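(* Let $\mathcal{H}$ be a complex separable infinite-dimensional Hilbert space and $T$ a bounded linear operator on $\mathcal{H}$ whose eigenvectors associated to unimodular eigenvalues are parametrized by a $\mathbb{T}$-eigenvector field $E$ which is $\mu$-spanning and analytic (a vector-valued analytic function in a neighbourhood of $\mathbb{T}$). Let $m$ be the associated Gaussian measure and $\mathcal{X},\mathcal{Y}$ the function spaces described in the context. Then there exist $t\in(0,1)$ and a positive constant $D(E)$ such that for all $f\in\mathcal{X}$ and $g\in\mathcal{Y}$, $$|\mathcal{I}_n(f,g)|\le D(E)\,t^n\,\|f\|_{\mathcal{X}}\,\|g\|_{\mathcal{Y}}$$ for every positive integer $n$.
   Context: The inner product of $\mathcal{H}$ is linear in the second variable and conjugate-linear in the first. $\mathbb{T}$ is the unit circle, $\mu$ normalized Lebesgue measure. A $\mathbb{T}$-eigenvector field is a bounded map $E:\mathbb{T}\to\mathcal{H}$ with $TE(\lambda)=\lambda E(\lambda)$; it is $\mu$-spanning if for every measurable $A\subset\mathbb{T}$ with $\mu(A)=1$ the vectors $E(\lambda)$, $\lambda\in A$, span a dense subspace. $R$ is defined by $\langle Rx,y\rangle=\int_{\mathbb{T}}\langle x,E(\lambda)\rangle\overline{\langle y,E(\lambda)\rangle}\,d\mu(\lambda)$ and $m$ is the Gaussian measure with covariance $R$ (each $\langle x,\cdot\rangle$ is complex symmetric Gaussian and $\int\langle x,z\rangle\overline{\langle y,z\rangle}dm(z)=\langle Rx,y\rangle$). $\mathcal{I}_n(f,g)=\int f(T^nx)g(x)\,dm(x)-\int f\,dm\int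 g\,dm$. Let $(e_j)_{j\ge1}$ be an orthonormal basis of eigenvectors of $R$, $Re_j=2\sigma_j^2e_j$; $\mathbb{Z}^*=\mathbb{Z}\setminus\{0\}$, $\mathfrak{e}_\ell=e_\ell$, $\mathfrak{e}_{-\ell}=ie_\ell$, $\sigma_{-\ell}=\sigma_\ell$. $L^2_{\mathbb{R}}$ is the real-valued part of $L^2(\mathcal{H},m)$; $\mathcal{G}$ the closed span of $\mathfrak{Re}\langle\mathfrak{e}_k,\cdot\rangle$; $\mathcal{G}^k$ the span of $k$-fold products of elements of $\mathcal{G}$; for $f\in\mathcal{G}^k$, $:f:=f-P_kf$ with $P_k$ the orthogonal projection onto the closed span of $\mathcal{G}^0,\dots,\mathcal{G}^{k-1}$; $:\mathcal{G}^k:$ is the closure of $\{:f:\}$, and $L^2_{\mathbb{R}}=\bigoplus_k:\mathcal{G}^k:$ orthogonally; $f_k$ is the projection of $f$ onto $:\mathcal{G}^k:$. With $\alpha^{(k)}_{i_1,\dots,i_k}=\langle f,:\mathfrak{Re}\langle\mathfrak{e}_{i_1},\cdot\rangle\cdots\mathfrak{Re}\langle\mathfrak{e}_{i_k},\cdot\rangle:\rangle_{L^2(m)}/(k!\sigma_{i_1}^2\cdots\sigma_{i_k}^2)$, let $\mathcal{B}_{f_k}(x^{(1)},\dots,x^{(k)})=\sum_{(i_1,\dots,i_k)\in(\mathbb{Z}^* )^k}\alpha^{(k)}_{i_1,\dots,i_k}x^{(1)}_{i_1}\cdots x^{(k)}_{i_k}$ on $\ell_2(\mathbb{Z}^*,\mathbb{R})^k$,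 with norm $\|\mathcal{B}_{f_k}\|$ the sup over unit vectors when bounded. $\mathcal{X}=\{f\in L^2_{\mathbb{R}}:\text{all }\mathcal{B}_{f_k}\text{ bounded},\ \sum_k\|\mathcal{B}_{f_k}\|^2<\infty\}$ with $\|f\|_{\mathcal{X}}=(\|f\|_{L^2(m)}^2+\sum_k\|\mathcal{B}_{f_k}\|^2)^{1/2}$; $\mathcal{Y}=\{g:\text{all }\mathcal{B}_{g_k}\text{ bounded},\ \sup_kk!\|\mathcal{B}_{g_k}\|<\infty\}$ with $\|g\|_{\mathcal{Y}}=\|g\|_{L^2(m)}+\sup_kk!\|\mathcal{B}_{g_k}\|$. *)

theory Defs
  imports "HOL-Probability.Probability"
begin

definition chilbert :: "(complex \<Rightarrow> 'h::banach \<Rightarrow> 'h) \<Rightarrow> ('h \<Rightarrow> 'h \<Rightarrow> complex) \<Rightarrow> bool" where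
  "chilbert cm ci \<longleftrightarrow>
     (\<forall>r x. cm (complex_of_real r) x = r *\<^sub>R x) \<and>
     (\<forall>a x y. cm a (x + y) = cm a x + cm a y) \<and>
     (\<forall>a b x. cm (a + b) x = cm a x + cm b x) \<and>
     (\<forall>a b x. cm a (cm b x) = cm (a * b) x) \<and>
     (\<forall>x y z. ci x (y + z) = ci x y + ci x z) \<and>
     (\<forall>a x y. ci x (cm a y) = a * ci x y) \<and>
     (\<forall>x y. ci y x = cnj (ci x y)) \<and>
     (\<forall>x. norm x = sqrt (Re (ci x x)))"

definition cspan :: "(complex \<Rightarrow> 'h::banach \<Rightarrow> 'h) \<Rightarrow> 'h set \<Rightarrow> 'h set" where
  "cspan cm S = {x. \<exists>F c. finite F \<and> F \<subseteq> S \<and> x = (\<Sum>v\<in>F. cm (c v) v)}"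

definition separable_space :: "'h::banach itself \<Rightarrow> bool" where
  "separable_space _ \<longleftrightarrow> (\<exists>D::'h set. countable D \<and> closure D = UNIV)"

definition infinite_dim :: "(complex \<Rightarrow> 'h::banach \<Rightarrow> 'h) \<Rightarrow> bool" where
  "infinite_dim cm \<longleftrightarrow> \<not> (\<exists>F. finite F \<and> cspan cm F = UNIV)"

definition cbounded_linear :: "(complex \<Rightarrow> 'h::banach \<Rightarrow> 'h) \<Rightarrow> ('h \<Rightarrow> 'h) \<Rightarrow> bool" where
  "cbounded_linear cm T \<longleftrightarrow> bounded_linear T \<and> (\<forall>a x. T (cm a x) = cm a (T x))"

definition circ :: "complex measure" where
  "circ = distr (uniform_measure lborel {0..2*pi}) borel cis"

definition eigenfield :: "(complex \<Rightarrow> 'h::banach \<Rightarrow> 'h) \<Rightarrow> ('h \<Rightarrow> 'h) \<Rightarrow> (complex \<Rightarrow> 'h) \<Rightarrow> bool" where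
  "eigenfield cm T E \<longleftrightarrow>
     (\<exists>B. \<forall>w\<in>sphere 0 1. norm (E w) \<le> B) \<and>
     (\<forall>w\<in>sphere 0 1. T (E w) = cm w (E w))"

definition mu_spanning :: "(complex \<Rightarrow> 'h::banach \<Rightarrow> 'h) \<Rightarrow> (complex \<Rightarrow> 'h) \<Rightarrow> bool" where
  "mu_spanning cm E \<longleftrightarrow>
     (\<forall>A\<in>sets borel. A \<subseteq> sphere 0 1 \<longrightarrow> emeasure circ A = 1 \<longrightarrow>
        closure (cspan cm (E ` A)) = UNIV)"

definition analytic_vec_on :: "(complex \<Rightarrow> 'h::banach \<Rightarrow> 'h) \<Rightarrow> (complex \<Rightarrow> 'h) \<Rightarrow> complex set \<Rightarrow> bool" where
  "analytic_vec_on cm E U \<longleftrightarrow>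
     (\<forall>z\<in>U. \<exists>r>0. \<exists>c::nat \<Rightarrow> 'h. \<forall>w. cmod (w - z) < r \<longrightarrow>
        (\<lambda>n. cm ((w - z) ^ n) (c n)) sums E w)"

definition analytic_near_circle :: "(complex \<Rightarrow> 'h::banach \<Rightarrow> 'h) \<Rightarrow> (complex \<Rightarrow> 'h) \<Rightarrow> bool" where
  "analytic_near_circle cm E \<longleftrightarrow>
     (\<exists>U. open U \<and> sphere 0 1 \<subseteq> U \<and> analytic_vec_on cm E U)"

text \<open>The covariance form: the right-hand side defining R.\<close>
definition covf :: "('h \<Rightarrow> 'h \<Rightarrow> complex) \<Rightarrow> (complex \<Rightarrow> 'h) \<Rightarrow> 'h \<Rightarrow> 'h \<Rightarrow> complex" where
  "covf ci E x y = (LINT w|circ. ci x (E w) * cnj (ci y (E w)))"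

definition csym_gaussian :: "'h measure \<Rightarrow> ('h \<Rightarrow> complex) \<Rightarrow> bool" where
  "csym_gaussian m X \<longleftrightarrow>
     (\<exists>v\<ge>0. \<forall>w. (LINT z|m. cis (Re (cnj w * X z))) = complex_of_real (exp (- (cmod w)\<^sup>2 * v / 4)))"

definition gaussian_cov :: "('h::banach \<Rightarrow> 'h \<Rightarrow> complex) \<Rightarrow> ('h \<Rightarrow> 'h) \<Rightarrow> 'h measure \<Rightarrow> bool" where
  "gaussian_cov ci R m \<longleftrightarrow>
     prob_space m \<and> sets m = sets borel \<and>
     (\<forall>x. csym_gaussian m (\<lambda>z. ci x z)) \<and>
     (\<forall>x y. integrable m (\<lambda>z. ci x z * cnj (ci y z)) \<and>
            (LINT z|m. ci x z * cnj (ci y z)) = ci (R x) y)"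

definition L2R :: "'h measure \<Rightarrow> ('h \<Rightarrow> real) set" where
  "L2R m = {f. f \<in> borel_measurable m \<and> integrable m (\<lambda>z. (f z)\<^sup>2)}"

definition l2norm :: "'h measure \<Rightarrow> ('h \<Rightarrow> real) \<Rightarrow> real" where
  "l2norm m f = sqrt (LINT z|m. (f z)\<^sup>2)"

definition l2cl :: "'h measure \<Rightarrow> ('h \<Rightarrow> real) set \<Rightarrow> ('h \<Rightarrow> real) set" where
  "l2cl m S = {f \<in> L2R m. \<exists>s. (\<forall>n. s n \<in> S) \<and> (\<lambda>n. l2norm m (\<lambda>z. f z - s n z)) \<longlonglongrightarrow> 0}"

definition rspan :: "('h \<Rightarrow> real) set \<Rightarrow> ('h \<Rightarrow> real) set" where
  "rspan S = {f. \<exists>F c. finite F \<and> F \<subseteq> S \<and> f = (\<lambda>z. \<Sum>g\<in>F. c g * g z)}"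

text \<open>Orthogonal projection in L2(m) onto a closed subspace V (a representative).\<close>
definition l2proj :: "'h measure \<Rightarrow> ('h \<Rightarrow> real) set \<Rightarrow> ('h \<Rightarrow> real) \<Rightarrow> ('h \<Rightarrow> real)" where
  "l2proj m V f = (SOME g. g \<in> V \<and> (\<forall>h\<in>V. (LINT z|m. (f z - g z) * h z) = 0))"

definition frake :: "(complex \<Rightarrow> 'h::banach \<Rightarrow> 'h) \<Rightarrow> (nat \<Rightarrow> 'h) \<Rightarrow> int \<Rightarrow> 'h" where
  "frake cm e l = (if l > 0 then e (nat l) else cm \<i> (e (nat (- l))))"

definition gfun :: "(complex \<Rightarrow> 'h::banach \<Rightarrow> 'h) \<Rightarrow> ('h \<Rightarrow> 'h \<Rightarrow> complex) \<Rightarrow> (nat \<Rightarrow> 'h) \<Rightarrow> int \<Rightarrow> 'h \<Rightarrow> real" where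
  "gfun cm ci e l = (\<lambda>z. Re (ci (frake cm e l) z))"

definition Gset where
  "Gset cm ci e m = l2cl m (rspan {gfun cm ci e l | l. l \<noteq> 0})"

definition Gpow where
  "Gpow cm ci e m k = rspan {(\<lambda>z. \<Prod>j<k. g j z) | g. \<forall>j<k. g j \<in> Gset cm ci e m}"

definition Glow where
  "Glow cm ci e m k = l2cl m (rspan (\<Union>j<k. Gpow cm ci e m j))"

definition wick where
  "wick cm ci e m k f = (\<lambda>z. f z - l2proj m (Glow cm ci e m k) f z)"

definition alpha where
  "alpha cm ci e \<sigma> m f is =
     (LINT z|m. f z * wick cm ci e m (length is) (\<lambda>z. prod_list (map (\<lambda>l. gfun cm ci e l z) is)) z)
     / (fact (length is) * prod_list (map (\<lambda>l. (\<sigma> (nat \<bar>l\<bar>))\<^sup>2) is))"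

text \<open>Evaluation on finitely supported vectors x 0, ..., x (k-1) in l2(Z*, R).\<close>
definition Bval :: "(int list \<Rightarrow> real) \<Rightarrow> nat \<Rightarrow> (nat \<Rightarrow> int \<Rightarrow> real) \<Rightarrow> real" where
  "Bval a k x = (\<Sum>is\<in>{is. length is = k \<and> set is \<subseteq> (\<Union>j<k. {i. x j i \<noteq> 0})}.
                   a is * (\<Prod>j<k. x j (is ! j)))"

definition unitfs :: "nat \<Rightarrow> (nat \<Rightarrow> int \<Rightarrow> real) \<Rightarrow> bool" where
  "unitfs k x \<longleftrightarrow> (\<forall>j<k. x j 0 = 0 \<and> finite {i. x j i \<noteq> 0} \<and> (\<Sum>i\<in>{i. x j i \<noteq> 0}. (x j i)\<^sup>2) = 1)"

definition Bvals :: "(int list \<Rightarrow> real) \<Rightarrow> nat \<Rightarrow> real set" where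
  "Bvals a k = {\<bar>Bval a k x\<bar> | x. unitfs k x}"

definition Bbdd :: "(int list \<Rightarrow> real) \<Rightarrow> nat \<Rightarrow> bool" where
  "Bbdd a k \<longleftrightarrow> bdd_above (Bvals a k)"

definition Bnorm :: "(int list \<Rightarrow> real) \<Rightarrow> nat \<Rightarrow> real" where
  "Bnorm a k = Sup (Bvals a k)"

definition Xsp where
  "Xsp cm ci e \<sigma> m = {f \<in> L2R m. (\<forall>k. Bbdd (alpha cm ci e \<sigma> m f) k) \<and>
                          summable (\<lambda>k. (Bnorm (alpha cm ci e \<sigma> m f) k)\<^sup>2)}"

definition Xnorm where
  "Xnorm cm ci e \<sigma> m f = sqrt ((l2norm m f)\<^sup>2 + (\<Sum>k. (Bnorm (alpha cm ci e \<sigma> m f) k)\<^sup>2))"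

definition Ysp where
  "Ysp cm ci e \<sigma> m = {g \<in> L2R m. (\<forall>k. Bbdd (alpha cm ci e \<sigma> m g) k) \<and>
                          bdd_above (range (\<lambda>k. fact k * Bnorm (alpha cm ci e \<sigma> m g) k))}"

definition Ynorm where
  "Ynorm cm ci e \<sigma> m g = l2norm m g + (SUP k. fact k * Bnorm (alpha cm ci e \<sigma> m g) k)"

definition Icorr :: "('h \<Rightarrow> 'h) \<Rightarrow> 'h measure \<Rightarrow> nat \<Rightarrow> ('h \<Rightarrow> real) \<Rightarrow> ('h \<Rightarrow> real) \<Rightarrow> real" where
  "Icorr T m n f g = (LINT z|m. f ((T ^^ n) z) * g z) - (LINT z|m. f z) * (LINT z|m. g z)"

end

theory Submission
  imports Defs "HOL-Complex_Analysis.Complex_Analysis" "HOL-Real_Asymp.Real_Asymp"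
begin

text \<open>
  Expand \<open>f\<close> and \<open>g\<close> in Wick products of the Gaussian coordinates. Composition with
  \<open>T^n\<close> replaces each coordinate by another Gaussian variable, and the covariance of two Wick
  products of the same length is the permanent of the matrix of covariances. Since the coefficients
  are symmetric, the contribution of degree \<open>k\<close> to the correlation is therefore
  \<open>k! \<Sum> \<alpha>_I \<beta>_J \<Prod>_l c(i_l, j_l)\<close> with \<open>c(i, j)\<close> half the real part of
  \<open>\<integral> w^n \<langle>e_i, E w\<rangle> cnj \<langle>e_j, E w\<rangle>\<close> over the unit circle. On the circle
  \<open>cnj \<langle>y, E w\<rangle>\<close> equals \<open>cnj \<langle>y, E (1 / cnj w)\<rangle>\<close>, which is analytic in \<open>w\<close>, so the
  circle of integration can be shrunk to a radius \<open>s < 1\<close>. Hence \<open>c\<close> is a limit of Riemann sums of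
  rank one kernels whose total norm is at most \<open>K = C s^n\<close>, and the degree \<open>k\<close> term is at
  most \<open>k! K^k\<close> times the product of the norms of the two \<open>k\<close>-linear forms. Summing a
  geometric series settles the case \<open>K \<le> 1/2\<close>; for larger \<open>K\<close>, that is for finitely many
  \<open>n\<close>, the Cauchy-Schwarz inequality suffices.
\<close>


section \<open>Square integrable functions\<close>

text \<open>A bound on the operator norm of the covariance kernel would not suffice: the multilinear
  forms are bounded only on tuples of vectors, while pairing two of them through the identity kernel
  is a Hilbert-Schmidt inner product, which their norms do not control. A kernel of rank one,
  however, evaluates both forms on such tuples, so the quantity to keep small is the sum of the
  products of norms in a decomposition into rank one kernels. A Riemann sum over a circle is such a
  decomposition, and Bessel's inequality bounds its total by the size of \<open>E\<close> on the
  circles of radii \<open>s\<close> and \<open>1 / s\<close>, uniformly in the number of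
  coordinates. The factorial left by the permanent is exactly the weight in \<open>Ynorm\<close>.

  Two features of the definitions shape the route. \<open>wick\<close> rests on a chosen projection
  and is determined only almost everywhere, so an explicit recursion \<open>wickp\<close> replaces
  it. Some \<open>\<sigma> j\<close> may be zero, so coefficients are characterised by an identity
  without division.\<close>

lemma L2R_D: assumes "f \<in> L2R M" shows "f \<in> borel_measurable M" "integrable M (\<lambda>z. (f z)\<^sup>2)"
  using assms by (auto simp: L2R_def)

lemma L2R_I: "f \<in> borel_measurable M \<Longrightarrow> integrable M (\<lambda>z. (f z)\<^sup>2) \<Longrightarrow> f \<in> L2R M"
  by (simp add: L2R_def)

lemma L2R_mult:
  assumes "f \<in> L2R M" "g \<in> L2R M" shows "integrable M (\<lambda>z. f z * g z)"
proof (rule Bochner_Integration.integrable_bound)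
  show "integrable M (\<lambda>z. (f z)\<^sup>2 + (g z)\<^sup>2)" using assms by (simp add: L2R_def)
  show "(\<lambda>z. f z * g z) \<in> borel_measurable M"
    using L2R_D(1)[OF assms(1)] L2R_D(1)[OF assms(2)] by simp
  have "\<bar>a * b\<bar> \<le> a\<^sup>2 + b\<^sup>2" for a b :: real
  proof -
    have "2 * \<bar>a\<bar> * \<bar>b\<bar> \<le> \<bar>a\<bar>\<^sup>2 + \<bar>b\<bar>\<^sup>2" by (rule sum_squares_bound)
    moreover have "0 \<le> \<bar>a\<bar> * \<bar>b\<bar>" by simp
    ultimately show ?thesis unfolding abs_mult power2_abs by linarith
  qed
  then show "AE z in M. norm (f z * g z) \<le> norm ((f z)\<^sup>2 + (g z)\<^sup>2)"
    by (intro AE_I2) simp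
qed

lemma L2R_scale: "f \<in> L2R M \<Longrightarrow> (\<lambda>z. c * f z) \<in> L2R M"
  by (auto intro!: L2R_I dest: L2R_D simp: power_mult_distrib)

lemma L2R_add:
  assumes "f \<in> L2R M" "g \<in> L2R M" shows "(\<lambda>z. f z + g z) \<in> L2R M"
proof -
  have "integrable M (\<lambda>z. (f z)\<^sup>2 + (g z)\<^sup>2 + 2 * (f z * g z))"
    using assms L2R_mult[OF assms] by (simp add: L2R_def)
  then show ?thesis
    using L2R_D(1)[OF assms(1)] L2R_D(1)[OF assms(2)]
    by (intro L2R_I) (simp_all add: power2_sum mult.assoc)
qed

lemma L2R_diff:
  assumes "f \<in> L2R M" "g \<in> L2R M" shows "(\<lambda>z. f z - g z) \<in> L2R M"
  using L2R_add[OF assms(1) L2R_scale[OF assms(2), of "-1"]] by simp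

lemma L2R_zero: "(\<lambda>z. 0) \<in> L2R M"
  by (simp add: L2R_def)

lemma L2R_sum: "(\<And>i. i \<in> A \<Longrightarrow> f i \<in> L2R M) \<Longrightarrow> (\<lambda>z. \<Sum>i\<in>A. f i z) \<in> L2R M"
  by (induction A rule: infinite_finite_induct) (auto intro: L2R_add L2R_zero)

lemma l2norm_nonneg: "0 \<le> l2norm M f"
  by (simp add: l2norm_def)

lemma l2norm_sq: "(l2norm M f)\<^sup>2 = (LINT z|M. f z * f z)"
  by (simp add: l2norm_def power2_eq_square)

lemma l2norm_scale: "l2norm M (\<lambda>z. c * f z) = \<bar>c\<bar> * l2norm M f"
  by (simp add: l2norm_def power_mult_distrib real_sqrt_mult)

lemma l2norm_minus_commute: "l2norm M (\<lambda>z. f z - g z) = l2norm M (\<lambda>z. g z - f z)"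
  by (simp add: l2norm_def power2_commute)

lemma l2norm_eq_0:
  assumes "f \<in> L2R M" shows "l2norm M f = 0 \<longleftrightarrow> (AE z in M. f z = 0)"
  using integral_nonneg_eq_0_iff_AE[OF L2R_D(2)[OF assms]] by (simp add: l2norm_def)

lemma integral_diff_square:
  assumes f: "f \<in> L2R M" and g: "g \<in> L2R M"
  shows "(LINT z|M. (a * f z - b * g z) * (a * f z - b * g z)) =
    a\<^sup>2 * (l2norm M f)\<^sup>2 - 2 * a * b * (LINT z|M. f z * g z) + b\<^sup>2 * (l2norm M g)\<^sup>2"
proof -
  have "(\<lambda>z. (a * f z - b * g z) * (a * f z - b * g z)) =
     (\<lambda>z. a\<^sup>2 * (f z * f z) - 2 * a * b * (f z * g z) + b\<^sup>2 * (g z * g z))"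
    by (auto simp: algebra_simps power2_eq_square)
  then show ?thesis
    using L2R_mult[OF f f] L2R_mult[OF f g] L2R_mult[OF g g] by (simp add: l2norm_sq)
qed

text \<open>With \<open>A\<close> and \<open>B\<close> the two norms, the squares of
  \<open>B f - A g\<close> and \<open>B f + A g\<close> integrate to \<open>2 A B (A B - I)\<close>
  and \<open>2 A B (A B + I)\<close>. Both are nonnegative; cancelling \<open>A B\<close> is the
  reason for the separate null case.\<close>

lemma l2_Cauchy_Schwarz:
  assumes f: "f \<in> L2R M" and g: "g \<in> L2R M"
  shows "\<bar>LINT z|M. f z * g z\<bar> \<le> l2norm M f * l2norm M g"
proof (cases "l2norm M f = 0 \<or> l2norm M g = 0")
  case True
  then have "AE z in M. f z * g z = 0"
    using l2norm_eq_0[OF f] l2norm_eq_0[OF g] by auto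
  then have "(LINT z|M. f z * g z) = (LINT z|M. 0)"
    by (intro integral_cong_AE borel_measurable_times borel_measurable_const L2R_D(1)[OF f] L2R_D(1)[OF g])
  then show ?thesis by (simp add: l2norm_nonneg)
next
  case False
  define A B I where "A = l2norm M f" and "B = l2norm M g" and "I = (LINT z|M. f z * g z)"
  have AB: "A * B > 0" using False l2norm_nonneg[of M] by (simp add: A_def B_def order_less_le)
  have "0 \<le> (LINT z|M. (B * f z - A * g z) * (B * f z - A * g z))"
    "0 \<le> (LINT z|M. (B * f z - (-A) * g z) * (B * f z - (-A) * g z))"
    by (intro integral_nonneg_AE AE_I2 zero_le_square)+
  then have "0 \<le> 2 * (A * B) * (A * B - I)" "0 \<le> 2 * (A * B) * (A * B + I)"
    unfolding integral_diff_square[OF f g]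
    by (simp_all add: A_def B_def I_def algebra_simps power2_eq_square)
  then have "0 \<le> A * B - I" "0 \<le> A * B + I"
    using AB mult_le_0_iff zero_le_mult_iff[of "2 * (A * B)" "A * B - I"] zero_le_mult_iff[of "2 * (A * B)" "A * B + I"] by linarith+
  then show ?thesis by (simp add: A_def B_def I_def)
qed

lemma l2norm_triangle:
  assumes f: "f \<in> L2R M" and g: "g \<in> L2R M"
  shows "l2norm M (\<lambda>z. f z + g z) \<le> l2norm M f + l2norm M g"
proof -
  have "(l2norm M (\<lambda>z. f z + g z))\<^sup>2 = (l2norm M f)\<^sup>2 + 2 * (LINT z|M. f z * g z) + (l2norm M g)\<^sup>2"
    using integral_diff_square[OF f g, of 1 "-1"] by (simp add: l2norm_sq)
  also have "\<dots> \<le> (l2norm M f + l2norm M g)\<^sup>2"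
    using l2_Cauchy_Schwarz[OF f g] by (simp add: power2_sum)
  finally show ?thesis by (rule power2_le_imp_le) (simp add: l2norm_nonneg)
qed

text \<open>The difference of the products is
  \<open>f (g - G) + (f - F) g - (f - F) (g - G)\<close>, and Cauchy-Schwarz controls each term.
  Limits of inner products below are taken by this lemma.\<close>

lemma l2_tendsto_integral_mult:
  assumes f: "f \<in> L2R M" and g: "g \<in> L2R M"
    and F: "\<And>n. F n \<in> L2R M" and G: "\<And>n. G n \<in> L2R M"
    and Ff: "(\<lambda>n. l2norm M (\<lambda>z. f z - F n z)) \<longlonglongrightarrow> 0"
    and Gg: "(\<lambda>n. l2norm M (\<lambda>z. g z - G n z)) \<longlonglongrightarrow> 0"
  shows "(\<lambda>n. LINT z|M. F n z * G n z) \<longlonglongrightarrow> (LINT z|M. f z * g z)"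
proof -
  have dF: "(\<lambda>z. f z - F n z) \<in> L2R M" and dG: "(\<lambda>z. g z - G n z) \<in> L2R M" for n
    using f g F G by (auto intro: L2R_diff)
  define b where "b = (\<lambda>n. l2norm M f * l2norm M (\<lambda>z. g z - G n z) + l2norm M (\<lambda>z. f z - F n z) * l2norm M g
      + l2norm M (\<lambda>z. f z - F n z) * l2norm M (\<lambda>z. g z - G n z))"
  have le: "norm ((LINT z|M. F n z * G n z) - (LINT z|M. f z * g z)) \<le> b n" for n
  proof -
    have "(LINT z|M. f z * g z) - (LINT z|M. F n z * G n z) =
       (LINT z|M. f z * g z - F n z * G n z)"
      using L2R_mult[OF f g] L2R_mult[OF F G] by simp
    also have "\<dots> = (LINT z|M. f z * (g z - G n z) + (f z - F n z) * g z - (f z - F n z) * (g z - G n z))"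
      by (intro Bochner_Integration.integral_cong) (auto simp: algebra_simps)
    also have "\<dots> = (LINT z|M. f z * (g z - G n z)) + (LINT z|M. (f z - F n z) * g z)
       - (LINT z|M. (f z - F n z) * (g z - G n z))"
      using L2R_mult[OF f dG] L2R_mult[OF dF g] L2R_mult[OF dF dG] by simp
    finally show ?thesis
      using l2_Cauchy_Schwarz[OF f dG[of n]] l2_Cauchy_Schwarz[OF dF[of n] g] l2_Cauchy_Schwarz[OF dF[of n] dG[of n]]
      unfolding b_def real_norm_def by linarith
  qed
  have "b \<longlonglongrightarrow> l2norm M f * 0 + 0 * l2norm M g + 0 * 0"
    unfolding b_def by (intro tendsto_intros Ff Gg)
  then have "b \<longlonglongrightarrow> 0" by simp
  then have "(\<lambda>n. (LINT z|M. F n z * G n z) - (LINT z|M. f z * g z)) \<longlonglongrightarrow> 0"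
    by (rule Lim_null_comparison[OF always_eventually[OF allI[OF le]]])
  then show ?thesis by (rule LIM_zero_cancel)
qed

lemma (in prob_space) L2R_integrable: "f \<in> L2R M \<Longrightarrow> integrable M f"
  using square_integrable_imp_integrable by (auto simp: L2R_def)

lemma (in prob_space) L2R_const: "(\<lambda>z. c) \<in> L2R M"
  by (simp add: L2R_def)

lemma (in prob_space) integral_abs_le_l2norm:
  assumes f: "f \<in> L2R M" shows "(LINT z|M. \<bar>f z\<bar>) \<le> l2norm M f"
proof -
  have a: "(\<lambda>z. \<bar>f z\<bar>) \<in> L2R M" using L2R_D[OF f] by (intro L2R_I) simp_all
  show ?thesis using l2_Cauchy_Schwarz[OF a L2R_const[of 1]] by (simp add: l2norm_def prob_space)
qed

text \<open>Riesz-Fischer for functions instead of classes: the increments of a fast subsequence are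
  summable in L1, hence almost everywhere, and Fatou's lemma turns the Cauchy estimate into an
  estimate of the distance to the pointwise limit.\<close>

lemma (in prob_space) l2_complete:
  assumes s: "\<And>n. s n \<in> L2R M"
    and cauchy: "\<And>\<epsilon>. 0 < \<epsilon> \<Longrightarrow> \<exists>N. \<forall>i\<ge>N. \<forall>j\<ge>N. l2norm M (\<lambda>z. s i z - s j z) < \<epsilon>"
  obtains F where "F \<in> L2R M" "(\<lambda>n. l2norm M (\<lambda>z. F z - s n z)) \<longlonglongrightarrow> 0"
proof -
  have meas[measurable]: "s n \<in> borel_measurable M" for n using s L2R_D by blast
  have "\<forall>k. \<exists>N. \<forall>i\<ge>N. \<forall>j\<ge>N. l2norm M (\<lambda>z. s i z - s j z) < (1/2)^k"
    using cauchy by simp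
  then obtain N where N: "\<And>k i j. i \<ge> N k \<Longrightarrow> j \<ge> N k \<Longrightarrow> l2norm M (\<lambda>z. s i z - s j z) < (1/2)^k"
    by metis
  \<comment> \<open>Cumulative sums place \<open>r k\<close> beyond every threshold
    \<open>N i\<close> with \<open>i \<le> k\<close>.\<close>
  define r where "r k = (\<Sum>i\<le>k. N i)" for k
  have r1: "r k \<ge> N i" if "i \<le> k" for i k
    unfolding r_def using that by (intro member_le_sum) auto
  define d where "d k z = s (r (Suc k)) z - s (r k) z" for k z
  have dL: "d k \<in> L2R M" for k
    unfolding d_def[abs_def] by (intro L2R_diff s)
  then have dm[measurable]: "d k \<in> borel_measurable M" for k using L2R_D by blast
  have dn: "(LINT z|M. \<bar>d k z\<bar>) \<le> (1/2)^k" for k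
  proof -
    have "l2norm M (d k) < (1/2)^k"
      unfolding d_def[abs_def] by (rule N) (auto intro: r1)
    then show ?thesis using integral_abs_le_l2norm[OF dL, of k] by simp
  qed
  have "(\<integral>\<^sup>+z. (\<Sum>k. ennreal \<bar>d k z\<bar>) \<partial>M) = (\<Sum>k. \<integral>\<^sup>+z. ennreal \<bar>d k z\<bar> \<partial>M)"
    by (intro nn_integral_suminf) simp
  also have "\<dots> \<le> (\<Sum>k. ennreal ((1/2)^k))"
  proof (intro suminf_le allI summableI)
    fix k
    have "(\<integral>\<^sup>+z. ennreal \<bar>d k z\<bar> \<partial>M) = ennreal (LINT z|M. \<bar>d k z\<bar>)"
      using L2R_integrable[OF dL] by (intro nn_integral_eq_integral) auto
    then show "(\<integral>\<^sup>+z. ennreal \<bar>d k z\<bar> \<partial>M) \<le> ennreal ((1/2)^k)"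
      using dn[of k] by (simp add: ennreal_leI)
  qed
  also have "\<dots> < top"
    by (subst suminf_ennreal2) (auto intro!: summable_geometric)
  finally have "AE z in M. (\<Sum>k. ennreal \<bar>d k z\<bar>) \<noteq> \<infinity>"
    by (intro nn_integral_PInf_AE) auto
  then have conv: "AE z in M. convergent (\<lambda>k. s (r k) z)"
  proof eventually_elim
    case (elim z)
    then have "summable (\<lambda>k. \<bar>d k z\<bar>)"
      by (intro summable_suminf_not_top) auto
    then have "summable (\<lambda>k. d k z)" by (rule summable_rabs_cancel)
    then have "convergent (\<lambda>n. \<Sum>k<n. d k z)" by (simp add: summable_iff_convergent)
    moreover have "(\<Sum>k<n. d k z) = s (r n) z - s (r 0) z" for n
      unfolding d_def by (rule sum_lessThan_telescope)
    ultimately have "convergent (\<lambda>n. (s (r n) z - s (r 0) z) + s (r 0) z)"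
      by (intro convergent_add convergent_const) simp
    then show ?case by simp
  qed
  \<comment> \<open>Where the subsequence diverges \<open>lim\<close> is an unspecified value; this
    concerns a null set only, and \<open>F\<close> is measurable all the same.\<close>
  define F where "F z = lim (\<lambda>k. s (r k) z)" for z
  have Fm[measurable]: "F \<in> borel_measurable M"
    unfolding F_def[abs_def] by measurable
  have lim: "AE z in M. (\<lambda>k. s (r k) z) \<longlonglongrightarrow> F z"
    using conv by eventually_elim (simp add: F_def convergent_LIMSEQ_iff)
  have bound: "(\<integral>\<^sup>+z. ennreal ((F z - s n z)\<^sup>2) \<partial>M) \<le> ennreal (((1/2)^k)\<^sup>2)" if n: "n \<ge> N k" for n k
  proof -
    have "(\<integral>\<^sup>+z. ennreal ((F z - s n z)\<^sup>2) \<partial>M)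
        = (\<integral>\<^sup>+z. liminf (\<lambda>j. ennreal ((s (r j) z - s n z)\<^sup>2)) \<partial>M)"
    proof (rule nn_integral_cong_AE)
      show "AE z in M. ennreal ((F z - s n z)\<^sup>2) = liminf (\<lambda>j. ennreal ((s (r j) z - s n z)\<^sup>2))"
        using lim
      proof eventually_elim
        case (elim z)
        have "(\<lambda>j. ennreal ((s (r j) z - s n z)\<^sup>2)) \<longlonglongrightarrow> ennreal ((F z - s n z)\<^sup>2)"
          by (intro tendsto_ennrealI tendsto_intros elim)
        then show ?case by (intro lim_imp_Liminf[symmetric]) simp_all
      qed
    qed
    also have "\<dots> \<le> liminf (\<lambda>j. \<integral>\<^sup>+z. ennreal ((s (r j) z - s n z)\<^sup>2) \<partial>M)"
      by (rule nn_integral_liminf) simp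
    also have "\<dots> \<le> limsup (\<lambda>j. \<integral>\<^sup>+z. ennreal ((s (r j) z - s n z)\<^sup>2) \<partial>M)"
      by (rule Liminf_le_Limsup) simp
    also have "\<dots> \<le> ennreal (((1/2)^k)\<^sup>2)"
    proof (rule Limsup_bounded, rule eventually_sequentiallyI[of k])
      fix j assume j: "k \<le> j"
      have "(\<integral>\<^sup>+z. ennreal ((s (r j) z - s n z)\<^sup>2) \<partial>M) = ennreal (LINT z|M. (s (r j) z - s n z)\<^sup>2)"
        using L2R_D(2)[OF L2R_diff[OF s s]] by (intro nn_integral_eq_integral) auto
      also have "\<dots> = ennreal ((l2norm M (\<lambda>z. s (r j) z - s n z))\<^sup>2)"
        unfolding l2norm_sq by (simp add: power2_eq_square)
      also have "\<dots> \<le> ennreal (((1/2)^k)\<^sup>2)"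
        using N[of k "r j" n] n r1[OF j] l2norm_nonneg by (intro ennreal_leI power_mono) (auto intro: less_imp_le)
      finally show "(\<integral>\<^sup>+z. ennreal ((s (r j) z - s n z)\<^sup>2) \<partial>M) \<le> ennreal (((1/2)^k)\<^sup>2)" .
    qed
    finally show ?thesis .
  qed
  have dF: "(\<lambda>z. F z - s n z) \<in> L2R M" if n: "n \<ge> N k" for n k
  proof (rule L2R_I)
    show "integrable M (\<lambda>z. (F z - s n z)\<^sup>2)"
      using order_le_less_trans[OF bound[OF n] ennreal_less_top]
      by (intro integrableI_nonneg) auto
  qed simp
  have FL: "F \<in> L2R M"
    using L2R_add[OF dF[OF order_refl, of 0] s[of "N 0"]] by simp
  have nb: "l2norm M (\<lambda>z. F z - s n z) \<le> (1/2)^k" if n: "n \<ge> N k" for n k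
  proof -
    have "ennreal (LINT z|M. (F z - s n z)\<^sup>2) \<le> ennreal (((1/2)^k)\<^sup>2)"
      using bound[OF n] L2R_D(2)[OF dF[OF n]]
      by (subst nn_integral_eq_integral[symmetric]) auto
    then have "(LINT z|M. (F z - s n z)\<^sup>2) \<le> ((1/2)^k)\<^sup>2"
      by (subst (asm) ennreal_le_iff) auto
    then show ?thesis unfolding l2norm_def by (intro real_le_lsqrt) auto
  qed
  have "(\<lambda>n. l2norm M (\<lambda>z. F z - s n z)) \<longlonglongrightarrow> 0"
  proof (rule LIMSEQ_I)
    fix e :: real assume "e > 0"
    then obtain k where k: "(1/2)^k < e" using real_arch_pow_inv[of e "1/2"] by auto
    have "norm (l2norm M (\<lambda>z. F z - s n z) - 0) < e" if "n \<ge> N k" for n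
      using nb[OF that] k l2norm_nonneg[of M "\<lambda>z. F z - s n z"] by simp
    then show "\<exists>no. \<forall>n\<ge>no. norm (l2norm M (\<lambda>z. F z - s n z) - 0) < e" by blast
  qed
  with FL show ?thesis by (rule that)
qed

section \<open>Uniqueness of Fourier transforms of signed and complex densities\<close>

text \<open>The case \<open>t = 0\<close> shows that the positive and negative parts of
  \<open>h\<close> have the same mass \<open>c\<close>. Divided by \<open>c\<close> they become
  probability densities, whose images under \<open>X\<close> have equal characteristic functions,
  and Levy's theorem identifies these images.\<close>

lemma fourier_uniqueness_real:
  fixes h :: "'a \<Rightarrow> real"
  assumes h: "integrable M h" and X[measurable]: "X \<in> borel_measurable M"
    and zero: "\<And>t. (LINT z|M. h z *\<^sub>R cis (t * X z)) = 0"
    and B[measurable]: "B \<in> sets borel"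
  shows "(LINT z|M. h z * indicator B (X z)) = 0"
proof -
  define hp hm where "hp z = max 0 (h z)" and "hm z = max 0 (- h z)" for z
  have hpm: "h z = hp z - hm z" "hp z \<ge> 0" "hm z \<ge> 0" for z by (auto simp: hp_def hm_def)
  have hmeas[measurable]: "h \<in> borel_measurable M" using h by simp
  have ip: "integrable M hp" and im: "integrable M hm"
    unfolding hp_def[abs_def] hm_def[abs_def] using h by auto
  have [measurable]: "hp \<in> borel_measurable M" "hm \<in> borel_measurable M" using ip im by auto
  have intc: "integrable M (\<lambda>z. k z *\<^sub>R cis (t * X z))" if k: "integrable M k" for k :: "'a \<Rightarrow> real" and t
  proof (rule Bochner_Integration.integrable_bound[OF k])
    have "k \<in> borel_measurable M" using k by simp
    then show "(\<lambda>z. k z *\<^sub>R cis (t * X z)) \<in> borel_measurable M"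
      unfolding cis_conv_exp by measurable
  qed simp
  have eq: "(LINT z|M. hp z *\<^sub>R cis (t * X z)) = (LINT z|M. hm z *\<^sub>R cis (t * X z))" for t
    using zero[of t] intc[OF ip, of t] intc[OF im, of t] by (simp add: hpm(1) scaleR_diff_left)
  define c where "c = (LINT z|M. hp z)"
  have "(LINT z|M. complex_of_real (hp z)) = (LINT z|M. complex_of_real (hm z))"
    using eq[of 0] by (simp add: scaleR_conv_of_real)
  then have c2: "c = (LINT z|M. hm z)" by (simp add: c_def)
  have c0: "c \<ge> 0" unfolding c_def by (intro integral_nonneg_AE AE_I2 hpm)
  have iB: "integrable M (\<lambda>z. k z * indicator B (X z))" if k: "integrable M k" for k :: "'a \<Rightarrow> real"
  proof (rule Bochner_Integration.integrable_bound[OF k])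
    have "k \<in> borel_measurable M" using k by simp
    then show "(\<lambda>z. k z * indicator B (X z)) \<in> borel_measurable M" by measurable
  qed (auto simp: indicator_def)
  have "(LINT z|M. hp z * indicator B (X z)) = (LINT z|M. hm z * indicator B (X z))"
  proof (cases "c = 0")
    case True
    then have "AE z in M. hp z = 0" "AE z in M. hm z = 0"
      using integral_nonneg_eq_0_iff_AE[OF ip] integral_nonneg_eq_0_iff_AE[OF im] c2 c_def hpm by auto
    then show ?thesis by (intro integral_cong_AE) auto
  next
    case False
    then have c: "c > 0" using c0 by simp
    define D where "D k = distr (density M (\<lambda>z. ennreal (k z / c))) borel X" for k
    have D: "real_distribution (D k) \<and> char (D k) t = (LINT z|M. k z *\<^sub>R cis (t * X z)) / c
        \<and> measure (D k) B = (LINT z|M. k z * indicator B (X z)) / c"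
      if k: "integrable M k" and k0: "\<And>z. k z \<ge> 0" and kc: "c = (LINT z|M. k z)" for k t
    proof -
      have [measurable]: "k \<in> borel_measurable M" using k by simp
      have "emeasure (density M (\<lambda>z. ennreal (k z / c))) (space M) = (\<integral>\<^sup>+z. ennreal (k z / c) \<partial>M)"
        by (subst emeasure_density) (auto intro!: nn_integral_cong)
      also have "\<dots> = ennreal (LINT z|M. k z / c)"
        using k k0 c by (intro nn_integral_eq_integral) auto
      also have "\<dots> = 1" using c kc by simp
      finally interpret P: prob_space "density M (\<lambda>z. ennreal (k z / c))"
        by (intro prob_spaceI) simp
      have rd: "real_distribution (D k)" unfolding D_def by (rule P.real_distribution_distr) simp
      have "char (D k) t = (LINT z|density M (\<lambda>z. ennreal (k z / c)). cis (t * X z))"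
        unfolding D_def char_def cis_conv_exp by (subst integral_distr) auto
      also have "\<dots> = (LINT z|M. (k z / c) *\<^sub>R cis (t * X z))"
        using k0 c by (intro integral_density) (auto simp: cis_conv_exp)
      also have "\<dots> = (LINT z|M. k z *\<^sub>R cis (t * X z) / c)"
        by (simp add: scaleR_conv_of_real)
      finally have ch: "char (D k) t = (LINT z|M. k z *\<^sub>R cis (t * X z)) / c" by simp
      interpret R: real_distribution "D k" by (rule rd)
      have "measure (D k) B = (LINT x|D k. indicator B x)" by simp
      also have "\<dots> = (LINT z|density M (\<lambda>z. ennreal (k z / c)). indicator B (X z))"
        unfolding D_def by (subst integral_distr) auto
      also have "\<dots> = (LINT z|M. (k z / c) *\<^sub>R indicator B (X z))"
        using k0 c by (intro integral_density) auto
      also have "\<dots> = (LINT z|M. k z * indicator B (X z) / c)" by simp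
      finally have "measure (D k) B = (LINT z|M. k z * indicator B (X z)) / c" by simp
      with rd ch show ?thesis by blast
    qed
    have "D hp = D hm"
    proof (rule Levy_uniqueness)
      show "char (D hp) = char (D hm)"
        using D[OF ip hpm(2) c_def] D[OF im hpm(3) c2] eq by (intro ext) simp
    qed (use D[OF ip hpm(2) c_def] D[OF im hpm(3) c2] in auto)
    then show ?thesis using D[OF ip hpm(2) c_def] D[OF im hpm(3) c2] c by auto
  qed
  then show ?thesis using iB[OF ip] iB[OF im] by (simp add: hpm(1) left_diff_distrib)
qed

text \<open>Conjugation turns the frequency \<open>t\<close> into \<open>-t\<close>, so the
  transform of \<open>cnj H\<close> vanishes too. The real and imaginary parts of \<open>H\<close>
  are combinations of \<open>H\<close> and \<open>cnj H\<close>.\<close>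

lemma fourier_uniqueness_complex:
  fixes H :: "'a \<Rightarrow> complex"
  assumes H: "integrable M H" and X[measurable]: "X \<in> borel_measurable M"
    and zero: "\<And>t. (LINT z|M. H z * cis (t * X z)) = 0"
    and B[measurable]: "B \<in> sets borel"
  shows "(LINT z|M. H z * indicator B (X z)) = 0"
proof -
  have [measurable]: "H \<in> borel_measurable M" using H by simp
  have [measurable]: "(\<lambda>z. cnj (H z)) \<in> borel_measurable M"
    using H by (intro borel_measurable_integrable integrable_cnj)
  have i1: "integrable M (\<lambda>z. H z * cis (t * X z))" for t
    by (rule Bochner_Integration.integrable_bound[OF H]) (auto simp: cis_conv_exp norm_mult)
  have i2: "integrable M (\<lambda>z. cnj (H z) * cis (t * X z))" for t
    by (rule Bochner_Integration.integrable_bound[OF H]) (auto simp: cis_conv_exp norm_mult)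
  have cn: "(LINT z|M. cnj (H z) * cis (t * X z)) = 0" for t
  proof -
    have "(LINT z|M. cnj (H z) * cis (t * X z)) = (LINT z|M. cnj (H z * cis ((- t) * X z)))"
      by (simp add: cis_cnj)
    also have "\<dots> = cnj (LINT z|M. H z * cis ((- t) * X z))"
      by (rule Bochner_Integration.integral_cnj)
    finally show ?thesis by (simp only: zero complex_cnj_zero)
  qed
  have re: "(LINT z|M. Re (H z) *\<^sub>R cis (t * X z)) = 0" for t
  proof -
    have "Re (H z) *\<^sub>R cis (t * X z) = (H z * cis (t * X z) + cnj (H z) * cis (t * X z)) / 2" for z
      by (simp add: distrib_right[symmetric] complex_add_cnj scaleR_conv_of_real)
    then have "(LINT z|M. Re (H z) *\<^sub>R cis (t * X z)) = (LINT z|M. (H z * cis (t * X z) + cnj (H z) * cis (t * X z)) / 2)"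
      by (intro Bochner_Integration.integral_cong refl)
    then show ?thesis using i1 i2 zero cn by simp
  qed
  have im: "(LINT z|M. Im (H z) *\<^sub>R cis (t * X z)) = 0" for t
  proof -
    have "Im (H z) *\<^sub>R cis (t * X z) = (H z * cis (t * X z) - cnj (H z) * cis (t * X z)) / (2 * \<i>)" for z
      by (simp add: complex_eq_iff)
    then have "(LINT z|M. Im (H z) *\<^sub>R cis (t * X z)) = (LINT z|M. (H z * cis (t * X z) - cnj (H z) * cis (t * X z)) / (2 * \<i>))"
      by (intro Bochner_Integration.integral_cong refl)
    then show ?thesis using i1 i2 zero cn by simp
  qed
  have iB: "integrable M (\<lambda>z. H z * indicator B (X z))"
    by (rule Bochner_Integration.integrable_bound[OF H]) (auto simp: indicator_def)
  show ?thesis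
  proof (rule complex_eqI)
    have "Re (LINT z|M. H z * indicator B (X z)) = (LINT z|M. Re (H z * indicator B (X z)))"
      by (rule integral_Re[OF iB, symmetric])
    also have "\<dots> = (LINT z|M. Re (H z) * indicator B (X z))"
      by (intro Bochner_Integration.integral_cong) (auto simp: indicator_def)
    also have "\<dots> = 0" using H by (intro fourier_uniqueness_real re) auto
    finally show "Re (LINT z|M. H z * indicator B (X z)) = Re 0" by simp
    have "Im (LINT z|M. H z * indicator B (X z)) = (LINT z|M. Im (H z * indicator B (X z)))"
      by (rule integral_Im[OF iB, symmetric])
    also have "\<dots> = (LINT z|M. Im (H z) * indicator B (X z))"
      by (intro Bochner_Integration.integral_cong) (auto simp: indicator_def)
    also have "\<dots> = 0" using H by (intro fourier_uniqueness_real im) auto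
    finally show "Im (LINT z|M. H z * indicator B (X z)) = Im 0" by simp
  qed
qed

text \<open>Characters are exchanged for indicators one coordinate at a time. At stage
  \<open>k\<close> the indicators already obtained and the exponential in the later coordinates form
  a complex weight, to which the one-dimensional statement applies in the variable
  \<open>X k\<close>.\<close>

lemma fourier_uniqueness_cylinder:
  fixes h :: "'a \<Rightarrow> real" and X :: "nat \<Rightarrow> 'a \<Rightarrow> real"
  assumes h: "integrable M h" and X[measurable]: "\<And>l. X l \<in> borel_measurable M"
    and zero: "\<And>t. (LINT z|M. h z *\<^sub>R cis (\<Sum>l<d. t l * X l z)) = 0"
    and B[measurable]: "\<And>l. B l \<in> sets borel"
  shows "(LINT z|M. h z * (\<Prod>l<d. indicator (B l) (X l z))) = 0"
proof -
  have [measurable]: "h \<in> borel_measurable M" using h by simp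
  have "\<forall>t. (LINT z|M. (h z * (\<Prod>l<k. indicator (B l) (X l z))) *\<^sub>R cis (\<Sum>l\<in>{k..<d}. t l * X l z)) = 0"
    if "k \<le> d" for k
    using that
  proof (induction k)
    case 0
    then show ?case using zero by (simp add: atLeast0LessThan)
  next
    case (Suc k)
    show ?case
    proof
      fix t :: "nat \<Rightarrow> real"
      define H where "H z = (h z * (\<Prod>l<k. indicator (B l) (X l z))) *\<^sub>R cis (\<Sum>l\<in>{Suc k..<d}. t l * X l z)" for z
      have p: "\<bar>\<Prod>l<k. indicator (B l) (X l z) :: real\<bar> \<le> 1" for z
        unfolding abs_prod by (intro prod_le_1) (auto simp: indicator_def)
      have Hm[measurable]: "H \<in> borel_measurable M"
        unfolding H_def cis_conv_exp by measurable
      have Hi: "integrable M H"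
        by (rule Bochner_Integration.integrable_bound[OF h])
          (auto simp: H_def abs_mult intro!: mult_left_le p)
      have "(LINT z|M. H z * indicator (B k) (X k z)) = 0"
      proof (rule fourier_uniqueness_complex[OF Hi X _ B])
        fix s
        have "H z * cis (s * X k z) = (h z * (\<Prod>l<k. indicator (B l) (X l z))) *\<^sub>R
           cis (\<Sum>l\<in>{k..<d}. (t(k := s)) l * X l z)" for z
        proof -
          have "{k..<d} = insert k {Suc k..<d}" using Suc.prems by auto
          then have "(\<Sum>l\<in>{k..<d}. (t(k := s)) l * X l z) = s * X k z + (\<Sum>l\<in>{Suc k..<d}. t l * X l z)"
            by simp
          then show ?thesis by (simp add: H_def cis_mult[symmetric])
        qed
        then show "(LINT z|M. H z * cis (s * X k z)) = 0"
          using Suc.IH Suc.prems by simp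
      qed
      moreover have "H z * indicator (B k) (X k z) = (h z * (\<Prod>l<Suc k. indicator (B l) (X l z))) *\<^sub>R cis (\<Sum>l\<in>{Suc k..<d}. t l * X l z)" for z
        by (auto simp: H_def indicator_def)
      ultimately show "(LINT z|M. (h z * (\<Prod>l<Suc k. indicator (B l) (X l z))) *\<^sub>R cis (\<Sum>l\<in>{Suc k..<d}. t l * X l z)) = 0"
        by simp
    qed
  qed
  from this[OF order_refl] have "(LINT z|M. complex_of_real (h z * (\<Prod>l<d. indicator (B l) (X l z)))) = 0"
    by (simp add: scaleR_conv_of_real)
  then show ?thesis by (simp only: integral_complex_of_real of_real_eq_0_iff)
qed

section \<open>Contractions, Wick products and permanents\<close>

lemma rspan_base: "f \<in> S \<Longrightarrow> f \<in> rspan S"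
  unfolding rspan_def by (intro CollectI exI[of _ "{f}"] exI[of _ "\<lambda>_. 1"]) auto

lemma rspan_zero: "(\<lambda>z. 0) \<in> rspan S"
  unfolding rspan_def by (intro CollectI exI[of _ "{}"]) auto

lemma rspan_scale:
  assumes "f \<in> rspan S" shows "(\<lambda>z. a * f z) \<in> rspan S"
proof -
  obtain F c where "finite F" "F \<subseteq> S" "f = (\<lambda>z. \<Sum>g\<in>F. c g * g z)" using assms by (auto simp: rspan_def)
  then show ?thesis unfolding rspan_def
    by (intro CollectI exI[of _ F] exI[of _ "\<lambda>g. a * c g"]) (auto simp: sum_distrib_left mult.assoc)
qed

lemma rspan_add:
  assumes "f \<in> rspan S" "g \<in> rspan S" shows "(\<lambda>z. f z + g z) \<in> rspan S"
proof -
  obtain F c where F: "finite F" "F \<subseteq> S" "f = (\<lambda>z. \<Sum>g\<in>F. c g * g z)" using assms(1) by (auto simp: rspan_def)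
  obtain F' c' where F': "finite F'" "F' \<subseteq> S" "g = (\<lambda>z. \<Sum>g\<in>F'. c' g * g z)" using assms(2) by (auto simp: rspan_def)
  \<comment> \<open>The coefficients are indexed by the functions themselves, so a function
    occurring in both sums receives the sum of its two coefficients.\<close>
  define d where "d h = (if h \<in> F then c h else 0) + (if h \<in> F' then c' h else 0)" for h
  have "f z + g z = (\<Sum>h\<in>F \<union> F'. d h * h z)" for z
  proof -
    have "(\<Sum>h\<in>F \<union> F'. (if h \<in> F then c h else 0) * h z) = f z"
      using F F' by (simp add: if_distrib[of "\<lambda>x. x * _"] sum.If_cases Int_absorb1 cong: if_cong)
    moreover have "(\<Sum>h\<in>F \<union> F'. (if h \<in> F' then c' h else 0) * h z) = g z"
      using F F' by (simp add: if_distrib[of "\<lambda>x. x * _"] sum.If_cases Int_absorb1 cong: if_cong)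
    ultimately show ?thesis by (simp add: d_def distrib_right sum.distrib)
  qed
  then show ?thesis using F F' unfolding rspan_def
    by (intro CollectI exI[of _ "F \<union> F'"] exI[of _ d]) auto
qed

lemma rspan_diff: "f \<in> rspan S \<Longrightarrow> g \<in> rspan S \<Longrightarrow> (\<lambda>z. f z - g z) \<in> rspan S"
  using rspan_add[of f S "\<lambda>z. (-1) * g z"] rspan_scale[of g S "-1"] by simp

lemma rspan_induct [consumes 1, case_names zero step]:
  assumes f: "f \<in> rspan S" and z: "P (\<lambda>z. 0)"
    and s: "\<And>a g h. g \<in> S \<Longrightarrow> P h \<Longrightarrow> P (\<lambda>z. a * g z + h z)"
  shows "P f"
proof -
  obtain F c where F: "finite F" "F \<subseteq> S" "f = (\<lambda>z. \<Sum>g\<in>F. c g * g z)" using f by (auto simp: rspan_def)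
  from F(1,2) have "P (\<lambda>z. \<Sum>g\<in>F. c g * g z)"
    by (induction F) (auto intro: z s)
  with F(3) show ?thesis by simp
qed

lemma rspan_subset: assumes "S \<subseteq> rspan T" shows "rspan S \<subseteq> rspan T"
proof
  fix f assume "f \<in> rspan S"
  then show "f \<in> rspan T"
  proof (induction rule: rspan_induct)
    case (step a g h)
    then show ?case using assms by (intro rspan_add rspan_scale) auto
  qed (rule rspan_zero)
qed

text \<open>\<open>contr c y F [x_1, ..., x_k]\<close> is the sum over \<open>j\<close> of \<open>c y x_j\<close> times \<open>F\<close> of the list without
  \<open>x_j\<close>; the recursion avoids indices.\<close>

fun contr :: "('b \<Rightarrow> 'c \<Rightarrow> real) \<Rightarrow> 'b \<Rightarrow> ('c list \<Rightarrow> 'd::real_vector) \<Rightarrow> 'c list \<Rightarrow> 'd" where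
  "contr c y F [] = 0"
| "contr c y F (x # xs) = c y x *\<^sub>R F xs + contr c y (\<lambda>L. F (x # L)) xs"

lemma contr_cong_subset:
  assumes "\<And>L. Suc (length L) = length xs \<Longrightarrow> set L \<subseteq> set xs \<Longrightarrow> F L = G L"
  shows "contr c y F xs = contr c y G xs"
  using assms
proof (induction xs arbitrary: F G)
  case (Cons x xs)
  have "F xs = G xs" by (rule Cons.prems) auto
  moreover have "contr c y (\<lambda>L. F (x # L)) xs = contr c y (\<lambda>L. G (x # L)) xs"
    by (rule Cons.IH) (rule Cons.prems, auto)
  ultimately show ?case by simp
qed simp

text \<open>As a congruence rule for recursive definitions it tells the termination proof of
  \<open>wickp\<close> that the lists handed to \<open>F\<close> are shorter by one.\<close>

lemma contr_cong [fundef_cong]: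
  assumes "c = c'" "y = y'" "xs = xs'" "\<And>L. Suc (length L) = length xs' \<Longrightarrow> F L = G L"
  shows "contr c y F xs = contr c' y' G xs'"
  using assms contr_cong_subset by metis

lemma contr_zero: "contr c y (\<lambda>L. 0) xs = 0"
  by (induction xs) auto

lemma contr_add: "contr c y (\<lambda>L. F L + G L) xs = contr c y F xs + contr c y G xs"
  by (induction xs arbitrary: F G) (auto simp: scaleR_add_right)

lemma contr_scaleR: "contr c y (\<lambda>L. a *\<^sub>R F L) xs = a *\<^sub>R contr c y F xs"
  by (induction xs arbitrary: F) (auto simp: scaleR_add_right mult.commute)

lemma contr_diff: "contr c y (\<lambda>L. F L - G L) xs = contr c y F xs - contr c y G xs"
  using contr_add[of c y F "\<lambda>L. (-1) *\<^sub>R G L" xs] contr_scaleR[of c y "-1" G xs] by simp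

lemma contr_mult: fixes F :: "_ \<Rightarrow> real" shows "contr c y (\<lambda>L. a * F L) xs = a * contr c y F xs"
  using contr_scaleR[of c y a F xs] by simp

lemma contr_cmult: fixes F :: "_ \<Rightarrow> complex" shows "contr c y (\<lambda>L. a * F L) xs = a * contr c y F xs"
  by (induction xs arbitrary: F) (auto simp: algebra_simps)

lemma contr_swap:
  "contr c x (\<lambda>L. contr d y (G L) ys) xs = contr d y (\<lambda>L'. contr c x (\<lambda>L. G L L') xs) ys"
proof (induction xs arbitrary: G)
  case Nil
  then show ?case by (simp add: contr_zero)
next
  case (Cons a xs)
  show ?case by (simp add: Cons.IH contr_add contr_scaleR)
qed

text \<open>A double contraction is a sum over ordered pairs of distinct positions, so the order of
  the two removals is immaterial.\<close>

lemma contr_commute: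
  "contr c x (\<lambda>L. contr d y F L) xs = contr d y (\<lambda>L. contr c x F L) xs"
proof (induction xs arbitrary: F)
  case (Cons a xs)
  show ?case by (simp add: contr_add contr_scaleR Cons.IH)
qed simp

lemma contr_map: "contr c y F (map h L) = contr (\<lambda>y j. c y (h j)) y (\<lambda>J. F (map h J)) L"
  by (induction L arbitrary: F) auto

lemma contr_integral:
  fixes F :: "'c list \<Rightarrow> 'a \<Rightarrow> real"
  assumes "\<And>L. Suc (length L) = length xs \<Longrightarrow> set L \<subseteq> set xs \<Longrightarrow> integrable M (F L)"
  shows "integrable M (\<lambda>z. contr c y (\<lambda>L. F L z) xs) \<and>
    (LINT z|M. contr c y (\<lambda>L. F L z) xs) = contr c y (\<lambda>L. LINT z|M. F L z) xs"
  using assms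
proof (induction xs arbitrary: F)
  case (Cons x xs)
  have 1: "integrable M (F xs)" by (rule Cons.prems) auto
  have 2: "integrable M (\<lambda>z. contr c y (\<lambda>L. F (x # L) z) xs) \<and>
    (LINT z|M. contr c y (\<lambda>L. F (x # L) z) xs) = contr c y (\<lambda>L. LINT z|M. F (x # L) z) xs"
    by (rule Cons.IH) (rule Cons.prems, auto)
  show ?case using 1 2 by simp
qed simp

section \<open>Ordinary products and Wick products\<close>

definition prodl :: "('a \<Rightarrow> real) list \<Rightarrow> 'a \<Rightarrow> real" where
  "prodl L z = prod_list (map (\<lambda>X. X z) L)"

lemma prodl_simps [simp]: "prodl [] z = 1" "prodl (X # L) z = X z * prodl L z"
  by (auto simp: prodl_def)

text \<open>No means are subtracted because the Gaussian variables to which this is applied are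
  centred.\<close>

definition cov :: "'a measure \<Rightarrow> ('a \<Rightarrow> real) \<Rightarrow> ('a \<Rightarrow> real) \<Rightarrow> real" where
  "cov M X Y = (LINT z|M. X z * Y z)"

text \<open>The Hermite recursion \<open>H_{k+1}(x) = x H_k(x) - k H_{k-1}(x)\<close> in several
  variables. In contrast to \<open>wick\<close> it involves no choice of a projection, yields a
  function defined at every point, and sees the variables only through their values and covariances,
  so that composition with a measure preserving map is harmless.\<close>

function wickp :: "'a measure \<Rightarrow> ('a \<Rightarrow> real) list \<Rightarrow> 'a \<Rightarrow> real" where
  "wickp M [] = (\<lambda>z. 1)"
| "wickp M (y # ys) = (\<lambda>z. y z * wickp M ys z - contr (cov M) y (\<lambda>L. wickp M L z) ys)"
  by pat_completeness auto
termination by (relation "Wellfounded.measure (\<lambda>(M, ys). length ys)") auto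

text \<open>The strict bound on the degree matches the remainder in \<open>wickp_prodspan\<close>
  and the union over \<open>j < k\<close> in \<open>Glow\<close>.\<close>

definition prodspan :: "('a \<Rightarrow> real) set \<Rightarrow> nat \<Rightarrow> ('a \<Rightarrow> real) set" where
  "prodspan A n = rspan {prodl L | L. set L \<subseteq> A \<and> length L < n}"

lemma prodspan_mono: "m \<le> n \<Longrightarrow> f \<in> prodspan A m \<Longrightarrow> f \<in> prodspan A n"
proof -
  assume "m \<le> n" "f \<in> prodspan A m"
  moreover have "prodspan A m \<subseteq> prodspan A n" if "m \<le> n"
    unfolding prodspan_def using that by (intro rspan_subset) (auto intro!: rspan_base)
  ultimately show ?thesis by blast
qed

lemma prodspan_base: "set L \<subseteq> A \<Longrightarrow> length L < n \<Longrightarrow> prodl L \<in> prodspan A n"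
  unfolding prodspan_def by (intro rspan_base) auto

lemma prodspan_mult:
  assumes "f \<in> prodspan A n" "X \<in> A" shows "(\<lambda>z. X z * f z) \<in> prodspan A (Suc n)"
  using assms(1) unfolding prodspan_def
proof (induction rule: rspan_induct)
  case zero
  then show ?case by (simp add: rspan_zero)
next
  case (step a g h)
  then obtain L where L: "g = prodl L" "set L \<subseteq> A" "length L < n" by auto
  have "(\<lambda>z. a * prodl (X # L) z) \<in> rspan {prodl L | L. set L \<subseteq> A \<and> length L < Suc n}"
    using L assms(2) by (intro rspan_scale rspan_base CollectI exI[of _ "X # L"]) auto
  from rspan_add[OF this step.IH] show ?case by (simp add: L algebra_simps)
qed

lemma contr_prodspan:
  assumes "\<And>L. Suc (length L) = length xs \<Longrightarrow> set L \<subseteq> set xs \<Longrightarrow> F L \<in> prodspan A n"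
  shows "(\<lambda>z. contr c y (\<lambda>L. F L z) xs) \<in> prodspan A n"
  using assms
proof (induction xs arbitrary: F)
  case Nil
  then show ?case by (simp add: prodspan_def rspan_zero)
next
  case (Cons x xs)
  have 1: "F xs \<in> prodspan A n" by (rule Cons.prems) auto
  have 2: "(\<lambda>z. contr c y (\<lambda>L. F (x # L) z) xs) \<in> prodspan A n"
    by (rule Cons.IH) (rule Cons.prems, auto)
  show ?case using rspan_add[OF rspan_scale[OF 1[unfolded prodspan_def]] 2[unfolded prodspan_def]]
    by (simp add: prodspan_def)
qed

text \<open>Strong induction along the recursion: multiplying the remainder of \<open>ys\<close> by
  \<open>y\<close> raises its degree by one, and each contraction term has two factors fewer than
  the whole list.\<close>

lemma wickp_prodspan:
  "set L \<subseteq> A \<Longrightarrow> (\<lambda>z. wickp M L z - prodl L z) \<in> prodspan A (length L)"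
proof (induction L rule: length_induct)
  case (1 L)
  show ?case
  proof (cases L)
    case Nil
    then show ?thesis by (simp add: prodspan_def rspan_zero)
  next
    case (Cons y ys)
    have IH: "(\<lambda>z. wickp M K z - prodl K z) \<in> prodspan A (length K)"
      if "length K < length L" "set K \<subseteq> A" for K using 1 that by blast
    have w: "wickp M K \<in> prodspan A (length L)" if "length K < length L" "set K \<subseteq> A" for K
    proof -
      have "(\<lambda>z. (wickp M K z - prodl K z) + prodl K z) \<in> prodspan A (length L)"
        using prodspan_mono[OF _ IH[OF that], of "length L"] prodspan_base[of K A "length L"] that
        unfolding prodspan_def by (intro rspan_add) auto
      then show ?thesis by simp
    qed
    have "(\<lambda>z. y z * (wickp M ys z - prodl ys z)) \<in> prodspan A (Suc (length ys))"
      using Cons 1(2) by (intro prodspan_mult IH) auto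
    moreover have "(\<lambda>z. contr (cov M) y (\<lambda>L. wickp M L z) ys) \<in> prodspan A (length L)"
      using Cons 1(2) by (intro contr_prodspan w) auto
    ultimately have "(\<lambda>z. y z * (wickp M ys z - prodl ys z) - contr (cov M) y (\<lambda>L. wickp M L z) ys) \<in> prodspan A (length L)"
      using Cons unfolding prodspan_def by (intro rspan_diff) auto
    then show ?thesis by (simp add: Cons algebra_simps)
  qed
qed

text \<open>Permanent of the matrix \<open>c i j\<close>, expanded along the first row.\<close>

fun per :: "('b \<Rightarrow> 'c \<Rightarrow> real) \<Rightarrow> 'b list \<Rightarrow> 'c list \<Rightarrow> real" where
  "per c [] J = (if J = [] then 1 else 0)"
| "per c (i # I) J = contr c i (per c I) J"

lemma per_map2: "per c (map g I) (map h J) = per (\<lambda>i j. c (g i) (h j)) I J"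
proof (induction I arbitrary: J)
  case (Cons i I)
  have "contr c (g i) (per c (map g I)) (map h J) = contr (\<lambda>y j. c y (h j)) (g i) (\<lambda>K. per c (map g I) (map h K)) J"
    by (rule contr_map)
  also have "\<dots> = contr (\<lambda>y j. c y (h j)) (g i) (per (\<lambda>i j. c (g i) (h j)) I) J"
    by (simp add: Cons.IH)
  also have "\<dots> = contr (\<lambda>i j. c (g i) (h j)) i (per (\<lambda>i j. c (g i) (h j)) I) J"
  proof -
    have "contr (\<lambda>y j. c y (h j)) (g i) F J = contr (\<lambda>i j. c (g i) (h j)) i F J" for F :: "_ \<Rightarrow> real"
      by (induction J arbitrary: F) auto
    then show ?thesis .
  qed
  finally show ?case by simp
qed simp

section \<open>Sums over index lists with symmetric coefficients\<close>

definition lsts :: "'b set \<Rightarrow> nat \<Rightarrow> 'b list set" where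
  "lsts A k = {J. set J \<subseteq> A \<and> length J = k}"

lemma finite_lsts: "finite A \<Longrightarrow> finite (lsts A k)"
  unfolding lsts_def by (rule finite_lists_length_eq)

lemma lsts_0: "lsts A 0 = {[]}"
  by (auto simp: lsts_def)

lemma sum_lsts_Suc:
  assumes "finite A"
  shows "(\<Sum>J\<in>lsts A (Suc k). f J) = (\<Sum>j\<in>A. \<Sum>J\<in>lsts A k. f (j # J))"
proof -
  have "lsts A (Suc k) = (\<lambda>(j, J). j # J) ` (A \<times> lsts A k)"
    by (auto simp: lsts_def length_Suc_conv image_iff)
  moreover have "inj_on (\<lambda>(j, J). j # J) (A \<times> lsts A k)" by (auto simp: inj_on_def)
  ultimately show ?thesis
    by (simp add: sum.reindex sum.cartesian_product case_prod_unfold)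
qed

text \<open>By symmetry of \<open>b\<close> the removed entry can be moved to the front, so all
  \<open>Suc k\<close> positions contribute equally. In the induction the removed entry is either
  the head, or it lies in the tail and is exchanged with the head.\<close>

lemma sum_contr_symmetric:
  fixes F :: "'b list \<Rightarrow> real"
  assumes A: "finite A" and b: "\<And>I J. mset I = mset J \<Longrightarrow> b I = b J"
  shows "(\<Sum>J\<in>lsts A (Suc k). b J * contr c i F J) =
    real (Suc k) * (\<Sum>j\<in>A. c i j * (\<Sum>J\<in>lsts A k. b (j # J) * F J))"
  using b
proof (induction k arbitrary: F b)
  case 0
  show ?case by (simp add: sum_lsts_Suc[OF A] lsts_0 algebra_simps)
next
  case (Suc k)
  have "(\<Sum>J\<in>lsts A (Suc (Suc k)). b J * contr c i F J) =
     (\<Sum>j\<in>A. \<Sum>J\<in>lsts A (Suc k). b (j # J) * (c i j * F J)) +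
     (\<Sum>j\<in>A. \<Sum>J\<in>lsts A (Suc k). b (j # J) * contr c i (\<lambda>L. F (j # L)) J)"
    by (simp add: sum_lsts_Suc[OF A, of _ "Suc k"] distrib_left sum.distrib)
  also have "(\<Sum>j\<in>A. \<Sum>J\<in>lsts A (Suc k). b (j # J) * contr c i (\<lambda>L. F (j # L)) J) =
    (\<Sum>j\<in>A. real (Suc k) * (\<Sum>j'\<in>A. c i j' * (\<Sum>J\<in>lsts A k. b (j # j' # J) * F (j # J))))"
  proof (rule sum.cong[OF refl])
    fix j
    show "(\<Sum>J\<in>lsts A (Suc k). b (j # J) * contr c i (\<lambda>L. F (j # L)) J) =
       real (Suc k) * (\<Sum>j'\<in>A. c i j' * (\<Sum>J\<in>lsts A k. b (j # j' # J) * F (j # J)))"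
      by (rule Suc.IH) (rule Suc.prems, simp)
  qed
  also have "\<dots> = (\<Sum>j\<in>A. real (Suc k) * (\<Sum>j'\<in>A. c i j' * (\<Sum>J\<in>lsts A k. b (j' # j # J) * F (j # J))))"
  proof -
    have "b (j # j' # J) = b (j' # j # J)" for j j' J
      by (rule Suc.prems) simp
    then show ?thesis by simp
  qed
  also have "\<dots> = real (Suc k) * (\<Sum>j'\<in>A. c i j' * (\<Sum>j\<in>A. \<Sum>J\<in>lsts A k. b (j' # j # J) * F (j # J)))"
    unfolding sum_distrib_left by (rule sum.swap)
  also have "\<dots> = real (Suc k) * (\<Sum>j'\<in>A. c i j' * (\<Sum>J\<in>lsts A (Suc k). b (j' # J) * F J))"
    by (simp add: sum_lsts_Suc[OF A])
  also have "(\<Sum>j\<in>A. \<Sum>J\<in>lsts A (Suc k). b (j # J) * (c i j * F J)) =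
     (\<Sum>j\<in>A. c i j * (\<Sum>J\<in>lsts A (Suc k). b (j # J) * F J))"
    by (simp add: sum_distrib_left mult_ac)
  finally show ?case by (simp add: algebra_simps)
qed

text \<open>Against symmetric coefficients every permutation in the permanent contributes as much as
  the identity. This produces the factorial and removes permutations from the rest of the
  argument.\<close>

lemma sum_per_symmetric:
  assumes A: "finite A" and b: "\<And>I J. mset I = mset J \<Longrightarrow> b I = b J"
  shows "(\<Sum>J\<in>lsts A (length I). b J * per c I J) =
    fact (length I) * (\<Sum>J\<in>lsts A (length I). b J * prod_list (map2 c I J))"
  using b
proof (induction I arbitrary: b)
  case Nil
  show ?case by (simp add: lsts_0)
next
  case (Cons i I)
  have "(\<Sum>J\<in>lsts A (length (i # I)). b J * per c (i # I) J) =
      real (Suc (length I)) * (\<Sum>j\<in>A. c i j * (\<Sum>J\<in>lsts A (length I). b (j # J) * per c I J))"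
    using sum_contr_symmetric[OF A Cons.prems] by simp
  also have "\<dots> = real (Suc (length I)) * (\<Sum>j\<in>A. c i j * (fact (length I) * (\<Sum>J\<in>lsts A (length I). b (j # J) * prod_list (map2 c I J))))"
    by (intro arg_cong2[where f="(*)"] sum.cong refl Cons.IH Cons.prems) simp
  also have "\<dots> = fact (length (i # I)) * (\<Sum>j\<in>A. c i j * (\<Sum>J\<in>lsts A (length I). b (j # J) * prod_list (map2 c I J)))"
    by (simp add: sum_distrib_left mult_ac)
  finally show ?case by (simp add: sum_lsts_Suc[OF A] sum_distrib_left mult_ac)
qed

section \<open>Gaussian families\<close>

text \<open>Products of square integrable functions need not be square integrable, whereas
  finiteness of all absolute moments is stable under products. This gives an algebra large enough
  for all Wick products of Gaussian variables.\<close>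

definition allmom :: "'a measure \<Rightarrow> ('a \<Rightarrow> real) \<Rightarrow> bool" where
  "allmom M F \<longleftrightarrow> F \<in> borel_measurable M \<and> (\<forall>n. integrable M (\<lambda>z. \<bar>F z\<bar> ^ n))"

lemma allmom_measurable: "allmom M F \<Longrightarrow> F \<in> borel_measurable M"
  by (simp add: allmom_def)

lemma allmom_mult:
  assumes "allmom M F" "allmom M G" shows "allmom M (\<lambda>z. F z * G z)"
proof -
  have [measurable]: "F \<in> borel_measurable M" "G \<in> borel_measurable M" using assms by (auto simp: allmom_def)
  have "integrable M (\<lambda>z. \<bar>F z * G z\<bar> ^ n)" for n
  proof (rule Bochner_Integration.integrable_bound)
    show "integrable M (\<lambda>z. \<bar>F z\<bar> ^ (2 * n) + \<bar>G z\<bar> ^ (2 * n))"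
      using assms by (auto simp: allmom_def)
    have "\<bar>a * b\<bar> ^ n \<le> \<bar>a\<bar> ^ (2 * n) + \<bar>b\<bar> ^ (2 * n)" for a b :: real
    proof -
      have "2 * \<bar>a\<bar> ^ n * \<bar>b\<bar> ^ n \<le> (\<bar>a\<bar> ^ n)\<^sup>2 + (\<bar>b\<bar> ^ n)\<^sup>2" by (rule sum_squares_bound)
      moreover have "0 \<le> \<bar>a\<bar> ^ n * \<bar>b\<bar> ^ n" by simp
      ultimately show ?thesis unfolding abs_mult power_mult_distrib power_mult mult.commute[of 2 n] by linarith
    qed
    then show "AE z in M. norm (\<bar>F z * G z\<bar> ^ n) \<le> norm (\<bar>F z\<bar> ^ (2 * n) + \<bar>G z\<bar> ^ (2 * n))"
      by (intro AE_I2) simp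
  qed simp
  then show ?thesis by (simp add: allmom_def)
qed

lemma allmom_add:
  assumes "allmom M F" "allmom M G" shows "allmom M (\<lambda>z. F z + G z)"
proof -
  have [measurable]: "F \<in> borel_measurable M" "G \<in> borel_measurable M" using assms by (auto simp: allmom_def)
  have "integrable M (\<lambda>z. \<bar>F z + G z\<bar> ^ n)" for n
  proof (rule Bochner_Integration.integrable_bound)
    show "integrable M (\<lambda>z. 2 ^ n * (\<bar>F z\<bar> ^ n + \<bar>G z\<bar> ^ n))"
      using assms by (auto simp: allmom_def)
    have "\<bar>a + b\<bar> ^ n \<le> 2 ^ n * (\<bar>a\<bar> ^ n + \<bar>b\<bar> ^ n)" for a b :: real
    proof -
      have "\<bar>a + b\<bar> ^ n \<le> (2 * max \<bar>a\<bar> \<bar>b\<bar>) ^ n" by (intro power_mono) auto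
      also have "\<dots> = 2 ^ n * (max \<bar>a\<bar> \<bar>b\<bar>) ^ n" by (rule power_mult_distrib)
      also have "\<dots> \<le> 2 ^ n * (\<bar>a\<bar> ^ n + \<bar>b\<bar> ^ n)"
        by (intro mult_left_mono) (auto simp: max_def)
      finally show ?thesis .
    qed
    then show "AE z in M. norm (\<bar>F z + G z\<bar> ^ n) \<le> norm (2 ^ n * (\<bar>F z\<bar> ^ n + \<bar>G z\<bar> ^ n))"
      by (intro AE_I2) simp
  qed simp
  then show ?thesis by (simp add: allmom_def)
qed

lemma allmom_scale: "allmom M F \<Longrightarrow> allmom M (\<lambda>z. c * F z)"
  by (auto simp: allmom_def abs_mult power_mult_distrib)

lemma allmom_diff: "allmom M F \<Longrightarrow> allmom M G \<Longrightarrow> allmom M (\<lambda>z. F z - G z)"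
  using allmom_add[of M F "\<lambda>z. (-1) * G z"] allmom_scale[of M G "-1"] by simp

lemma allmom_L2R: assumes "allmom M F" shows "F \<in> L2R M"
proof -
  have "integrable M (\<lambda>z. \<bar>F z\<bar> ^ 2)" using assms unfolding allmom_def by blast
  then show ?thesis using assms by (auto simp: allmom_def intro: L2R_I)
qed

lemma allmom_integrable: assumes "allmom M F" shows "integrable M F"
proof -
  have "integrable M (\<lambda>z. \<bar>F z\<bar> ^ 1)" using assms unfolding allmom_def by blast
  then show ?thesis using assms by (simp add: allmom_def integrable_abs_iff)
qed

lemma (in prob_space) allmom_const: "allmom M (\<lambda>z. c)"
  by (simp add: allmom_def)

text \<open>Completing the square: up to a constant, the factor \<open>exp (c * x)\<close> shifts
  the mean of the normal density to \<open>c\<close>.\<close>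

lemma integrable_std_normal_exp:
  "integrable lborel (\<lambda>x. std_normal_density x * exp (c * x))"
proof -
  have "std_normal_density x * exp (c * x) = exp (c\<^sup>2 / 2) * normal_density c 1 x" for x
  proof -
    have "- x\<^sup>2 / 2 + c * x = c\<^sup>2 / 2 + - (x - c)\<^sup>2 / 2" by (simp add: power2_eq_square field_simps)
    then have "exp (- x\<^sup>2 / 2) * exp (c * x) = exp (c\<^sup>2 / 2) * exp (- (x - c)\<^sup>2 / 2)"
      by (simp only: exp_add[symmetric])
    then show ?thesis by (simp add: normal_density_def)
  qed
  then show ?thesis by simp
qed

lemma abs_power_le_exp: "\<bar>x::real\<bar> ^ n \<le> fact n * exp \<bar>x\<bar>"
proof -
  have "\<bar>x\<bar> ^ n / fact n \<le> exp \<bar>x\<bar>"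
  proof -
    have "(\<lambda>n. \<bar>x\<bar> ^ n /\<^sub>R fact n) sums exp \<bar>x\<bar>" by (rule exp_converges)
    then have "sum (\<lambda>n. \<bar>x\<bar> ^ n /\<^sub>R fact n) {n} \<le> exp \<bar>x\<bar>"
      by (intro sum_le_suminf[of "\<lambda>n. \<bar>x\<bar> ^ n /\<^sub>R fact n" "{n}", THEN order_trans]) (auto simp: sums_iff)
    then show ?thesis by (simp add: divide_inverse mult.commute)
  qed
  then show ?thesis by (simp add: field_simps)
qed

lemma has_vector_derivative_quadratic_bound:
  fixes f :: "real \<Rightarrow> 'b::real_normed_vector"
  assumes "\<And>s. norm (f s - f 0 - s *\<^sub>R L) \<le> C * s\<^sup>2"
  shows "(f has_vector_derivative L) (at 0)"
proof -
  have "((\<lambda>y. (f y - f 0 - y *\<^sub>R L) /\<^sub>R norm y) \<longlongrightarrow> 0) (at 0)"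
  proof (rule Lim_null_comparison)
    show "\<forall>\<^sub>F y in at 0. norm ((f y - f 0 - y *\<^sub>R L) /\<^sub>R norm y) \<le> C * \<bar>y\<bar>"
    proof (rule eventually_at_filter[THEN iffD2], rule always_eventually, intro allI impI)
      fix y :: real assume y: "y \<noteq> 0"
      have "norm ((f y - f 0 - y *\<^sub>R L) /\<^sub>R norm y) = norm (f y - f 0 - y *\<^sub>R L) / \<bar>y\<bar>"
        by (simp add: divide_inverse mult.commute)
      also have "\<dots> \<le> C * y\<^sup>2 / \<bar>y\<bar>" by (intro divide_right_mono assms) simp
      also have "\<dots> = C * \<bar>y\<bar>" using y by (simp add: power2_eq_square field_simps)
      finally show "norm ((f y - f 0 - y *\<^sub>R L) /\<^sub>R norm y) \<le> C * \<bar>y\<bar>" .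
    qed
    show "((\<lambda>y. C * \<bar>y\<bar>) \<longlongrightarrow> 0) (at 0)"
      by (intro tendsto_eq_intros | simp)+
  qed
  then show ?thesis
    unfolding has_vector_derivative_def has_derivative_def
    by (auto intro: bounded_linear_scaleR_left)
qed

lemma cis_minus_linear_bound: "cmod (cis x - 1 - \<i> * x) \<le> x\<^sup>2 / 2"
  using iexp_approx1[of x 1] by (simp add: cis_conv_exp diff_diff_eq power2_eq_square)

lemma integral_norm_le:
  fixes f :: "'a \<Rightarrow> 'b::{banach,second_countable_topology}"
  assumes "integrable M f" "integrable M g" "\<And>x. norm (f x) \<le> g x"
  shows "norm (\<integral>x. f x \<partial>M) \<le> (\<integral>x. g x \<partial>M)"
proof (rule order_trans[OF integral_norm_bound])
  show "(\<integral>x. norm (f x) \<partial>M) \<le> (\<integral>x. g x \<partial>M)"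
    by (intro integral_mono integrable_norm assms)
qed

text \<open>The second order bound for \<open>cis\<close> at \<open>s * X z\<close> leaves an error
  of at most \<open>s^2 / 2\<close> times the integral of \<open>|P * X * X|\<close>, which is
  finite because all moments are.\<close>

lemma integral_cis_derivative:
  assumes P: "allmom M P" and X: "allmom M X" and Z[measurable]: "Z \<in> borel_measurable M"
  shows "((\<lambda>s. LINT z|M. P z *\<^sub>R cis (Z z + s * X z)) has_vector_derivative
     \<i> * (LINT z|M. (P z * X z) *\<^sub>R cis (Z z))) (at 0)"
proof -
  have [measurable]: "P \<in> borel_measurable M" "X \<in> borel_measurable M" using P X by (auto simp: allmom_def)
  have PX: "allmom M (\<lambda>z. P z * X z)" and PXX: "allmom M (\<lambda>z. P z * X z * X z)"
    by (intro allmom_mult P X)+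
  have int: "integrable M (\<lambda>z. Q z *\<^sub>R cis (Y z))"
    if Q: "allmom M Q" and [measurable]: "Y \<in> borel_measurable M" for Q Y
  proof (rule Bochner_Integration.integrable_bound[OF allmom_integrable[OF Q]])
    show "(\<lambda>z. Q z *\<^sub>R cis (Y z)) \<in> borel_measurable M"
      unfolding cis_conv_exp using allmom_measurable[OF Q] by measurable
  qed simp
  show ?thesis
  proof (rule has_vector_derivative_quadratic_bound)
    fix s :: real
    have "norm ((LINT z|M. P z *\<^sub>R cis (Z z + s * X z)) - (LINT z|M. P z *\<^sub>R cis (Z z + 0 * X z))
        - s *\<^sub>R (\<i> * (LINT z|M. (P z * X z) *\<^sub>R cis (Z z)))) =
       norm (LINT z|M. P z *\<^sub>R cis (Z z + s * X z) - P z *\<^sub>R cis (Z z) - s *\<^sub>R (\<i> * ((P z * X z) *\<^sub>R cis (Z z))))"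
      using int[OF P, of "\<lambda>z. Z z + s * X z"] int[OF P Z] int[OF PX Z]
      by (simp del: mult_scaleR_right mult_scaleR_left scaleR_scaleR)
    also have "\<dots> \<le> (LINT z|M. (s\<^sup>2 / 2) * \<bar>P z * X z * X z\<bar>)"
    proof (rule integral_norm_le)
      show "integrable M (\<lambda>z. P z *\<^sub>R cis (Z z + s * X z) - P z *\<^sub>R cis (Z z) - s *\<^sub>R (\<i> * ((P z * X z) *\<^sub>R cis (Z z))))"
        using int[OF P, of "\<lambda>z. Z z + s * X z"] int[OF P Z] int[OF PX Z] by (simp del: mult_scaleR_right mult_scaleR_left scaleR_scaleR)
      show "integrable M (\<lambda>z. (s\<^sup>2 / 2) * \<bar>P z * X z * X z\<bar>)"
        using allmom_integrable[OF PXX] by simp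
      fix z
      have "P z *\<^sub>R cis (Z z + s * X z) - P z *\<^sub>R cis (Z z) - s *\<^sub>R (\<i> * ((P z * X z) *\<^sub>R cis (Z z)))
         = P z *\<^sub>R (cis (Z z) * (cis (s * X z) - 1 - \<i> * complex_of_real (s * X z)))"
        by (simp add: cis_mult[symmetric] scaleR_conv_of_real algebra_simps)
      then have "norm (P z *\<^sub>R cis (Z z + s * X z) - P z *\<^sub>R cis (Z z) - s *\<^sub>R (\<i> * ((P z * X z) *\<^sub>R cis (Z z))))
         = \<bar>P z\<bar> * cmod (cis (s * X z) - 1 - \<i> * complex_of_real (s * X z))"
        by (simp add: norm_mult)
      also have "\<dots> \<le> \<bar>P z\<bar> * ((s * X z)\<^sup>2 / 2)"
        by (intro mult_left_mono cis_minus_linear_bound) simp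
      also have "\<dots> = (s\<^sup>2 / 2) * \<bar>P z * X z * X z\<bar>"
        by (simp add: abs_mult power_mult_distrib power2_eq_square abs_mult_self)
      finally show "norm (P z *\<^sub>R cis (Z z + s * X z) - P z *\<^sub>R cis (Z z) - s *\<^sub>R (\<i> * ((P z * X z) *\<^sub>R cis (Z z))))
          \<le> (s\<^sup>2 / 2) * \<bar>P z * X z * X z\<bar>" .
    qed
    also have "\<dots> = ((LINT z|M. \<bar>P z * X z * X z\<bar>) / 2) * s\<^sup>2" by simp
    finally show "norm ((LINT z|M. P z *\<^sub>R cis (Z z + s * X z)) - (LINT z|M. P z *\<^sub>R cis (Z z + 0 * X z))
        - s *\<^sub>R (\<i> * (LINT z|M. (P z * X z) *\<^sub>R cis (Z z)))) \<le> ((LINT z|M. \<bar>P z * X z * X z\<bar>) / 2) * s\<^sup>2" .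
  qed
qed

lemma contr_has_vector_derivative:
  fixes F :: "'c list \<Rightarrow> real \<Rightarrow> complex"
  assumes "\<And>L. Suc (length L) = length xs \<Longrightarrow> set L \<subseteq> set xs \<Longrightarrow> (F L has_vector_derivative F' L) (at 0)"
  shows "((\<lambda>s. contr c y (\<lambda>L. F L s) xs) has_vector_derivative contr c y F' xs) (at 0)"
  using assms
proof (induction xs arbitrary: F F')
  case (Cons x xs)
  have 1: "(F xs has_vector_derivative F' xs) (at 0)" by (rule Cons.prems) auto
  have 2: "((\<lambda>s. contr c y (\<lambda>L. F (x # L) s) xs) has_vector_derivative contr c y (\<lambda>L. F' (x # L)) xs) (at 0)"
    by (rule Cons.IH) (rule Cons.prems, auto)
  have 3: "((\<lambda>s. c y x *\<^sub>R F xs s) has_vector_derivative c y x *\<^sub>R F' xs) (at 0)"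
    using has_vector_derivative_scaleR[OF DERIV_const[of "c y x"] 1] by simp
  show ?case using has_vector_derivative_add[OF 3 2] by simp
qed simp

text \<open>Closure under linear combinations turns the one-dimensional condition
  \<open>G_char\<close> into joint Gaussianity of every finite subfamily; the condition also forces
  all means to be zero.\<close>

locale gaussian_family = prob_space M for M :: "'a measure" +
  fixes G :: "('a \<Rightarrow> real) set"
  assumes G_L2: "Y \<in> G \<Longrightarrow> Y \<in> L2R M"
    and G_add: "X \<in> G \<Longrightarrow> Y \<in> G \<Longrightarrow> (\<lambda>z. X z + Y z) \<in> G"
    and G_scale: "Y \<in> G \<Longrightarrow> (\<lambda>z. a * Y z) \<in> G"
    and G_char: "Y \<in> G \<Longrightarrow> (LINT z|M. cis (Y z)) = complex_of_real (exp (- (l2norm M Y)\<^sup>2 / 2))"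
begin

lemma G_measurable: "Y \<in> G \<Longrightarrow> Y \<in> borel_measurable M"
  using G_L2 L2R_D by blast

text \<open>Only characteristic functions are given, so the law has to be identified first: after
  normalisation it is standard normal by Levy's theorem. A variable of norm zero cannot be
  normalised and is treated apart.\<close>

lemma G_exp_integrable:
  assumes Y: "Y \<in> G" shows "integrable M (\<lambda>z. exp (Y z))"
proof (cases "l2norm M Y = 0")
  case True
  note [measurable] = G_measurable[OF Y]
  have "AE z in M. Y z = 0" using True l2norm_eq_0[OF G_L2[OF Y]] by simp
  then have "AE z in M. 1 = exp (Y z)" by eventually_elim simp
  moreover have "integrable M (\<lambda>z. 1::real)" by simp
  ultimately show ?thesis by (subst integrable_cong_AE[of _ _ "\<lambda>z. 1"]) auto
next
  case False
  define s where "s = l2norm M Y"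
  have s: "s > 0" using False l2norm_nonneg[of M Y] by (simp add: s_def)
  note [measurable] = G_measurable[OF Y]
  define X where "X z = Y z / s" for z
  have Xm[measurable]: "X \<in> borel_measurable M" unfolding X_def[abs_def] by measurable
  have "distr M borel X = std_normal_distribution"
  proof (rule Levy_uniqueness)
    show "real_distribution (distr M borel X)" by (rule real_distribution_distr) simp
    show "real_distribution std_normal_distribution" by (rule real_dist_normal_dist)
    show "char (distr M borel X) = char std_normal_distribution"
    proof
      fix t
      have "char (distr M borel X) t = (LINT z|M. cis ((t / s) * Y z))"
        unfolding char_def by (subst integral_distr) (auto simp: cis_conv_exp X_def)
      also have "\<dots> = complex_of_real (exp (- (l2norm M (\<lambda>z. (t / s) * Y z))\<^sup>2 / 2))"
        by (intro G_char G_scale Y)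
      also have "\<dots> = complex_of_real (exp (- t\<^sup>2 / 2))"
        unfolding l2norm_scale s_def[symmetric] using s by (simp add: power_mult_distrib power_divide)
      finally show "char (distr M borel X) t = char std_normal_distribution t"
        by (simp add: char_std_normal_distribution)
    qed
  qed
  moreover have "integrable std_normal_distribution (\<lambda>x. exp (s * x))"
    by (subst integrable_density) (auto simp: integrable_std_normal_exp)
  ultimately have "integrable (distr M borel X) (\<lambda>x. exp (s * x))" by simp
  then have "integrable M (\<lambda>z. exp (s * X z))"
    by (subst (asm) integrable_distr_eq) auto
  then show ?thesis using s by (simp add: X_def)
qed

lemma G_exp_abs_integrable:
  assumes Y: "Y \<in> G" shows "integrable M (\<lambda>z. exp (c * \<bar>Y z\<bar>))"
proof (rule Bochner_Integration.integrable_bound)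
  show "integrable M (\<lambda>z. exp (c * Y z) + exp ((-c) * Y z))"
    by (intro Bochner_Integration.integrable_add G_exp_integrable G_scale Y)
  show "(\<lambda>z. exp (c * \<bar>Y z\<bar>)) \<in> borel_measurable M" using G_measurable[OF Y] by measurable
  show "AE z in M. norm (exp (c * \<bar>Y z\<bar>)) \<le> norm (exp (c * Y z) + exp ((-c) * Y z))"
  proof (rule AE_I2)
    fix z
    have "exp (c * \<bar>Y z\<bar>) \<le> exp (c * Y z) + exp ((-c) * Y z)"
      using exp_ge_zero[of "c * Y z"] exp_ge_zero[of "(-c) * Y z"] by (cases "Y z \<ge> 0") auto
    then show "norm (exp (c * \<bar>Y z\<bar>)) \<le> norm (exp (c * Y z) + exp ((-c) * Y z))"
      unfolding real_norm_def by (intro order_trans[OF _ abs_ge_self]) simp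
  qed
qed

lemma G_allmom: assumes Y: "Y \<in> G" shows "allmom M Y"
  unfolding allmom_def
proof (intro conjI allI)
  show [measurable]: "Y \<in> borel_measurable M" by (rule G_measurable[OF Y])
  fix n
  show "integrable M (\<lambda>z. \<bar>Y z\<bar> ^ n)"
  proof (rule Bochner_Integration.integrable_bound)
    show "integrable M (\<lambda>z. fact n * exp (1 * \<bar>Y z\<bar>))"
      by (intro integrable_mult_right G_exp_abs_integrable Y)
    show "AE z in M. norm (\<bar>Y z\<bar> ^ n) \<le> norm (fact n * exp (1 * \<bar>Y z\<bar>))"
      using abs_power_le_exp by (intro AE_I2) simp
  qed simp
qed

lemma prodl_allmom: "set L \<subseteq> G \<Longrightarrow> allmom M (prodl L)"
proof (induction L)
  case Nil
  then show ?case using allmom_const[of 1] by (simp add: prodl_def[abs_def])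
next
  case (Cons X L)
  then have "allmom M (\<lambda>z. X z * prodl L z)" by (intro allmom_mult[OF G_allmom Cons.IH]) auto
  then show ?case by (simp add: prodl_def[abs_def])
qed

lemma cov_add_right: "X \<in> L2R M \<Longrightarrow> Y \<in> L2R M \<Longrightarrow> Z \<in> L2R M \<Longrightarrow> cov M X (\<lambda>z. Y z + Z z) = cov M X Y + cov M X Z"
  using L2R_mult[of X M Y] L2R_mult[of X M Z] by (simp add: cov_def distrib_left)

lemma cov_scale_right: "cov M X (\<lambda>z. a * Y z) = a * cov M X Y"
  by (simp add: cov_def mult.left_commute)

text \<open>Induction over the factors: replacing \<open>Z\<close> by \<open>Z + s X\<close> and differentiating at \<open>s = 0\<close> produces
  the additional factor \<open>X\<close>.\<close>

lemma gaussian_ibp_cis: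
  assumes "Y \<in> G" "Z \<in> G" "set Xs \<subseteq> G"
  shows "(LINT z|M. (Y z * prodl Xs z) *\<^sub>R cis (Z z)) =
    contr (cov M) Y (\<lambda>L. LINT z|M. prodl L z *\<^sub>R cis (Z z)) Xs
     + (\<i> * cov M Y Z) * (LINT z|M. prodl Xs z *\<^sub>R cis (Z z))"
  using assms
proof (induction Xs arbitrary: Z)
  case Nil
  have d1: "((\<lambda>s. LINT z|M. 1 *\<^sub>R cis (Z z + s * Y z)) has_vector_derivative
     \<i> * (LINT z|M. (1 * Y z) *\<^sub>R cis (Z z))) (at 0)"
    by (intro integral_cis_derivative allmom_const G_allmom G_measurable Nil)
  \<comment> \<open>The characteristic function of \<open>Z + s Y\<close> is explicit, and the
    coefficient of \<open>s\<close> in its exponent carries the covariance; comparing derivatives at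
    \<open>0\<close> gives the statement without factors.\<close>
  have e1: "(\<lambda>s. LINT z|M. 1 *\<^sub>R cis (Z z + s * Y z)) =
     (\<lambda>s. complex_of_real (exp (- ((l2norm M Z)\<^sup>2 + 2 * s * cov M Y Z + s\<^sup>2 * (l2norm M Y)\<^sup>2) / 2)))"
  proof
    fix s
    have "(l2norm M (\<lambda>z. Z z + s * Y z))\<^sup>2 = (l2norm M Z)\<^sup>2 + 2 * s * cov M Y Z + s\<^sup>2 * (l2norm M Y)\<^sup>2"
      using integral_diff_square[OF G_L2[OF Nil(2)] G_L2[OF Nil(1)], of 1 "-s"]
      by (simp add: l2norm_sq cov_def mult.commute)
    then show "(LINT z|M. 1 *\<^sub>R cis (Z z + s * Y z)) =
      complex_of_real (exp (- ((l2norm M Z)\<^sup>2 + 2 * s * cov M Y Z + s\<^sup>2 * (l2norm M Y)\<^sup>2) / 2))"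
      using G_char[OF G_add[OF Nil(2) G_scale[OF Nil(1)]], of s] by simp
  qed
  have d2: "((\<lambda>s. complex_of_real (exp (- ((l2norm M Z)\<^sup>2 + 2 * s * cov M Y Z + s\<^sup>2 * (l2norm M Y)\<^sup>2) / 2)))
      has_vector_derivative complex_of_real (- cov M Y Z * exp (- (l2norm M Z)\<^sup>2 / 2))) (at 0)"
  proof (rule has_vector_derivative_of_real)
    show "((\<lambda>s. exp (- ((l2norm M Z)\<^sup>2 + 2 * s * cov M Y Z + s\<^sup>2 * (l2norm M Y)\<^sup>2) / 2))
      has_real_derivative - cov M Y Z * exp (- (l2norm M Z)\<^sup>2 / 2)) (at 0)"
      by (auto intro!: derivative_eq_intros)
  qed
  have "\<i> * (LINT z|M. (1 * Y z) *\<^sub>R cis (Z z)) = complex_of_real (- cov M Y Z * exp (- (l2norm M Z)\<^sup>2 / 2))"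
    by (rule vector_derivative_unique_at[OF d1[unfolded e1] d2])
  then have "\<i> * (\<i> * (LINT z|M. Y z *\<^sub>R cis (Z z))) = \<i> * complex_of_real (- cov M Y Z * exp (- (l2norm M Z)\<^sup>2 / 2))"
    by simp
  then have "(LINT z|M. Y z *\<^sub>R cis (Z z)) = \<i> * complex_of_real (cov M Y Z * exp (- (l2norm M Z)\<^sup>2 / 2))"
    by (simp add: mult.assoc[symmetric])
  then show ?case using G_char[OF Nil(2)] by (simp add: mult_ac)
next
  case (Cons X Xs)
  have X: "X \<in> G" and Xs: "set Xs \<subseteq> G" using Cons.prems by auto
  note Y = Cons.prems(1) and Z = Cons.prems(2)
  define A where "A L s = (LINT z|M. prodl L z *\<^sub>R cis (Z z + s * X z))" for L s
  have dA: "(A L has_vector_derivative \<i> * (LINT z|M. (prodl L z * X z) *\<^sub>R cis (Z z))) (at 0)" if "set L \<subseteq> G" for L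
    unfolding A_def[abs_def] by (intro integral_cis_derivative prodl_allmom that G_allmom X G_measurable Z)
  \<comment> \<open>The induction hypothesis at \<open>Z + s X\<close>. The integrals and the
    covariance with \<open>Y\<close> both depend on \<open>s\<close>, so the product rule yields the
    contraction of \<open>Y\<close> with \<open>X\<close> as an additional term.\<close>
  have eq: "(LINT z|M. (Y z * prodl Xs z) *\<^sub>R cis (Z z + s * X z)) =
     contr (cov M) Y (\<lambda>L. A L s) Xs + (\<i> * (complex_of_real (cov M Y Z) + s *\<^sub>R complex_of_real (cov M Y X))) * A Xs s" for s
    using Cons.IH[OF Y G_add[OF Z G_scale[OF X]] Xs, of s]
    by (simp add: A_def cov_add_right cov_scale_right G_L2 Y Z X G_scale scaleR_conv_of_real)
  have "((\<lambda>s. LINT z|M. (Y z * prodl Xs z) *\<^sub>R cis (Z z + s * X z)) has_vector_derivative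
     \<i> * (LINT z|M. (Y z * prodl Xs z * X z) *\<^sub>R cis (Z z))) (at 0)"
    by (intro integral_cis_derivative allmom_mult prodl_allmom G_allmom G_measurable Y Z X Xs)
  moreover have "((\<lambda>s. contr (cov M) Y (\<lambda>L. A L s) Xs + (\<i> * (complex_of_real (cov M Y Z) + s *\<^sub>R complex_of_real (cov M Y X))) * A Xs s)
      has_vector_derivative contr (cov M) Y (\<lambda>L. \<i> * (LINT z|M. (prodl L z * X z) *\<^sub>R cis (Z z))) Xs
        + ((\<i> * complex_of_real (cov M Y Z)) * (\<i> * (LINT z|M. (prodl Xs z * X z) *\<^sub>R cis (Z z)))
           + \<i> * complex_of_real (cov M Y X) * A Xs 0)) (at 0)"
  proof (rule has_vector_derivative_add)
    show "((\<lambda>s. contr (cov M) Y (\<lambda>L. A L s) Xs) has_vector_derivative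
       contr (cov M) Y (\<lambda>L. \<i> * (LINT z|M. (prodl L z * X z) *\<^sub>R cis (Z z))) Xs) (at 0)"
      using Xs by (intro contr_has_vector_derivative dA) auto
    have "((\<lambda>s. \<i> * (complex_of_real (cov M Y Z) + s *\<^sub>R complex_of_real (cov M Y X)))
        has_vector_derivative \<i> * complex_of_real (cov M Y X)) (at 0)"
      by (auto intro!: derivative_eq_intros)
    from has_vector_derivative_mult[OF this dA[OF Xs]]
    show "((\<lambda>s. (\<i> * (complex_of_real (cov M Y Z) + s *\<^sub>R complex_of_real (cov M Y X))) * A Xs s) has_vector_derivative
        (\<i> * complex_of_real (cov M Y Z)) * (\<i> * (LINT z|M. (prodl Xs z * X z) *\<^sub>R cis (Z z)))
           + \<i> * complex_of_real (cov M Y X) * A Xs 0) (at 0)"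
      by simp
  qed
  ultimately have "\<i> * (LINT z|M. (Y z * prodl Xs z * X z) *\<^sub>R cis (Z z)) =
     contr (cov M) Y (\<lambda>L. \<i> * (LINT z|M. (prodl L z * X z) *\<^sub>R cis (Z z))) Xs
        + ((\<i> * complex_of_real (cov M Y Z)) * (\<i> * (LINT z|M. (prodl Xs z * X z) *\<^sub>R cis (Z z)))
           + \<i> * complex_of_real (cov M Y X) * A Xs 0)"
    unfolding eq by (rule vector_derivative_unique_at)
  also have "\<dots> = \<i> * (contr (cov M) Y (\<lambda>L. (LINT z|M. (prodl L z * X z) *\<^sub>R cis (Z z))) Xs
        + ((\<i> * complex_of_real (cov M Y Z)) * (LINT z|M. (prodl Xs z * X z) *\<^sub>R cis (Z z))
           + complex_of_real (cov M Y X) * A Xs 0))"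
    unfolding contr_cmult by (simp add: algebra_simps)
  finally have "(LINT z|M. (Y z * prodl Xs z * X z) *\<^sub>R cis (Z z)) =
     contr (cov M) Y (\<lambda>L. (LINT z|M. (prodl L z * X z) *\<^sub>R cis (Z z))) Xs
        + ((\<i> * complex_of_real (cov M Y Z)) * (LINT z|M. (prodl Xs z * X z) *\<^sub>R cis (Z z))
           + complex_of_real (cov M Y X) * A Xs 0)" by simp
  then show ?case by (simp add: A_def scaleR_conv_of_real mult_ac)
qed

text \<open>The case \<open>Z = 0\<close>; iterated, it is Wick's formula for Gaussian
  moments.\<close>

lemma gaussian_ibp:
  assumes Y: "Y \<in> G" and Xs: "set Xs \<subseteq> G"
  shows "(LINT z|M. Y z * prodl Xs z) = contr (cov M) Y (\<lambda>L. LINT z|M. prodl L z) Xs"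
proof -
  have Z: "(\<lambda>z. 0) \<in> G" using G_scale[OF Y, of 0] by simp
  have c: "cov M Y (\<lambda>z. 0) = 0" by (simp add: cov_def)
  have "complex_of_real (LINT z|M. Y z * prodl Xs z) = contr (cov M) Y (\<lambda>L. complex_of_real (LINT z|M. prodl L z)) Xs"
    using gaussian_ibp_cis[OF Y Z Xs] by (simp add: c scaleR_conv_of_real flip: of_real_mult)
  also have "\<dots> = complex_of_real (contr (cov M) Y (\<lambda>L. LINT z|M. prodl L z) Xs)"
  proof -
    have "contr c y (\<lambda>L. complex_of_real (F L)) xs = complex_of_real (contr c y F xs)" for c :: "('a \<Rightarrow> real) \<Rightarrow> _" and y F and xs :: "('a \<Rightarrow> real) list"
      by (induction xs arbitrary: F) (auto simp: scaleR_conv_of_real)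
    then show ?thesis .
  qed
  finally show ?thesis by (simp only: of_real_eq_iff)
qed

end

section \<open>Orthogonality and completeness of Wick products\<close>

lemma contr_allmom:
  assumes "\<And>L. Suc (length L) = length xs \<Longrightarrow> set L \<subseteq> set xs \<Longrightarrow> allmom M (F L)"
    and "allmom M (\<lambda>z. 0)"
  shows "allmom M (\<lambda>z. contr c y (\<lambda>L. F L z) xs)"
  using assms
proof (induction xs arbitrary: F)
  case (Cons x xs)
  have 1: "allmom M (F xs)" by (rule Cons.prems) auto
  have 2: "allmom M (\<lambda>z. contr c y (\<lambda>L. F (x # L) z) xs)"
    by (rule Cons.IH) (rule Cons.prems, auto intro: Cons.prems)
  show ?case using allmom_add[OF allmom_scale[OF 1] 2] by simp
qed simp

context gaussian_family
begin

lemma wickp_allmom: "set L \<subseteq> G \<Longrightarrow> allmom M (wickp M L)"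
proof (induction L rule: length_induct)
  case (1 L)
  show ?case
  proof (cases L)
    case Nil
    then show ?thesis using allmom_const[of 1] by simp
  next
    case (Cons y ys)
    have IH: "allmom M (wickp M K)" if "length K < length L" "set K \<subseteq> G" for K using 1 that by blast
    have "allmom M (\<lambda>z. y z * wickp M ys z)"
      using Cons 1(2) by (intro allmom_mult G_allmom IH) auto
    moreover have "allmom M (\<lambda>z. contr (cov M) y (\<lambda>L. wickp M L z) ys)"
      using Cons 1(2) by (intro contr_allmom IH allmom_const) auto
    ultimately show ?thesis using allmom_diff by (simp add: Cons)
  qed
qed

lemma wickp_times_integral:
  assumes "X \<in> G" "set Xs \<subseteq> G" "allmom M P"
  shows "(LINT z|M. wickp M (X # Xs) z * P z) =
    (LINT z|M. X z * wickp M Xs z * P z) - contr (cov M) X (\<lambda>L. LINT z|M. wickp M L z * P z) Xs"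
proof -
  have c: "integrable M (\<lambda>z. contr (cov M) X (\<lambda>L. wickp M L z * P z) Xs) \<and>
    (LINT z|M. contr (cov M) X (\<lambda>L. wickp M L z * P z) Xs) = contr (cov M) X (\<lambda>L. LINT z|M. wickp M L z * P z) Xs"
    using assms by (intro contr_integral allmom_integrable allmom_mult wickp_allmom) auto
  have i: "integrable M (\<lambda>z. X z * wickp M Xs z * P z)"
    by (rule allmom_integrable[OF allmom_mult[OF allmom_mult[OF G_allmom wickp_allmom]]]) (rule assms)+
  have "contr (cov M) X (\<lambda>L. wickp M L z * P z) Xs = contr (cov M) X (\<lambda>L. wickp M L z) Xs * P z" for z
    using contr_mult[of "cov M" X "P z" "\<lambda>L. wickp M L z" Xs] by (simp add: mult.commute)
  then have "wickp M (X # Xs) z * P z = X z * wickp M Xs z * P z - contr (cov M) X (\<lambda>L. wickp M L z * P z) Xs" for z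
    by (simp add: left_diff_distrib)
  then have "(LINT z|M. wickp M (X # Xs) z * P z) = (LINT z|M. X z * wickp M Xs z * P z - contr (cov M) X (\<lambda>L. wickp M L z * P z) Xs)"
    by (intro Bochner_Integration.integral_cong refl)
  then show ?thesis using c i by simp
qed

text \<open>Contraction with \<open>Y\<close> is a derivation, and it differentiates a Wick product
  in the same way as an ordinary product, by removing one factor at a time. In the proof the
  recursion is applied to the first factor \<open>X\<close> of \<open>Ys\<close>, which thereby
  passes to the other list, and the resulting double contractions agree after an interchange of
  their order.\<close>

lemma wickp_ibp:
  assumes "Y \<in> G" "set Ys \<subseteq> G" "set Zs \<subseteq> G"
  shows "(LINT z|M. Y z * wickp M Ys z * prodl Zs z) =
    contr (cov M) Y (\<lambda>L. LINT z|M. wickp M L z * prodl Zs z) Ys +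
    contr (cov M) Y (\<lambda>L. LINT z|M. wickp M Ys z * prodl L z) Zs"
  using assms
proof (induction Ys arbitrary: Y Zs rule: length_induct)
  case (1 Ys)
  note Y = 1(2) and Zs = 1(4)
  show ?case
  proof (cases Ys)
    case Nil
    then show ?thesis using gaussian_ibp[OF Y Zs] by simp
  next
    case (Cons X Xs)
    have X: "X \<in> G" and Xs: "set Xs \<subseteq> G" using 1(3) Cons by auto
    define E where "E K L = (LINT z|M. wickp M K z * prodl L z)" for K L
    let ?c = "cov M"
    have IH: "(LINT z|M. Y z * wickp M K z * prodl L z) = contr ?c Y (\<lambda>K'. E K' L) K + contr ?c Y (\<lambda>L'. E K L') L"
      if "length K \<le> length Xs" "set K \<subseteq> G" "set L \<subseteq> G" for K L
      unfolding E_def by (rule 1(1)[rule_format, of K Y L]) (use that Y Cons in auto)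
    \<comment> \<open>Moving the first factor from the Wick product to the ordinary product costs
      one contraction.\<close>
    have E: "E (X # K) L = E K (X # L) - contr ?c X (\<lambda>K'. E K' L) K" if "set K \<subseteq> G" "set L \<subseteq> G" for K L
      unfolding E_def using wickp_times_integral[OF X that(1) prodl_allmom[OF that(2)]]
      by (simp add: mult_ac del: wickp.simps)
    have "(LINT z|M. Y z * wickp M Ys z * prodl Zs z) = (LINT z|M. wickp M (X # Xs) z * (Y z * prodl Zs z))"
      by (simp add: Cons mult_ac del: wickp.simps)
    also have "\<dots> = (LINT z|M. Y z * wickp M Xs z * prodl (X # Zs) z)
        - contr ?c X (\<lambda>L. LINT z|M. Y z * wickp M L z * prodl Zs z) Xs"
      using wickp_times_integral[OF X Xs allmom_mult[OF G_allmom[OF Y] prodl_allmom[OF Zs]]]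
      by (simp add: mult_ac del: wickp.simps)
    \<comment> \<open>Since \<open>X\<close> now heads the list of ordinary factors, its contraction
      with \<open>Y\<close> splits off.\<close>
    also have "(LINT z|M. Y z * wickp M Xs z * prodl (X # Zs) z) =
       contr ?c Y (\<lambda>K. E K (X # Zs)) Xs + (?c Y X * E Xs Zs + contr ?c Y (\<lambda>L. E Xs (X # L)) Zs)"
      using IH[of Xs "X # Zs"] X Xs Zs by simp
    also have "contr ?c X (\<lambda>L. LINT z|M. Y z * wickp M L z * prodl Zs z) Xs =
       contr ?c X (\<lambda>K. contr ?c Y (\<lambda>K'. E K' Zs) K + contr ?c Y (E K) Zs) Xs"
      using Xs Zs by (intro contr_cong_subset IH) auto
    also have "\<dots> = contr ?c Y (\<lambda>K. contr ?c X (\<lambda>K'. E K' Zs) K) Xs + contr ?c Y (\<lambda>L. contr ?c X (\<lambda>K. E K L) Xs) Zs"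
      by (simp only: contr_add contr_commute[of ?c X ?c Y] contr_swap[of ?c X ?c Y])
    finally have A: "(LINT z|M. Y z * wickp M Ys z * prodl Zs z) =
       contr ?c Y (\<lambda>K. E K (X # Zs)) Xs + (?c Y X * E Xs Zs + contr ?c Y (\<lambda>L. E Xs (X # L)) Zs) -
       (contr ?c Y (\<lambda>K. contr ?c X (\<lambda>K'. E K' Zs) K) Xs + contr ?c Y (\<lambda>L. contr ?c X (\<lambda>K. E K L) Xs) Zs)" .
    have "contr ?c Y (\<lambda>K. E (X # K) Zs) Xs = contr ?c Y (\<lambda>K. E K (X # Zs) - contr ?c X (\<lambda>K'. E K' Zs) K) Xs"
      using Xs Zs by (intro contr_cong_subset E) auto
    moreover have "contr ?c Y (\<lambda>L. E (X # Xs) L) Zs = contr ?c Y (\<lambda>L. E Xs (X # L) - contr ?c X (\<lambda>K. E K L) Xs) Zs"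
      using Xs Zs by (intro contr_cong_subset E) auto
    ultimately have "contr ?c Y (\<lambda>L. E L Zs) (X # Xs) + contr ?c Y (\<lambda>L. E (X # Xs) L) Zs = (LINT z|M. Y z * wickp M Ys z * prodl Zs z)"
      unfolding A by (simp add: contr_diff)
    then show ?thesis unfolding E_def Cons by (rule sym)
  qed
qed

text \<open>The corrections in the recursion of \<open>wickp\<close> cancel precisely the
  contractions of \<open>Y\<close> with \<open>Ys\<close>, so that only contractions across the two
  lists survive.\<close>

lemma wickp_prodl_step:
  assumes "Y \<in> G" "set Ys \<subseteq> G" "set Zs \<subseteq> G"
  shows "(LINT z|M. wickp M (Y # Ys) z * prodl Zs z) = contr (cov M) Y (\<lambda>L. LINT z|M. wickp M Ys z * prodl L z) Zs"
  using wickp_times_integral[OF assms(1,2) prodl_allmom[OF assms(3)]] wickp_ibp[OF assms]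
  by (simp del: wickp.simps)

text \<open>Each step removes one entry from both lists. The shorter list \<open>Zs\<close> is
  exhausted first, and a contraction over the empty list is zero.\<close>

lemma wickp_prodl_orth:
  "set Ys \<subseteq> G \<Longrightarrow> set Zs \<subseteq> G \<Longrightarrow> length Zs < length Ys \<Longrightarrow> (LINT z|M. wickp M Ys z * prodl Zs z) = 0"
proof (induction Ys arbitrary: Zs)
  case (Cons Y Ys)
  have "contr (cov M) Y (\<lambda>L. LINT z|M. wickp M Ys z * prodl L z) Zs = contr (cov M) Y (\<lambda>L. 0) Zs"
    using Cons.prems by (intro contr_cong_subset Cons.IH) auto
  then show ?case using wickp_prodl_step[of Y Ys Zs] Cons.prems by (simp add: contr_zero del: wickp.simps)
qed simp

lemma wickp_prodl_per:
  "set Ys \<subseteq> G \<Longrightarrow> set Zs \<subseteq> G \<Longrightarrow> length Zs = length Ys \<Longrightarrow>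
    (LINT z|M. wickp M Ys z * prodl Zs z) = per (cov M) Ys Zs"
proof (induction Ys arbitrary: Zs)
  case Nil
  then show ?case by (simp add: prob_space)
next
  case (Cons Y Ys)
  have "contr (cov M) Y (\<lambda>L. LINT z|M. wickp M Ys z * prodl L z) Zs = contr (cov M) Y (per (cov M) Ys) Zs"
    using Cons.prems by (intro contr_cong_subset Cons.IH) auto
  then show ?case using wickp_prodl_step[of Y Ys Zs] Cons.prems by (simp del: wickp.simps)
qed

lemma prodspan_allmom: assumes "h \<in> prodspan G n" shows "allmom M h"
  using assms unfolding prodspan_def
proof (induction rule: rspan_induct)
  case zero
  then show ?case by (rule allmom_const)
next
  case (step a g h)
  then show ?case by (intro allmom_add allmom_scale) (auto intro: prodl_allmom)
qed

lemma wickp_prodspan_orth: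
  assumes Ys: "set Ys \<subseteq> G" and h: "h \<in> prodspan G (length Ys)"
  shows "(LINT z|M. wickp M Ys z * h z) = 0"
proof -
  have "allmom M h \<and> (LINT z|M. wickp M Ys z * h z) = 0"
    using h unfolding prodspan_def
  proof (induction rule: rspan_induct)
    case zero
    then show ?case using allmom_const by simp
  next
    case (step a g h)
    then obtain L where L: "g = prodl L" "set L \<subseteq> G" "length L < length Ys" by auto
    have "integrable M (\<lambda>z. wickp M Ys z * prodl L z)" "integrable M (\<lambda>z. wickp M Ys z * h z)"
      using step Ys L by (auto intro!: allmom_integrable allmom_mult wickp_allmom prodl_allmom)
    moreover have "(\<lambda>z. wickp M Ys z * (a * g z + h z)) = (\<lambda>z. a * (wickp M Ys z * prodl L z) + wickp M Ys z * h z)"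
      by (auto simp: L algebra_simps)
    ultimately have "(LINT z|M. wickp M Ys z * (a * g z + h z)) = 0"
      using wickp_prodl_orth[OF Ys L(2,3)] step by simp
    then show ?case using step prodl_allmom[OF L(2)] L by (auto intro: allmom_add allmom_scale)
  qed
  then show ?thesis ..
qed

text \<open>The Wick product of the list that is not longer may be replaced by its ordinary product,
  because the difference has lower degree and is orthogonal to the other Wick product.\<close>

lemma wickp_wickp:
  assumes Ys: "set Ys \<subseteq> G" and Zs: "set Zs \<subseteq> G"
  shows "(LINT z|M. wickp M Ys z * wickp M Zs z) = (if length Ys = length Zs then per (cov M) Ys Zs else 0)"
proof -
  have A: "(LINT z|M. wickp M Ys z * wickp M Zs z) = (LINT z|M. wickp M Ys z * prodl Zs z)"
    if Ys: "set Ys \<subseteq> G" and Zs: "set Zs \<subseteq> G" and len: "length Zs \<le> length Ys" for Ys Zs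
  proof -
    have "(LINT z|M. wickp M Ys z * (wickp M Zs z - prodl Zs z)) = 0"
      using wickp_prodspan[OF Zs] len by (intro wickp_prodspan_orth Ys prodspan_mono[OF len])
    moreover have "(LINT z|M. wickp M Ys z * (wickp M Zs z - prodl Zs z)) =
       (LINT z|M. wickp M Ys z * wickp M Zs z) - (LINT z|M. wickp M Ys z * prodl Zs z)"
      unfolding right_diff_distrib using Ys Zs
      by (intro Bochner_Integration.integral_diff allmom_integrable allmom_mult wickp_allmom prodl_allmom)
    ultimately show ?thesis by simp
  qed
  consider "length Zs < length Ys" | "length Ys < length Zs" | "length Ys = length Zs" by linarith
  then show ?thesis
  proof cases
    case 1
    then show ?thesis using A[OF Ys Zs] wickp_prodl_orth[OF Ys Zs] by simp
  next
    case 2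
    then show ?thesis using A[OF Zs Ys] wickp_prodl_orth[OF Zs Ys] by (simp add: mult.commute)
  next
    case 3
    then show ?thesis using A[OF Ys Zs] wickp_prodl_per[OF Ys Zs] by simp
  qed
qed

lemma wickp_norm_eq: assumes "set Ys \<subseteq> G"
  shows "(LINT z|M. wickp M Ys z * wickp M Ys z) = (LINT z|M. wickp M Ys z * prodl Ys z)"
  using wickp_wickp[OF assms assms] wickp_prodl_per[OF assms assms] by simp

text \<open>The squared norm equals the integral of the Wick product against the ordinary product,
  which contains a null factor. This takes care of indices with \<open>\<sigma> j = 0\<close>, where
  a coefficient cannot be recovered by division.\<close>

lemma wickp_degenerate:
  assumes L: "set L \<subseteq> G" and Y: "Y \<in> set L" and Y0: "l2norm M Y = 0"
  shows "AE z in M. wickp M L z = 0"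
proof -
  have "AE z in M. Y z = 0" using l2norm_eq_0[OF G_L2] L Y Y0 by blast
  then have "AE z in M. wickp M L z * prodl L z = 0"
  proof eventually_elim
    case (elim z)
    then have "prodl L z = 0" using Y by (force simp: prodl_def prod_list_zero_iff)
    then show ?case by simp
  qed
  then have "(LINT z|M. wickp M L z * prodl L z) = 0"
    by (simp add: integral_eq_zero_AE)
  then have "(l2norm M (wickp M L))\<^sup>2 = 0"
    using wickp_norm_eq[OF L] by (simp add: l2norm_sq)
  then show ?thesis using l2norm_eq_0[OF allmom_L2R[OF wickp_allmom[OF L]]] by simp
qed

text \<open>The choice in \<open>l2proj\<close> is meaningful because
  \<open>prodl L - wickp M L\<close> satisfies its condition. Uniqueness holds almost everywhere; as
  \<open>V\<close> is not assumed to be a subspace, the difference of the two candidates is tested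
  against each of them separately.\<close>

lemma l2proj_prodl:
  assumes L: "set L \<subseteq> G" and V: "V \<subseteq> L2R M"
    and mem: "(\<lambda>z. prodl L z - wickp M L z) \<in> V"
    and orth: "\<And>h. h \<in> V \<Longrightarrow> (LINT z|M. wickp M L z * h z) = 0"
  shows "l2proj M V (prodl L) \<in> V" "AE z in M. prodl L z - l2proj M V (prodl L) z = wickp M L z"
proof -
  define q where "q = (\<lambda>z. prodl L z - wickp M L z)"
  define p where "p = l2proj M V (prodl L)"
  have "q \<in> V \<and> (\<forall>h\<in>V. (LINT z|M. (prodl L z - q z) * h z) = 0)"
    using mem orth by (simp add: q_def)
  then have "p \<in> V \<and> (\<forall>h\<in>V. (LINT z|M. (prodl L z - p z) * h z) = 0)"
    unfolding p_def l2proj_def by (rule someI[of "\<lambda>p. p \<in> V \<and> (\<forall>h\<in>V. (LINT z|M. (prodl L z - p z) * h z) = 0)"])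
  then have p: "p \<in> V" "\<And>h. h \<in> V \<Longrightarrow> (LINT z|M. (prodl L z - p z) * h z) = 0" by auto
  have qV: "q \<in> V" using mem by (simp add: q_def)
  have pL: "p \<in> L2R M" and qL: "q \<in> L2R M" and LL: "prodl L \<in> L2R M"
    using p qV V allmom_L2R[OF prodl_allmom[OF L]] by auto
  have d: "(LINT z|M. (p z - q z) * h z) = 0" if h: "h \<in> V" for h
  proof -
    have hL: "h \<in> L2R M" using h V by auto
    have "(LINT z|M. (p z - q z) * h z) = (LINT z|M. (prodl L z - q z) * h z - (prodl L z - p z) * h z)"
      by (intro Bochner_Integration.integral_cong) (auto simp: algebra_simps)
    also have "\<dots> = (LINT z|M. (prodl L z - q z) * h z) - (LINT z|M. (prodl L z - p z) * h z)"
      by (intro Bochner_Integration.integral_diff L2R_mult L2R_diff pL qL LL hL)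
    also have "\<dots> = 0" using p(2)[OF h] orth[OF h] by (simp add: q_def)
    finally show ?thesis .
  qed
  have pq: "(\<lambda>z. p z - q z) \<in> L2R M" by (intro L2R_diff pL qL)
  have "(l2norm M (\<lambda>z. p z - q z))\<^sup>2 = (LINT z|M. (p z - q z) * p z) - (LINT z|M. (p z - q z) * q z)"
    unfolding l2norm_sq right_diff_distrib[of "_ - _" "p _" "q _"]
    by (intro Bochner_Integration.integral_diff L2R_mult pq pL qL)
  also have "\<dots> = 0" using d[OF p(1)] d[OF qV] by simp
  finally have "AE z in M. p z - q z = 0" using l2norm_eq_0[OF pq] by simp
  then show "AE z in M. prodl L z - l2proj M V (prodl L) z = wickp M L z"
    unfolding p_def[symmetric] by eventually_elim (simp add: q_def)
  show "l2proj M V (prodl L) \<in> V" using p(1) by (simp add: p_def)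
qed

text \<open>The power series of \<open>cis (Y z)\<close> is integrated termwise. Its partial sums,
  multiplied by \<open>f\<close>, are dominated by \<open>|f| exp |Y|\<close>, which is integrable
  since \<open>exp |Y|\<close> is square integrable.\<close>

lemma orth_powers_imp_orth_cis:
  assumes f: "f \<in> L2R M" and Y: "Y \<in> G" and orth: "\<And>n. (LINT z|M. f z * Y z ^ n) = 0"
  shows "(LINT z|M. f z *\<^sub>R cis (Y z)) = 0"
proof -
  note [measurable] = L2R_D(1)[OF f] G_measurable[OF Y]
  have Yn: "(\<lambda>z. Y z ^ n) \<in> L2R M" for n
  proof -
    have "allmom M (\<lambda>z. Y z ^ n)"
      by (induction n) (auto intro: allmom_const allmom_mult[OF G_allmom[OF Y]])
    then show ?thesis by (rule allmom_L2R)
  qed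
  have ex: "(\<lambda>z. exp \<bar>Y z\<bar>) \<in> L2R M"
    using G_exp_abs_integrable[OF Y, of 2] by (intro L2R_I) (auto simp: exp_double[symmetric])
  define S where "S N z = f z *\<^sub>R (\<Sum>n<N. (\<i> * complex_of_real (Y z)) ^ n /\<^sub>R fact n)" for N z
  have "(\<lambda>N. LINT z|M. S N z) \<longlonglongrightarrow> (LINT z|M. f z *\<^sub>R cis (Y z))"
  proof (rule integral_dominated_convergence)
    show "integrable M (\<lambda>z. \<bar>f z * exp \<bar>Y z\<bar>\<bar>)" using L2R_mult[OF f ex] by simp
    show "(\<lambda>z. f z *\<^sub>R cis (Y z)) \<in> borel_measurable M" unfolding cis_conv_exp by measurable
    show "S N \<in> borel_measurable M" for N unfolding S_def[abs_def] by measurable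
    show "AE z in M. (\<lambda>N. S N z) \<longlonglongrightarrow> f z *\<^sub>R cis (Y z)"
    proof (rule AE_I2)
      fix z
      have "(\<lambda>n. (\<i> * complex_of_real (Y z)) ^ n /\<^sub>R fact n) sums cis (Y z)"
        unfolding cis_conv_exp by (rule exp_converges)
      then show "(\<lambda>N. S N z) \<longlonglongrightarrow> f z *\<^sub>R cis (Y z)"
        unfolding S_def sums_def by (intro tendsto_intros)
    qed
    show "AE z in M. norm (S N z) \<le> \<bar>f z * exp \<bar>Y z\<bar>\<bar>" for N
    proof (rule AE_I2)
      fix z
      have "norm (\<Sum>n<N. (\<i> * complex_of_real (Y z)) ^ n /\<^sub>R fact n) \<le> (\<Sum>n<N. \<bar>Y z\<bar> ^ n /\<^sub>R fact n)"
        by (rule order_trans[OF norm_sum]) (simp add: norm_power norm_mult)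
      also have "\<dots> \<le> exp \<bar>Y z\<bar>"
        using exp_converges[of "\<bar>Y z\<bar>"] sum_le_suminf[of "\<lambda>n. \<bar>Y z\<bar> ^ n /\<^sub>R fact n" "{..<N}"]
        by (auto simp: sums_iff)
      finally show "norm (S N z) \<le> \<bar>f z * exp \<bar>Y z\<bar>\<bar>"
        unfolding S_def by (simp add: abs_mult mult_left_mono)
    qed
  qed
  moreover have "(LINT z|M. S N z) = 0" for N
  proof -
    have "S N z = (\<Sum>n<N. (\<i> ^ n /\<^sub>R fact n) * complex_of_real (f z * Y z ^ n))" for z
      unfolding S_def by (simp add: sum_distrib_left power_mult_distrib scaleR_conv_of_real mult_ac)
    moreover have "integrable M (\<lambda>z. (\<i> ^ n /\<^sub>R fact n) * complex_of_real (f z * Y z ^ n))" for n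
      by (intro integrable_mult_right integrable_of_real L2R_mult f Yn)
    ultimately have "(LINT z|M. S N z) = (\<Sum>n<N. LINT z|M. (\<i> ^ n /\<^sub>R fact n) * complex_of_real (f z * Y z ^ n))"
      by simp
    also have "\<dots> = (\<Sum>n<N. (\<i> ^ n /\<^sub>R fact n) * complex_of_real (LINT z|M. f z * Y z ^ n))"
      by (simp only: Bochner_Integration.integral_mult_right_zero integral_complex_of_real)
    also have "\<dots> = 0" by (simp add: orth)
    finally show ?thesis .
  qed
  ultimately show ?thesis by (simp add: LIMSEQ_const_iff)
qed

text \<open>Triangularity: an ordinary product differs from the Wick product by terms of lower
  degree in the same variables.\<close>

lemma orth_wickp_imp_orth_prodl:
  assumes f: "f \<in> L2R M" and A: "A \<subseteq> G"
    and orth: "\<And>L. set L \<subseteq> A \<Longrightarrow> (LINT z|M. f z * wickp M L z) = 0"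
  shows "set L \<subseteq> A \<Longrightarrow> (LINT z|M. f z * prodl L z) = 0"
proof (induction L rule: length_induct)
  case (1 L)
  have LG: "set L \<subseteq> G" using 1 A by auto
  have "(\<lambda>z. wickp M L z - prodl L z) \<in> prodspan A (length L)" by (rule wickp_prodspan[OF 1(2)])
  then have "allmom M (\<lambda>z. wickp M L z - prodl L z) \<and> (LINT z|M. f z * (wickp M L z - prodl L z)) = 0"
    unfolding prodspan_def
  proof (induction rule: rspan_induct)
    case zero
    then show ?case using allmom_const by simp
  next
    case (step a g h)
    then obtain K where K: "g = prodl K" "set K \<subseteq> A" "length K < length L" by auto
    have gK: "allmom M g" using K A by (auto intro: prodl_allmom)
    have "integrable M (\<lambda>z. f z * g z)" "integrable M (\<lambda>z. f z * h z)"
      using step gK by (auto intro!: L2R_mult f allmom_L2R)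
    moreover have "(LINT z|M. f z * g z) = 0" using 1(1) K by blast
    moreover have "(\<lambda>z. f z * (a * g z + h z)) = (\<lambda>z. a * (f z * g z) + f z * h z)" by (auto simp: algebra_simps)
    ultimately have "(LINT z|M. f z * (a * g z + h z)) = 0" using step by simp
    then show ?case using step gK by (auto intro: allmom_add allmom_scale)
  qed
  moreover have "(LINT z|M. f z * (wickp M L z - prodl L z)) = (LINT z|M. f z * wickp M L z) - (LINT z|M. f z * prodl L z)"
    unfolding right_diff_distrib
    by (intro Bochner_Integration.integral_diff L2R_mult f allmom_L2R wickp_allmom prodl_allmom LG)
  ultimately show ?case using orth[OF 1(2)] by simp
qed

lemma G_sum:
  fixes d :: nat
  assumes "\<And>l. X l \<in> G" shows "(\<lambda>z. \<Sum>l<d. t l * X l z) \<in> G"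
proof (induction d)
  case 0
  then show ?case using G_scale[OF assms, of 0 0] by simp
next
  case (Suc d)
  then show ?case using G_add[OF Suc G_scale[OF assms]] by simp
qed

text \<open>The extra factor \<open>prodl L\<close> makes the induction work: one factor of the
  power is expanded and its variable moves into the list.\<close>

lemma orth_prodl_imp_orth_power:
  fixes d :: nat
  assumes f: "f \<in> L2R M" and X: "\<And>l. X l \<in> G"
    and orth: "\<And>L. set L \<subseteq> range X \<Longrightarrow> (LINT z|M. f z * prodl L z) = 0"
  shows "set L \<subseteq> range X \<Longrightarrow> (LINT z|M. f z * (prodl L z * (\<Sum>l<d. t l * X l z) ^ n)) = 0"
proof (induction n arbitrary: L)
  case 0
  then show ?case using orth by simp
next
  case (Suc n)
  have am: "allmom M (\<lambda>z. (\<Sum>l<d. t l * X l z) ^ n)" for n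
    by (induction n) (auto intro: allmom_const allmom_mult[OF G_allmom[OF G_sum[OF X]]])
  have "f z * (prodl L z * (\<Sum>l<d. t l * X l z) ^ Suc n) =
     (\<Sum>l<d. t l * (f z * (prodl (X l # L) z * (\<Sum>l<d. t l * X l z) ^ n)))" for z
    by (simp add: sum_distrib_right sum_distrib_left mult_ac)
  then have "(LINT z|M. f z * (prodl L z * (\<Sum>l<d. t l * X l z) ^ Suc n)) =
     (LINT z|M. (\<Sum>l<d. t l * (f z * (prodl (X l # L) z * (\<Sum>l<d. t l * X l z) ^ n))))"
    by (intro Bochner_Integration.integral_cong refl)
  also have "\<dots> = (\<Sum>l<d. LINT z|M. t l * (f z * (prodl (X l # L) z * (\<Sum>l<d. t l * X l z) ^ n)))"
    using X Suc.prems
    by (intro Bochner_Integration.integral_sum integrable_mult_right L2R_mult f allmom_L2R allmom_mult prodl_allmom am) auto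
  also have "\<dots> = (\<Sum>l<d. t l * (LINT z|M. f z * (prodl (X l # L) z * (\<Sum>l<d. t l * X l z) ^ n)))"
    by (simp del: prodl_simps)
  also have "\<dots> = 0" using Suc.prems by (intro sum.neutral ballI) (simp add: Suc.IH del: prodl_simps)
  finally show ?case .
qed

end

section \<open>Cylinder sets and totality of the Wick products\<close>

definition cylinders :: "'a set \<Rightarrow> (nat \<Rightarrow> 'a \<Rightarrow> real) \<Rightarrow> 'a set set" where
  "cylinders \<Omega> X = {{z \<in> \<Omega>. \<forall>l<d. X l z \<in> B l} | d B. \<forall>l. B l \<in> sets borel}"

lemma cylindersI: "(\<And>l. B l \<in> sets borel) \<Longrightarrow> A = {z \<in> \<Omega>. \<forall>l<d. X l z \<in> B l} \<Longrightarrow> A \<in> cylinders \<Omega> X"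
  unfolding cylinders_def by blast

lemma cylindersE:
  assumes "A \<in> cylinders \<Omega> X"
  obtains d B where "A = {z \<in> \<Omega>. \<forall>l<d. X l z \<in> B l}" "\<forall>l. B l \<in> sets borel"
  using assms unfolding cylinders_def by blast

lemma space_in_cylinders: "\<Omega> \<in> cylinders \<Omega> X"
  by (rule cylindersI[of "\<lambda>_. UNIV" _ _ 0]) auto

lemma Int_stable_cylinders: "Int_stable (cylinders \<Omega> X)"
proof (rule Int_stableI)
  fix A A' assume "A \<in> cylinders \<Omega> X" "A' \<in> cylinders \<Omega> X"
  then obtain d B d' B' where 1: "A = {z \<in> \<Omega>. \<forall>l<d. X l z \<in> B l}" "\<forall>l. B l \<in> sets borel"
    and 2: "A' = {z \<in> \<Omega>. \<forall>l<d'. X l z \<in> B' l}" "\<forall>l. B' l \<in> sets borel" by (elim cylindersE)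
  have "A \<inter> A' = {z \<in> \<Omega>. \<forall>l<max d d'. X l z \<in> (if l < d then B l else UNIV) \<inter> (if l < d' then B' l else UNIV)}"
    unfolding 1 2 by (auto simp: less_max_iff_disj)
  then show "A \<inter> A' \<in> cylinders \<Omega> X"
    using 1(2) 2(2) by (intro cylindersI[of "\<lambda>l. (if l < d then B l else UNIV) \<inter> (if l < d' then B' l else UNIV)"]) auto
qed

lemma indicator_cylinder:
  fixes d :: nat
  assumes "z \<in> \<Omega>" "A = {z \<in> \<Omega>. \<forall>l<d. X l z \<in> B l}"
  shows "indicator A z = (\<Prod>l<d. indicator (B l) (X l z) :: real)"
proof (cases "z \<in> A")
  case False
  then obtain l where "l < d" "X l z \<notin> B l" using assms by auto
  then have "(\<Prod>l<d. indicator (B l) (X l z) :: real) = 0" by (intro prod_zero) (auto intro!: bexI[of _ l])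
  then show ?thesis using False by simp
qed (simp add: assms)

text \<open>The sets over which \<open>h\<close> integrates to zero form a Dynkin system once the
  whole space is one of them, and a function whose integral over every measurable set is zero
  vanishes almost everywhere.\<close>

lemma (in prob_space) AE_zero_of_generator:
  fixes h :: "'a \<Rightarrow> real"
  assumes h: "integrable M h" and E: "Int_stable E" "E \<subseteq> Pow (space M)" "space M \<in> E"
    and gen: "sets M = sigma_sets (space M) E"
    and zero: "\<And>A. A \<in> E \<Longrightarrow> (LINT z|M. h z * indicator A z) = 0"
  shows "AE z in M. h z = 0"
proof (rule density_zero[OF h])
  have E_M: "A \<in> sets M" if "A \<in> sigma_sets (space M) E" for A using that gen by simp
  have ind: "integrable M (\<lambda>z. h z * indicator A z)" if "A \<in> sets M" for A
    using integrable_mult_indicator[OF that h] by (simp add: mult.commute)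
  fix A assume "A \<in> sets M"
  then have AE: "A \<in> sigma_sets (space M) E" using gen by simp
  have "(LINT z|M. h z * indicator A z) = 0"
    using E(1,2) AE
  proof (induction rule: sigma_sets_induct_disjoint)
    case (basic A) then show ?case by (rule zero)
  next
    case empty then show ?case by simp
  next
    case (compl A)
    have "(LINT z|M. h z * indicator (space M - A) z) = (LINT z|M. h z * indicator (space M) z - h z * indicator A z)"
      by (intro Bochner_Integration.integral_cong) (auto simp: indicator_def)
    also have "\<dots> = (LINT z|M. h z * indicator (space M) z) - (LINT z|M. h z * indicator A z)"
      by (intro Bochner_Integration.integral_diff ind E_M compl sigma_sets_top)
    finally show ?case using zero[OF E(3)] compl by simp
  next
    case (union A)
    have Am: "range A \<subseteq> sets M" using union E_M by auto
    have "(LINT z:(\<Union>i. A i)|M. h z) = (\<Sum>i. (LINT z:(A i)|M. h z))"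
      using union(1) Am ind[of "\<Union>i. A i"]
      by (intro lebesgue_integral_countable_add) (auto simp: disjoint_family_on_def set_integrable_def mult.commute)
    then show ?case using union by (simp add: set_lebesgue_integral_def mult.commute)
  qed
  then show "set_lebesgue_integral M A h = 0" by (simp add: set_lebesgue_integral_def mult.commute)
qed

text \<open>Orthogonality passes from Wick products to ordinary products, then to powers of linear
  combinations, to characters, and finally by Fourier uniqueness to indicators of cylinder
  sets.\<close>

lemma (in gaussian_family) wickp_complete:
  assumes f: "f \<in> L2R M" and X: "\<And>l::nat. X l \<in> G"
    and gen: "sets M = sigma_sets (space M) (cylinders (space M) X)"
    and orth: "\<And>L. set L \<subseteq> range X \<Longrightarrow> (LINT z|M. f z * wickp M L z) = 0"
  shows "AE z in M. f z = 0"
proof (rule AE_zero_of_generator[OF L2R_integrable[OF f] Int_stable_cylinders _ space_in_cylinders gen])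
  fix A assume "A \<in> cylinders (space M) X"
  then obtain d B where A: "A = {z \<in> space M. \<forall>l<d. X l z \<in> B l}" and "\<forall>l. B l \<in> sets borel"
    by (rule cylindersE)
  then have B: "\<And>l. B l \<in> sets borel" by simp
  have RX: "range X \<subseteq> G" using X by auto
  have op: "(LINT z|M. f z * prodl L z) = 0" if "set L \<subseteq> range X" for L
    using orth_wickp_imp_orth_prodl[OF f RX orth] that by blast
  have "(LINT z|M. f z * (\<Prod>l<d. indicator (B l) (X l z))) = 0"
  proof (rule fourier_uniqueness_cylinder[OF L2R_integrable[OF f] G_measurable[OF X] _ B])
    fix t
    show "(LINT z|M. f z *\<^sub>R cis (\<Sum>l<d. t l * X l z)) = 0"
      using orth_prodl_imp_orth_power[where L = "[]", OF f X op]
      by (intro orth_powers_imp_orth_cis f G_sum X) simp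
  qed
  moreover have "(LINT z|M. f z * indicator A z) = (LINT z|M. f z * (\<Prod>l<d. indicator (B l) (X l z)))"
  proof (intro Bochner_Integration.integral_cong refl)
    fix z assume "z \<in> space M"
    from indicator_cylinder[OF this A]
    show "f z * indicator A z = f z * (\<Prod>l<d. indicator (B l) (X l z))" by simp
  qed
  ultimately show "(LINT z|M. f z * indicator A z) = 0" by simp
qed (auto elim: cylindersE)

section \<open>Wick expansions\<close>

locale wick_expansion = gaussian_family M G for M :: "'a measure" and G +
  fixes g :: "'i \<Rightarrow> 'a \<Rightarrow> real" and s :: "'i \<Rightarrow> real" and A :: "nat \<Rightarrow> 'i set"
  assumes g_in: "g i \<in> G"
    and A_fin: "finite (A N)"
    and A_mono: "N \<le> N' \<Longrightarrow> A N \<subseteq> A N'"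
    and g_orth: "i \<in> (\<Union>N. A N) \<Longrightarrow> j \<in> (\<Union>N. A N) \<Longrightarrow> cov M (g i) (g j) = (if i = j then s i else 0)"
    and g_complete: "f \<in> L2R M \<Longrightarrow> (\<And>I. set I \<subseteq> (\<Union>N. A N) \<Longrightarrow> (LINT z|M. f z * wickp M (map g I) z) = 0) \<Longrightarrow> AE z in M. f z = 0"
begin

text \<open>Stated with a product instead of a quotient, so that it remains meaningful when some
  \<open>s i\<close> is zero; the second condition then does not constrain the coefficient.\<close>

definition is_coeff :: "('a \<Rightarrow> real) \<Rightarrow> ('i list \<Rightarrow> real) \<Rightarrow> bool" where
  "is_coeff f a \<longleftrightarrow> (\<forall>I J. mset I = mset J \<longrightarrow> a I = a J) \<and>
    (\<forall>I. set I \<subseteq> (\<Union>N. A N) \<longrightarrow> fact (length I) * prod_list (map s I) * a I = (LINT z|M. f z * wickp M (map g I) z))"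

text \<open>The variables \<open>h\<close> are a parameter because the coefficients of
  \<open>f\<close> are used both with the coordinates and with the coordinates composed with a power
  of \<open>T\<close>. One cutoff \<open>N\<close> bounds the degree and the indices, which keeps
  the sum finite.\<close>

definition partial_expansion :: "('i list \<Rightarrow> real) \<Rightarrow> ('i \<Rightarrow> 'a \<Rightarrow> real) \<Rightarrow> nat \<Rightarrow> 'a \<Rightarrow> real" where
  "partial_expansion a h N z = (\<Sum>k\<le>N. \<Sum>I\<in>lsts (A N) k. a I * wickp M (map h I) z)"

lemma wickp_map_L2R: "(\<And>i. h i \<in> G) \<Longrightarrow> wickp M (map h I) \<in> L2R M"
  by (intro allmom_L2R wickp_allmom) auto

lemma partial_expansion_L2R: "(\<And>i. h i \<in> G) \<Longrightarrow> partial_expansion a h N \<in> L2R M"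
  unfolding partial_expansion_def[abs_def]
  by (intro L2R_sum L2R_scale wickp_map_L2R)

lemma partial_expansion_inner:
  assumes h: "\<And>i. h i \<in> G" and F: "F \<in> L2R M"
  shows "(LINT z|M. partial_expansion a h N z * F z) =
    (\<Sum>k\<le>N. \<Sum>I\<in>lsts (A N) k. a I * (LINT z|M. wickp M (map h I) z * F z))"
proof -
  have "partial_expansion a h N z * F z = (\<Sum>k\<le>N. \<Sum>I\<in>lsts (A N) k. a I * (wickp M (map h I) z * F z))" for z
    by (simp add: partial_expansion_def sum_distrib_right mult.assoc)
  moreover have "integrable M (\<lambda>z. wickp M (map h I) z * F z)" for I
    by (intro L2R_mult wickp_map_L2R h F)
  ultimately show ?thesis by simp
qed

lemma wickp_map_inner:
  assumes h: "\<And>i. h i \<in> G"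
  shows "(LINT z|M. wickp M (map h I) z * wickp M (map g J) z) =
    (if length I = length J then per (\<lambda>i j. cov M (h i) (g j)) I J else 0)"
proof -
  have "set (map h I) \<subseteq> G" "set (map g J) \<subseteq> G" using h g_in by auto
  from wickp_wickp[OF this] show ?thesis by (simp add: per_map2)
qed

lemma pairing_step:
  assumes h: "\<And>i. h i \<in> G" and b: "\<And>I J. mset I = mset J \<Longrightarrow> b I = b J" and I: "length I \<le> N"
  shows "(LINT z|M. wickp M (map h I) z * partial_expansion b g N z) =
    fact (length I) * (\<Sum>J\<in>lsts (A N) (length I). b J * prod_list (map2 (\<lambda>i j. cov M (h i) (g j)) I J))"
proof -
  have "(LINT z|M. wickp M (map h I) z * partial_expansion b g N z) =
     (\<Sum>k\<le>N. \<Sum>J\<in>lsts (A N) k. b J * (LINT z|M. wickp M (map h I) z * wickp M (map g J) z))"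
    using partial_expansion_inner[of g "wickp M (map h I)" b N, OF g_in wickp_map_L2R] h
    by (simp add: mult.commute)
  also have "\<dots> = (\<Sum>k\<le>N. if k = length I then \<Sum>J\<in>lsts (A N) (length I). b J * per (\<lambda>i j. cov M (h i) (g j)) I J else 0)"
    unfolding wickp_map_inner[OF h]
    by (intro sum.cong refl) (auto simp: lsts_def)
  also have "\<dots> = (\<Sum>J\<in>lsts (A N) (length I). b J * per (\<lambda>i j. cov M (h i) (g j)) I J)"
    using I by simp
  also have "\<dots> = fact (length I) * (\<Sum>J\<in>lsts (A N) (length I). b J * prod_list (map2 (\<lambda>i j. cov M (h i) (g j)) I J))"
    by (rule sum_per_symmetric[OF A_fin b])
  finally show ?thesis .
qed

lemma partial_expansion_pairing:
  assumes h: "\<And>i. h i \<in> G" and b: "\<And>I J. mset I = mset J \<Longrightarrow> b I = b J"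
  shows "(LINT z|M. partial_expansion a h N z * partial_expansion b g N z) =
    (\<Sum>k\<le>N. fact k * (\<Sum>I\<in>lsts (A N) k. \<Sum>J\<in>lsts (A N) k. a I * b J * prod_list (map2 (\<lambda>i j. cov M (h i) (g j)) I J)))"
proof -
  have "(LINT z|M. partial_expansion a h N z * partial_expansion b g N z) =
     (\<Sum>k\<le>N. \<Sum>I\<in>lsts (A N) k. a I * (LINT z|M. wickp M (map h I) z * partial_expansion b g N z))"
    by (intro partial_expansion_inner h partial_expansion_L2R g_in)
  also have "\<dots> = (\<Sum>k\<le>N. \<Sum>I\<in>lsts (A N) k. a I * (fact k * (\<Sum>J\<in>lsts (A N) k. b J * prod_list (map2 (\<lambda>i j. cov M (h i) (g j)) I J))))"
  proof (intro sum.cong refl)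
    fix k I assume "k \<in> {..N}" "I \<in> lsts (A N) k"
    then have "length I = k" "length I \<le> N" by (auto simp: lsts_def)
    then show "a I * (LINT z|M. wickp M (map h I) z * partial_expansion b g N z) =
       a I * (fact k * (\<Sum>J\<in>lsts (A N) k. b J * prod_list (map2 (\<lambda>i j. cov M (h i) (g j)) I J)))"
      using pairing_step[of h b I N, OF h b] by simp
  qed
  finally show ?thesis by (simp add: sum_distrib_left mult_ac)
qed

lemma prod_list_map2_diagonal:
  assumes "length I = length J" "\<And>i j. i \<in> set I \<Longrightarrow> j \<in> set J \<Longrightarrow> c i j = (if i = j then s i else 0)"
  shows "prod_list (map2 c I J) = (if I = J then prod_list (map s I) else 0)"
  using assms
proof (induction I J rule: list_induct2)
  case (Cons i I j J)
  have "prod_list (map2 c I J) = (if I = J then prod_list (map s I) else 0)"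
    by (rule Cons.IH) (rule Cons.prems, simp_all)
  moreover have "c i j = (if i = j then s i else 0)" by (rule Cons.prems) simp_all
  ultimately show ?case by simp
qed simp

text \<open>The permanent has already become a single product, and the diagonal covariance leaves
  only the term \<open>I = J\<close>; its factors are the ones that occur in
  \<open>is_coeff\<close>.\<close>

lemma partial_expansion_inner_wickp:
  assumes a: "is_coeff f a" and J: "set J \<subseteq> A N" "length J \<le> N"
  shows "(LINT z|M. partial_expansion a g N z * wickp M (map g J) z) = (LINT z|M. f z * wickp M (map g J) z)"
proof -
  have sym: "mset I = mset J \<Longrightarrow> a I = a J" for I J using a unfolding is_coeff_def by blast
  have "(LINT z|M. partial_expansion a g N z * wickp M (map g J) z) =
     fact (length J) * (\<Sum>I\<in>lsts (A N) (length J). a I * prod_list (map2 (\<lambda>i j. cov M (g i) (g j)) J I))"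
    using pairing_step[of g a J N, OF g_in sym J(2)] by (simp add: mult.commute)
  also have "\<dots> = fact (length J) * (\<Sum>I\<in>lsts (A N) (length J). if I = J then a J * prod_list (map s J) else 0)"
  proof (intro arg_cong2[where f="(*)"] sum.cong refl)
    fix I assume I: "I \<in> lsts (A N) (length J)"
    have "prod_list (map2 (\<lambda>i j. cov M (g i) (g j)) J I) = (if J = I then prod_list (map s J) else 0)"
      using I J by (intro prod_list_map2_diagonal g_orth) (auto simp: lsts_def)
    then show "a I * prod_list (map2 (\<lambda>i j. cov M (g i) (g j)) J I) = (if I = J then a J * prod_list (map s J) else 0)"
      by auto
  qed
  also have "\<dots> = fact (length J) * prod_list (map s J) * a J"
    using J finite_lsts[OF A_fin] by (simp add: lsts_def)
  also have "\<dots> = (LINT z|M. f z * wickp M (map g J) z)"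
    using a J unfolding is_coeff_def by blast
  finally show ?thesis .
qed

text \<open>Within the cutoff \<open>N\<close> the longer expansion and \<open>f\<close> have the
  same inner products with Wick products, so the shorter expansion cannot tell them apart.\<close>

lemma partial_expansion_orth:
  assumes a: "is_coeff f a" and f: "f \<in> L2R M" and N: "N \<le> N'"
  shows "(LINT z|M. partial_expansion a g N z * partial_expansion a g N' z) = (LINT z|M. partial_expansion a g N z * f z)"
proof -
  have "(LINT z|M. partial_expansion a g N z * F z) = (\<Sum>k\<le>N. \<Sum>I\<in>lsts (A N) k. a I * (LINT z|M. f z * wickp M (map g I) z))"
    if F: "F = f \<or> F = partial_expansion a g N'" for F
  proof -
    have "F \<in> L2R M" using F f partial_expansion_L2R g_in by auto
    then have "(LINT z|M. partial_expansion a g N z * F z) = (\<Sum>k\<le>N. \<Sum>I\<in>lsts (A N) k. a I * (LINT z|M. wickp M (map g I) z * F z))"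
      by (intro partial_expansion_inner g_in)
    also have "\<dots> = (\<Sum>k\<le>N. \<Sum>I\<in>lsts (A N) k. a I * (LINT z|M. f z * wickp M (map g I) z))"
    proof (intro sum.cong refl arg_cong2[where f="(*)"])
      fix k I assume kI: "k \<in> {..N}" "I \<in> lsts (A N) k"
      then have "set I \<subseteq> A N'" "length I \<le> N'" using A_mono[OF N] N by (auto simp: lsts_def)
      then show "(LINT z|M. wickp M (map g I) z * F z) = (LINT z|M. f z * wickp M (map g I) z)"
        using F partial_expansion_inner_wickp[OF a] by (auto simp: mult.commute)
    qed
    finally show ?thesis .
  qed
  then show ?thesis by metis
qed

text \<open>By orthogonality the squared distance of two partial sums is the difference of their
  squared norms, which increase and are bounded by that of \<open>f\<close>; hence a limit exists.
  It has the same inner products with Wick products as \<open>f\<close>, and completeness identifies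
  the two.\<close>

lemma partial_expansion_tendsto:
  assumes a: "is_coeff f a" and f: "f \<in> L2R M"
  shows "(\<lambda>N. l2norm M (\<lambda>z. f z - partial_expansion a g N z)) \<longlonglongrightarrow> 0"
proof -
  let ?P = "partial_expansion a g"
  define n where "n N = (l2norm M (?P N))\<^sup>2" for N
  have P: "?P N \<in> L2R M" for N by (intro partial_expansion_L2R g_in)
  have inner: "(LINT z|M. ?P N z * ?P N' z) = n N" if "N \<le> N'" for N N'
    using partial_expansion_orth[OF a f that] partial_expansion_orth[OF a f order_refl, of N]
    by (simp add: n_def l2norm_sq)
  have dist: "(l2norm M (\<lambda>z. ?P N' z - ?P N z))\<^sup>2 = n N' - n N" if "N \<le> N'" for N N'
    using integral_diff_square[OF P P, of 1 N' 1 N] inner[OF that]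
    by (simp add: l2norm_sq[of M "\<lambda>z. ?P N' z - ?P N z"] n_def mult.commute)
  have mono: "incseq n"
  proof (rule incseq_SucI)
    fix N
    have "0 \<le> n (Suc N) - n N" unfolding dist[OF le_SucI[OF order_refl], symmetric] by simp
    then show "n N \<le> n (Suc N)" by simp
  qed
  have "n N \<le> (l2norm M f)\<^sup>2" for N
  proof -
    have "0 \<le> (l2norm M (\<lambda>z. f z - ?P N z))\<^sup>2" by simp
    also have "\<dots> = (l2norm M f)\<^sup>2 - n N"
      using integral_diff_square[OF f P, of 1 1 N] partial_expansion_orth[OF a f order_refl, of N]
      by (simp add: l2norm_sq[of M "\<lambda>z. f z - ?P N z"] n_def mult.commute l2norm_sq[of M "?P N"])
    finally show ?thesis by simp
  qed
  then have "convergent n"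
    using mono by (metis incseq_convergent convergentI)
  then have "Cauchy n" by (rule convergent_Cauchy)
  have "\<exists>F. F \<in> L2R M \<and> (\<lambda>N. l2norm M (\<lambda>z. F z - ?P N z)) \<longlonglongrightarrow> 0"
  proof (rule l2_complete[of ?P])
    fix e :: real assume e: "e > 0"
    then obtain N where N: "\<And>i j. i \<ge> N \<Longrightarrow> j \<ge> N \<Longrightarrow> \<bar>n i - n j\<bar> < e\<^sup>2"
      using \<open>Cauchy n\<close> unfolding Cauchy_def dist_real_def by (meson zero_less_power)
    have "l2norm M (\<lambda>z. ?P i z - ?P j z) < e" if "i \<ge> N" "j \<ge> N" for i j
    proof -
      have "(l2norm M (\<lambda>z. ?P i z - ?P j z))\<^sup>2 = \<bar>n i - n j\<bar>"
      proof (cases "j \<le> i")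
        case True
        then show ?thesis using dist[OF True] incseqD[OF mono True] by simp
      next
        case False
        then have "i \<le> j" by simp
        then show ?thesis using dist incseqD[OF mono] by (subst l2norm_minus_commute) simp
      qed
      then have "(l2norm M (\<lambda>z. ?P i z - ?P j z))\<^sup>2 < e\<^sup>2" using N[OF that] by simp
      then show ?thesis by (rule power2_less_imp_less) (use e in simp)
    qed
    then show "\<exists>N. \<forall>i\<ge>N. \<forall>j\<ge>N. l2norm M (\<lambda>z. ?P i z - ?P j z) < e" by blast
  qed (use P in auto)
  then obtain F where F: "F \<in> L2R M" and lim: "(\<lambda>N. l2norm M (\<lambda>z. F z - ?P N z)) \<longlonglongrightarrow> 0" by blast
  have "AE z in M. F z - f z = 0"
  proof (rule g_complete)
    show "(\<lambda>z. F z - f z) \<in> L2R M" by (intro L2R_diff F f)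
    fix I assume I: "set I \<subseteq> (\<Union>N. A N)"
    have "\<exists>N. set I \<subseteq> A N"
      using I
    proof (induction I)
      case (Cons i I)
      then obtain N N' where "i \<in> A N" "set I \<subseteq> A N'" by auto
      then have "set (i # I) \<subseteq> A (max N N')" using A_mono[of N "max N N'"] A_mono[of N' "max N N'"] by auto
      then show ?case ..
    qed simp
    then obtain N where N: "set I \<subseteq> A N" by blast
    have W: "wickp M (map g I) \<in> L2R M" by (intro wickp_map_L2R g_in)
    have c1: "(\<lambda>N. LINT z|M. ?P N z * wickp M (map g I) z) \<longlonglongrightarrow> (LINT z|M. F z * wickp M (map g I) z)"
      using l2_tendsto_integral_mult[OF F W P W lim] by (simp add: l2norm_def)
    have c2: "\<forall>\<^sub>F n in sequentially. (LINT z|M. ?P n z * wickp M (map g I) z) = (LINT z|M. f z * wickp M (map g I) z)"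
    proof (rule eventually_sequentiallyI[of "max N (length I)"])
      fix n assume "max N (length I) \<le> n"
      then show "(LINT z|M. ?P n z * wickp M (map g I) z) = (LINT z|M. f z * wickp M (map g I) z)"
        using N A_mono[of N n] by (intro partial_expansion_inner_wickp a) auto
    qed
    have "(LINT z|M. F z * wickp M (map g I) z) = (LINT z|M. f z * wickp M (map g I) z)"
      by (rule LIMSEQ_unique[OF c1 tendsto_eventually[OF c2]])
    then show "(LINT z|M. (F z - f z) * wickp M (map g I) z) = 0"
      using L2R_mult[OF F W] L2R_mult[OF f W] by (simp add: left_diff_distrib)
  qed
  then have "AE z in M. (F z - ?P N z)\<^sup>2 = (f z - ?P N z)\<^sup>2" for N by auto
  then have "(LINT z|M. (F z - ?P N z)\<^sup>2) = (LINT z|M. (f z - ?P N z)\<^sup>2)" for N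
    using L2R_D(1)[OF F] L2R_D(1)[OF f] L2R_D(1)[OF P] by (intro integral_cong_AE) simp_all
  then show ?thesis using lim by (simp add: l2norm_def)
qed

end

section \<open>Multilinear forms and kernels of finite rank\<close>

definition vnorm :: "'i set \<Rightarrow> ('i \<Rightarrow> real) \<Rightarrow> real" where
  "vnorm A u = sqrt (\<Sum>i\<in>A. (u i)\<^sup>2)"

lemma vnorm_nonneg: "0 \<le> vnorm A u"
  by (simp add: vnorm_def sum_nonneg)

definition mform :: "'i set \<Rightarrow> ('i list \<Rightarrow> real) \<Rightarrow> ('i \<Rightarrow> real) list \<Rightarrow> real" where
  "mform A a xs = (\<Sum>I\<in>lsts A (length xs). a I * prod_list (map2 (\<lambda>u i. u i) xs I))"

definition mform_bounded :: "'i set \<Rightarrow> ('i list \<Rightarrow> real) \<Rightarrow> nat \<Rightarrow> real \<Rightarrow> bool" where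
  "mform_bounded A a k B \<longleftrightarrow> (\<forall>xs. length xs = k \<longrightarrow> \<bar>mform A a xs\<bar> \<le> B * prod_list (map (vnorm A) xs))"

lemma sum_lsts_prod_list:
  assumes "finite Q" shows "(\<Sum>qs\<in>lsts Q k. prod_list (map w qs)) = (\<Sum>q\<in>Q. w q :: real) ^ k"
  by (induction k) (auto simp: lsts_0 sum_lsts_Suc[OF assms] sum_distrib_left[symmetric] sum_distrib_right)

lemma prod_list_map2_bilinear:
  assumes Q: "finite Q" and "length I = length J"
    and "\<And>i j. i \<in> set I \<Longrightarrow> j \<in> set J \<Longrightarrow> c i j = (\<Sum>q\<in>Q. u q i * v q j :: real)"
  shows "prod_list (map2 c I J) =
    (\<Sum>qs\<in>lsts Q (length I). prod_list (map2 (\<lambda>u i. u i) (map u qs) I) * prod_list (map2 (\<lambda>u i. u i) (map v qs) J))"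
  using assms(2,3)
proof (induction I J rule: list_induct2)
  case Nil
  then show ?case by (simp add: lsts_0)
next
  case (Cons i I j J)
  have IH: "prod_list (map2 c I J) = (\<Sum>qs\<in>lsts Q (length I). prod_list (map2 (\<lambda>u i. u i) (map u qs) I) * prod_list (map2 (\<lambda>u i. u i) (map v qs) J))"
    by (rule Cons.IH) (rule Cons.prems, auto)
  have "prod_list (map2 c (i # I) (j # J)) = (\<Sum>q\<in>Q. u q i * v q j) * prod_list (map2 c I J)"
    using Cons.prems[of i j] by simp
  also have "\<dots> = (\<Sum>q\<in>Q. \<Sum>qs\<in>lsts Q (length I). (u q i * v q j) *
     (prod_list (map2 (\<lambda>u i. u i) (map u qs) I) * prod_list (map2 (\<lambda>u i. u i) (map v qs) J)))"
    unfolding IH sum_product ..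
  finally show ?case by (simp add: sum_lsts_Suc[OF Q] mult_ac)
qed

text \<open>Inserting the decomposition separates the two forms: for each list \<open>qs\<close> one
  is evaluated at the vectors \<open>u q\<close>, the other at the vectors \<open>v q\<close>. The
  sum of the bounds over all \<open>qs\<close> is the \<open>k\<close>-th power of the total
  norm.\<close>

lemma bilinear_rank_one_bound:
  assumes A: "finite A" and Q: "finite Q"
    and c: "\<And>i j. i \<in> A \<Longrightarrow> j \<in> A \<Longrightarrow> c i j = (\<Sum>q\<in>Q. u q i * v q j)"
    and K: "(\<Sum>q\<in>Q. vnorm A (u q) * vnorm A (v q)) \<le> K"
    and a: "mform_bounded A a k Ba" and b: "mform_bounded A b k Bb" and B: "0 \<le> Ba" "0 \<le> Bb"
  shows "\<bar>\<Sum>I\<in>lsts A k. \<Sum>J\<in>lsts A k. a I * b J * prod_list (map2 c I J)\<bar> \<le> Ba * Bb * K ^ k"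
proof -
  have "(\<Sum>I\<in>lsts A k. \<Sum>J\<in>lsts A k. a I * b J * prod_list (map2 c I J)) =
    (\<Sum>I\<in>lsts A k. \<Sum>J\<in>lsts A k. \<Sum>qs\<in>lsts Q k.
      (a I * prod_list (map2 (\<lambda>u i. u i) (map u qs) I)) * (b J * prod_list (map2 (\<lambda>u i. u i) (map v qs) J)))"
  proof (intro sum.cong refl)
    fix I J assume IJ: "I \<in> lsts A k" "J \<in> lsts A k"
    have "prod_list (map2 c I J) = (\<Sum>qs\<in>lsts Q (length I). prod_list (map2 (\<lambda>u i. u i) (map u qs) I) * prod_list (map2 (\<lambda>u i. u i) (map v qs) J))"
      using IJ by (intro prod_list_map2_bilinear Q c) (auto simp: lsts_def)
    moreover have "length I = k" using IJ by (simp add: lsts_def)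
    ultimately show "a I * b J * prod_list (map2 c I J) = (\<Sum>qs\<in>lsts Q k.
      (a I * prod_list (map2 (\<lambda>u i. u i) (map u qs) I)) * (b J * prod_list (map2 (\<lambda>u i. u i) (map v qs) J)))"
      by (simp add: sum_distrib_left mult_ac)
  qed
  also have "\<dots> = (\<Sum>I\<in>lsts A k. \<Sum>qs\<in>lsts Q k. \<Sum>J\<in>lsts A k.
      (a I * prod_list (map2 (\<lambda>u i. u i) (map u qs) I)) * (b J * prod_list (map2 (\<lambda>u i. u i) (map v qs) J)))"
    by (intro sum.cong refl sum.swap)
  also have "\<dots> = (\<Sum>qs\<in>lsts Q k. \<Sum>I\<in>lsts A k. \<Sum>J\<in>lsts A k.
      (a I * prod_list (map2 (\<lambda>u i. u i) (map u qs) I)) * (b J * prod_list (map2 (\<lambda>u i. u i) (map v qs) J)))"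
    by (rule sum.swap)
  also have "\<dots> = (\<Sum>qs\<in>lsts Q k. mform A a (map u qs) * mform A b (map v qs))"
  proof (intro sum.cong refl)
    fix qs assume "qs \<in> lsts Q k"
    then have l: "length qs = k" by (simp add: lsts_def)
    show "(\<Sum>I\<in>lsts A k. \<Sum>J\<in>lsts A k.
      (a I * prod_list (map2 (\<lambda>u i. u i) (map u qs) I)) * (b J * prod_list (map2 (\<lambda>u i. u i) (map v qs) J))) =
      mform A a (map u qs) * mform A b (map v qs)"
      unfolding mform_def length_map l sum_product ..
  qed
  finally have "\<bar>\<Sum>I\<in>lsts A k. \<Sum>J\<in>lsts A k. a I * b J * prod_list (map2 c I J)\<bar> \<le>
     (\<Sum>qs\<in>lsts Q k. \<bar>mform A a (map u qs) * mform A b (map v qs)\<bar>)"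
    by (simp only: sum_abs)
  also have "\<dots> \<le> (\<Sum>qs\<in>lsts Q k. Ba * Bb * prod_list (map (\<lambda>q. vnorm A (u q) * vnorm A (v q)) qs))"
  proof (rule sum_mono)
    fix qs assume "qs \<in> lsts Q k"
    then have l: "length qs = k" by (simp add: lsts_def)
    have p: "0 \<le> prod_list (map (vnorm A) (map u qs))"
      by (intro prod_list_nonneg) (auto simp: vnorm_nonneg)
    have "\<bar>mform A a (map u qs)\<bar> * \<bar>mform A b (map v qs)\<bar> \<le>
       (Ba * prod_list (map (vnorm A) (map u qs))) * (Bb * prod_list (map (vnorm A) (map v qs)))"
      using a[unfolded mform_bounded_def, rule_format, of "map u qs"] b[unfolded mform_bounded_def, rule_format, of "map v qs"]
        l B p by (intro mult_mono mult_nonneg_nonneg) simp_all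
    also have "\<dots> = Ba * Bb * prod_list (map (\<lambda>q. vnorm A (u q) * vnorm A (v q)) qs)"
    proof -
      have "prod_list (map (vnorm A) (map u qs)) * prod_list (map (vnorm A) (map v qs)) = prod_list (map (\<lambda>q. vnorm A (u q) * vnorm A (v q)) qs)"
        by (induction qs) (simp_all add: mult_ac)
      then show ?thesis by (simp add: mult_ac)
    qed
    finally show "\<bar>mform A a (map u qs) * mform A b (map v qs)\<bar> \<le> Ba * Bb * prod_list (map (\<lambda>q. vnorm A (u q) * vnorm A (v q)) qs)"
      by (simp add: abs_mult)
  qed
  also have "\<dots> = Ba * Bb * (\<Sum>q\<in>Q. vnorm A (u q) * vnorm A (v q)) ^ k"
    by (simp add: sum_distrib_left[symmetric] sum_lsts_prod_list[OF Q])
  also have "\<dots> \<le> Ba * Bb * K ^ k"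
    using B K by (intro mult_left_mono power_mono sum_nonneg mult_nonneg_nonneg vnorm_nonneg) auto
  finally show ?thesis .
qed

text \<open>Entrywise limits of finite rank kernels whose projective norm is at most
  \<open>K\<close>. The index type \<open>nat \<times> bool\<close> is dictated by the application:
  a node of a Riemann sum together with the choice between real and imaginary part.\<close>

definition rank_one_approx :: "'i set \<Rightarrow> real \<Rightarrow> ('i \<Rightarrow> 'i \<Rightarrow> real) \<Rightarrow> bool" where
  "rank_one_approx A K c \<longleftrightarrow> (\<exists>C. (\<forall>i\<in>A. \<forall>j\<in>A. (\<lambda>n. C n i j) \<longlonglongrightarrow> c i j) \<and>
    (\<forall>n::nat. \<exists>(Q :: (nat \<times> bool) set) u v. finite Q \<and> (\<forall>i\<in>A. \<forall>j\<in>A. C n i j = (\<Sum>q\<in>Q. u q i * v q j)) \<and>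
       (\<Sum>q\<in>Q. vnorm A (u q) * vnorm A (v q)) \<le> K))"

lemma bilinear_approx_bound:
  assumes A: "finite A" and c: "rank_one_approx A K c"
    and a: "mform_bounded A a k Ba" and b: "mform_bounded A b k Bb" and B: "0 \<le> Ba" "0 \<le> Bb"
  shows "\<bar>\<Sum>I\<in>lsts A k. \<Sum>J\<in>lsts A k. a I * b J * prod_list (map2 c I J)\<bar> \<le> Ba * Bb * K ^ k"
proof -
  obtain C where C: "\<And>i j. i \<in> A \<Longrightarrow> j \<in> A \<Longrightarrow> (\<lambda>n. C n i j) \<longlonglongrightarrow> c i j"
    and R: "\<And>n::nat. \<exists>(Q :: (nat \<times> bool) set) u v. finite Q \<and> (\<forall>i\<in>A. \<forall>j\<in>A. C n i j = (\<Sum>q\<in>Q. u q i * v q j)) \<and>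
       (\<Sum>q\<in>Q. vnorm A (u q) * vnorm A (v q)) \<le> K"
    using c unfolding rank_one_approx_def by blast
  have lim: "(\<lambda>n. prod_list (map2 (C n) I J)) \<longlonglongrightarrow> prod_list (map2 c I J)" if "length I = length J" "set I \<subseteq> A" "set J \<subseteq> A" for I J
    using that by (induction I J rule: list_induct2) (auto intro!: tendsto_mult C)
  have "(\<lambda>n. \<bar>\<Sum>I\<in>lsts A k. \<Sum>J\<in>lsts A k. a I * b J * prod_list (map2 (C n) I J)\<bar>) \<longlonglongrightarrow>
     \<bar>\<Sum>I\<in>lsts A k. \<Sum>J\<in>lsts A k. a I * b J * prod_list (map2 c I J)\<bar>"
    by (intro tendsto_intros lim) (auto simp: lsts_def)
  moreover have "\<bar>\<Sum>I\<in>lsts A k. \<Sum>J\<in>lsts A k. a I * b J * prod_list (map2 (C n) I J)\<bar> \<le> Ba * Bb * K ^ k" for n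
  proof -
    obtain Q :: "(nat \<times> bool) set" and u v where "finite Q" "\<And>i j. i \<in> A \<Longrightarrow> j \<in> A \<Longrightarrow> C n i j = (\<Sum>q\<in>Q. u q i * v q j)"
       "(\<Sum>q\<in>Q. vnorm A (u q) * vnorm A (v q)) \<le> K" using R[of n] by blast
    then show ?thesis by (intro bilinear_rank_one_bound[OF A _ _ _ a b B])
  qed
  ultimately show ?thesis by (intro LIMSEQ_le_const2) auto
qed

lemma lsts_nth: "I \<in> lsts A k \<Longrightarrow> j < k \<Longrightarrow> I ! j \<in> A"
  unfolding lsts_def by (clarify, erule subsetD, erule nth_mem)

text \<open>\<open>Bnorm\<close> is a supremum over finitely supported unit vectors, so the estimate
  follows by homogeneity. A vector vanishing on \<open>A\<close> cannot be normalised, but then both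
  sides are zero.\<close>

lemma mform_bounded_Bnorm:
  assumes A: "finite A" "0 \<notin> A" and bdd: "Bbdd a k"
  shows "mform_bounded A a k (Bnorm a k)"
  unfolding mform_bounded_def
proof (intro allI impI)
  fix xs :: "(int \<Rightarrow> real) list" assume len: "length xs = k"
  have pl: "prod_list (map2 (\<lambda>u i. u i) xs I) = (\<Prod>j<k. (xs ! j) (I ! j))" if "length I = k" for I
    using that len by (simp add: prod.list_conv_set_nth atLeast0LessThan)
  have pv: "prod_list (map (vnorm A) xs) = (\<Prod>j<k. vnorm A (xs ! j))"
    using len by (simp add: prod.list_conv_set_nth atLeast0LessThan)
  show "\<bar>mform A a xs\<bar> \<le> Bnorm a k * prod_list (map (vnorm A) xs)"
  proof (cases "\<exists>j<k. vnorm A (xs ! j) = 0")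
    case True
    then obtain j where j: "j < k" "vnorm A (xs ! j) = 0" by blast
    then have "(xs ! j) i = 0" if "i \<in> A" for i
      using that A by (simp add: vnorm_def sum_nonneg_eq_0_iff)
    moreover have "I ! j \<in> A" if "I \<in> lsts A k" for I
      using that j(1) by (rule lsts_nth)
    ultimately have "(\<Prod>j<k. (xs ! j) (I ! j)) = 0" if "I \<in> lsts A k" for I
      using that j(1) by (intro prod_zero) auto
    then have "mform A a xs = 0"
      unfolding mform_def len by (intro sum.neutral) (auto simp: pl lsts_def)
    moreover have "prod_list (map (vnorm A) xs) = 0" unfolding pv using j by (intro prod_zero) auto
    ultimately show ?thesis by simp
  next
    case False
    \<comment> \<open>Cut off outside \<open>A\<close>, which does not contain \<open>0\<close>, the
      vectors meet the requirements of \<open>unitfs\<close>, while the form over \<open>A\<close>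
      does not notice the change.\<close>
    define y where "y j i = (if i \<in> A then (xs ! j) i / vnorm A (xs ! j) else 0)" for j i
    have y0: "y j i = 0" if "i \<notin> A" for j i using that by (simp add: y_def)
    have supp: "{i. y j i \<noteq> 0} \<subseteq> A" for j using y0 by auto
    have "unitfs k y"
      unfolding unitfs_def
    proof (intro allI impI conjI)
      fix j assume j: "j < k"
      show "y j 0 = 0" using A by (simp add: y_def)
      show "finite {i. y j i \<noteq> 0}" using supp A finite_subset by blast
      have "(\<Sum>i\<in>{i. y j i \<noteq> 0}. (y j i)\<^sup>2) = (\<Sum>i\<in>A. (y j i)\<^sup>2)"
        using A supp[of j] by (intro sum.mono_neutral_left) auto
      also have "\<dots> = (\<Sum>i\<in>A. ((xs ! j) i)\<^sup>2) / (vnorm A (xs ! j))\<^sup>2"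
        by (simp add: y_def power_divide sum_divide_distrib)
      also have "\<dots> = 1"
        using False j by (simp add: vnorm_def sum_nonneg)
      finally show "(\<Sum>i\<in>{i. y j i \<noteq> 0}. (y j i)\<^sup>2) = 1" .
    qed
    then have "\<bar>Bval a k y\<bar> \<in> Bvals a k" by (auto simp: Bvals_def)
    then have le: "\<bar>Bval a k y\<bar> \<le> Bnorm a k"
      using bdd unfolding Bnorm_def Bbdd_def by (rule cSup_upper)
    have "Bval a k y = (\<Sum>I\<in>lsts A k. a I * (\<Prod>j<k. y j (I ! j)))"
      unfolding Bval_def
    proof (rule sum.mono_neutral_left)
      show "finite (lsts A k)" by (rule finite_lsts[OF A(1)])
      show "{is. length is = k \<and> set is \<subseteq> (\<Union>j<k. {i. y j i \<noteq> 0})} \<subseteq> lsts A k"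
        using supp by (fastforce simp: lsts_def)
      show "\<forall>I\<in>lsts A k - {is. length is = k \<and> set is \<subseteq> (\<Union>j<k. {i. y j i \<noteq> 0})}. a I * (\<Prod>j<k. y j (I ! j)) = 0"
      proof
        fix I assume I: "I \<in> lsts A k - {is. length is = k \<and> set is \<subseteq> (\<Union>j<k. {i. y j i \<noteq> 0})}"
        then have "\<exists>i\<in>set I. i \<notin> (\<Union>j<k. {i. y j i \<noteq> 0})" by (auto simp: lsts_def)
        then obtain i where "i \<in> set I" "i \<notin> (\<Union>j<k. {i. y j i \<noteq> 0})" by blast
        then obtain l where "l < k" "y l (I ! l) = 0" using I by (auto simp: in_set_conv_nth lsts_def)
        then have "(\<Prod>j<k. y j (I ! j)) = 0" by (intro prod_zero) auto
        then show "a I * (\<Prod>j<k. y j (I ! j)) = 0" by simp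
      qed
    qed
    also have "\<dots> = (\<Sum>I\<in>lsts A k. a I * prod_list (map2 (\<lambda>u i. u i) xs I) / (\<Prod>j<k. vnorm A (xs ! j)))"
    proof (intro sum.cong refl)
      fix I assume I: "I \<in> lsts A k"
      then have "(\<Prod>j<k. y j (I ! j)) = (\<Prod>j<k. (xs ! j) (I ! j) / vnorm A (xs ! j))"
        using lsts_nth[OF I] by (intro prod.cong refl) (simp add: y_def)
      then show "a I * (\<Prod>j<k. y j (I ! j)) = a I * prod_list (map2 (\<lambda>u i. u i) xs I) / (\<Prod>j<k. vnorm A (xs ! j))"
        using I by (simp add: prod_dividef pl lsts_def)
    qed
    also have "\<dots> = mform A a xs / (\<Prod>j<k. vnorm A (xs ! j))"
      by (simp add: mform_def len sum_divide_distrib)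
    finally have "mform A a xs = Bval a k y * (\<Prod>j<k. vnorm A (xs ! j))"
      using False by simp
    then show ?thesis
      unfolding pv using le by (simp add: abs_mult abs_prod vnorm_nonneg mult_right_mono prod_nonneg)
  qed
qed

lemma Bvals_nonempty: "Bvals a k \<noteq> {}"
proof -
  have "unitfs k (\<lambda>j i. if i = 1 then 1 else 0)" by (simp add: unitfs_def)
  then show ?thesis by (auto simp: Bvals_def)
qed

lemma Bnorm_nonneg: assumes "Bbdd a k" shows "0 \<le> Bnorm a k"
proof -
  obtain x where x: "x \<in> Bvals a k" using Bvals_nonempty by blast
  then have "0 \<le> x" by (auto simp: Bvals_def)
  also have "x \<le> Bnorm a k" using assms x unfolding Bnorm_def Bbdd_def by (intro cSup_upper)
  finally show ?thesis .
qed

section \<open>Hilbert space\<close>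

locale complex_hilbert =
  fixes cm :: "complex \<Rightarrow> 'h::banach \<Rightarrow> 'h" and ci :: "'h \<Rightarrow> 'h \<Rightarrow> complex"
  assumes chil: "chilbert cm ci"
begin

lemma cm_of_real: "cm (complex_of_real r) x = r *\<^sub>R x"
  and cm_add_left: "cm (a + b) x = cm a x + cm b x"
  and cm_cm: "cm a (cm b x) = cm (a * b) x"
  and ci_add_right: "ci x (y + z) = ci x y + ci x z"
  and ci_cm_right: "ci x (cm a y) = a * ci x y"
  and ci_commute: "ci y x = cnj (ci x y)"
  and norm_eq_ci: "norm x = sqrt (Re (ci x x))"
  using chil unfolding chilbert_def by blast+

lemma ci_add_left: "ci (x + y) z = ci x z + ci y z"
  by (metis ci_commute ci_add_right complex_cnj_add)

lemma ci_cm_left: "ci (cm a x) y = cnj a * ci x y"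
  by (metis ci_commute ci_cm_right complex_cnj_mult)

lemma ci_scaleR_right: "ci x (r *\<^sub>R y) = r * ci x y"
  using ci_cm_right[of x "complex_of_real r" y] by (simp add: cm_of_real)

lemma ci_scaleR_left: "ci (r *\<^sub>R x) y = r * ci x y"
  using ci_cm_left[of "complex_of_real r" x y] by (simp add: cm_of_real)

lemma ci_zero_right [simp]: "ci x 0 = 0" using ci_scaleR_right[of x 0 0] by simp
lemma ci_zero_left [simp]: "ci 0 x = 0" using ci_scaleR_left[of 0 0 x] by simp

lemma ci_diff_right: "ci x (y - z) = ci x y - ci x z"
  using ci_add_right[of x y "(-1) *\<^sub>R z"] ci_scaleR_right[of x "-1" z] by simp

lemma ci_diff_left: "ci (x - y) z = ci x z - ci y z"
  using ci_add_left[of x "(-1) *\<^sub>R y" z] ci_scaleR_left[of "-1" y z] by simp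

lemma ci_sum_right: "ci x (\<Sum>i\<in>A. f i) = (\<Sum>i\<in>A. ci x (f i))"
  by (induction A rule: infinite_finite_induct) (auto simp: ci_add_right)

lemma ci_sum_left: "ci (\<Sum>i\<in>A. f i) x = (\<Sum>i\<in>A. ci (f i) x)"
  by (induction A rule: infinite_finite_induct) (auto simp: ci_add_left)

lemma ci_self: "ci x x = complex_of_real ((norm x)\<^sup>2)"
proof -
  have "Im (ci x x) = 0" using ci_commute[of x x] by (simp add: complex_eq_iff)
  moreover have "0 \<le> Re (ci x x)" using norm_eq_ci[of x] norm_ge_zero[of x] by (metis real_sqrt_ge_0_iff)
  ultimately show ?thesis using norm_eq_ci[of x] by (simp add: complex_eq_iff)
qed

lemma norm_sq_diff: "(norm (x - y))\<^sup>2 = (norm x)\<^sup>2 - 2 * Re (ci x y) + (norm y)\<^sup>2"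
proof -
  have "complex_of_real ((norm (x - y))\<^sup>2) = complex_of_real ((norm x)\<^sup>2) - (ci x y + cnj (ci x y)) + complex_of_real ((norm y)\<^sup>2)"
    unfolding ci_self[symmetric] by (simp add: ci_diff_left ci_diff_right ci_commute[of x y])
  then have "complex_of_real ((norm (x - y))\<^sup>2) = complex_of_real ((norm x)\<^sup>2 - 2 * Re (ci x y) + (norm y)\<^sup>2)"
    by (simp add: complex_add_cnj)
  then show ?thesis by (simp only: of_real_eq_iff)
qed

lemma norm_cm: "norm (cm a x) = cmod a * norm x"
proof -
  have "complex_of_real ((norm (cm a x))\<^sup>2) = complex_of_real ((cmod a * norm x)\<^sup>2)"
  proof -
    have "ci (cm a x) (cm a x) = (a * cnj a) * ci x x" by (simp add: ci_cm_left ci_cm_right mult_ac)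
    then show ?thesis
      unfolding ci_self complex_norm_square[symmetric] power_mult_distrib of_real_mult .
  qed
  then have "(norm (cm a x))\<^sup>2 = (cmod a * norm x)\<^sup>2" by (simp only: of_real_eq_iff)
  then show ?thesis by (rule power2_eq_imp_eq) simp_all
qed

lemma cmod_ci_le: "cmod (ci x y) \<le> norm x * norm y"
proof (cases "x = 0")
  case False
  \<comment> \<open>\<open>cm a x\<close> is the projection of \<open>y\<close> onto the line
    through \<open>x\<close>.\<close>
  define a where "a = ci x y / ci x x"
  have n: "(norm x)\<^sup>2 > 0" using False by simp
  have "0 \<le> (norm (y - cm a x))\<^sup>2" by simp
  also have "\<dots> = (norm y)\<^sup>2 - 2 * Re (ci y (cm a x)) + (norm (cm a x))\<^sup>2" by (rule norm_sq_diff)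
  also have "Re (ci y (cm a x)) = (cmod (ci x y))\<^sup>2 / (norm x)\<^sup>2"
  proof -
    have "ci y (cm a x) = complex_of_real ((cmod (ci x y))\<^sup>2 / (norm x)\<^sup>2)"
      unfolding ci_cm_right a_def ci_self ci_commute[of y x] of_real_divide complex_norm_square by simp
    then show ?thesis by simp
  qed
  also have "(norm (cm a x))\<^sup>2 = (cmod (ci x y))\<^sup>2 / (norm x)\<^sup>2"
  proof -
    have "cmod a = cmod (ci x y) / (norm x)\<^sup>2" by (simp add: a_def ci_self norm_divide norm_power)
    then show ?thesis using n by (simp add: norm_cm power2_eq_square)
  qed
  finally have "(cmod (ci x y))\<^sup>2 / (norm x)\<^sup>2 \<le> (norm y)\<^sup>2" by simp
  then have "(cmod (ci x y))\<^sup>2 \<le> (norm x * norm y)\<^sup>2"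
    using n by (simp add: field_simps power_mult_distrib)
  then show ?thesis by (rule power2_le_imp_le) simp
qed simp

lemma bounded_linear_ci: "bounded_linear (ci x)"
  by (rule bounded_linear_intro[of _ "norm x"])
    (auto simp: ci_add_right ci_scaleR_right scaleR_conv_of_real cmod_ci_le mult.commute[of "norm _" "norm x"])

lemma ci_measurable [measurable]: "ci x \<in> borel_measurable borel"
  by (intro borel_measurable_continuous_onI linear_continuous_on bounded_linear_ci)

end

section \<open>Orthonormal bases and adjoints\<close>

locale hilbert_basis = complex_hilbert cm ci for cm :: "complex \<Rightarrow> 'h::banach \<Rightarrow> 'h" and ci +
  fixes e :: "nat \<Rightarrow> 'h"
  assumes onb: "\<And>i j. i \<ge> 1 \<Longrightarrow> j \<ge> 1 \<Longrightarrow> ci (e i) (e j) = (if i = j then 1 else 0)"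
    and onb_span: "closure (cspan cm (e ` {1..})) = UNIV"
begin

definition proj :: "nat \<Rightarrow> 'h \<Rightarrow> 'h" where
  "proj N x = (\<Sum>j\<in>{1..N}. cm (ci (e j) x) (e j))"

lemma ci_e_sum: "j \<in> {1..N} \<Longrightarrow> ci (e j) (\<Sum>i\<in>{1..N}. cm (c i) (e i)) = c j"
  by (simp add: ci_sum_right ci_cm_right onb if_distrib[of "\<lambda>x. _ * x"] cong: if_cong)

lemma norm_sq_sum: "(norm (\<Sum>i\<in>{1..N}. cm (c i) (e i)))\<^sup>2 = (\<Sum>i\<in>{1..N}. (cmod (c i))\<^sup>2)"
proof -
  have "ci (\<Sum>i\<in>{1..N}. cm (c i) (e i)) (\<Sum>i\<in>{1..N}. cm (c i) (e i)) = (\<Sum>i\<in>{1..N}. cnj (c i) * c i)"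
    unfolding ci_sum_left ci_cm_left by (intro sum.cong refl) (simp only: ci_e_sum)
  also have "\<dots> = complex_of_real (\<Sum>i\<in>{1..N}. (cmod (c i))\<^sup>2)"
    unfolding of_real_sum complex_norm_square by (simp only: mult.commute)
  finally show ?thesis unfolding ci_self by (simp only: of_real_eq_iff)
qed

lemma proj_diff: "proj N (x - y) = proj N x - proj N y"
proof -
  have "cm (a - b) x = cm a x - cm b x" for a b x
    by (metis cm_add_left add_diff_cancel_right' diff_add_cancel)
  then show ?thesis by (simp add: proj_def ci_diff_right sum_subtractf)
qed

lemma norm_proj_residual: "(norm (x - proj N x))\<^sup>2 = (norm x)\<^sup>2 - (\<Sum>j\<in>{1..N}. (cmod (ci (e j) x))\<^sup>2)"
proof -
  have "ci x (proj N x) = (\<Sum>j\<in>{1..N}. complex_of_real ((cmod (ci (e j) x))\<^sup>2))"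
    unfolding proj_def ci_sum_right ci_cm_right
    by (intro sum.cong refl) (simp only: complex_norm_square ci_commute[of x "e _"])
  then have "Re (ci x (proj N x)) = (\<Sum>j\<in>{1..N}. (cmod (ci (e j) x))\<^sup>2)" by simp
  moreover have "(norm (proj N x))\<^sup>2 = (\<Sum>j\<in>{1..N}. (cmod (ci (e j) x))\<^sup>2)"
    unfolding proj_def by (rule norm_sq_sum)
  ultimately show ?thesis using norm_sq_diff[of x "proj N x"] by simp
qed

lemma bessel: "(\<Sum>j\<in>{1..N}. (cmod (ci (e j) x))\<^sup>2) \<le> (norm x)\<^sup>2"
  using norm_proj_residual[of x N] by (smt (verit) zero_le_power2)

lemma norm_proj_le: "norm (proj N x) \<le> norm x"
proof (rule power2_le_imp_le)
  show "(norm (proj N x))\<^sup>2 \<le> (norm x)\<^sup>2"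
    unfolding proj_def norm_sq_sum by (rule bessel)
qed simp

lemma norm_residual_le: "norm (x - proj N x) \<le> norm x"
proof (rule power2_le_imp_le)
  show "(norm (x - proj N x))\<^sup>2 \<le> (norm x)\<^sup>2"
    unfolding norm_proj_residual by (simp add: sum_nonneg)
qed simp

lemma proj_fixed:
  assumes "finite F" "F \<subseteq> e ` {1..}"
  shows "\<exists>N0. \<forall>N\<ge>N0. proj N (\<Sum>v\<in>F. cm (c v) v) = (\<Sum>v\<in>F. cm (c v) v)"
  using assms
proof (induction F rule: finite_induct)
  case empty
  have "cm 0 x = 0" for x using cm_of_real[of 0 x] by simp
  then show ?case by (simp add: proj_def)
next
  case (insert v F)
  then obtain N0 where N0: "\<And>N. N \<ge> N0 \<Longrightarrow> proj N (\<Sum>v\<in>F. cm (c v) v) = (\<Sum>v\<in>F. cm (c v) v)" by auto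
  obtain j where j: "j \<ge> 1" "v = e j" using insert.prems by auto
  have v: "proj N (cm (c v) v) = cm (c v) v" if "N \<ge> j" for N
  proof -
    have z: "cm 0 x = 0" for x using cm_of_real[of 0 x] by simp
    have "proj N (cm (c v) v) = (\<Sum>i\<in>{1..N}. if i = j then cm (c v) (e j) else 0)"
      unfolding proj_def using j
      by (intro sum.cong refl) (auto simp: ci_cm_right onb z)
    then show ?thesis using that j by simp
  qed
  have "proj N (x + y) = proj N x + proj N y" for N x y
    by (simp add: proj_def ci_add_right cm_add_left sum.distrib)
  then have "proj N (\<Sum>v\<in>insert v F. cm (c v) v) = (\<Sum>v\<in>insert v F. cm (c v) v)" if "N \<ge> max N0 j" for N
    using insert.hyps that N0 v by simp
  then show ?case by blast
qed

text \<open>Approximate \<open>x\<close> by a finite combination \<open>y\<close> of basis vectors,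
  which the projections eventually fix; the error is then the residual of \<open>x - y\<close>, no
  longer than \<open>x - y\<close> itself.\<close>

lemma proj_tendsto: "(\<lambda>N. proj N x) \<longlonglongrightarrow> x"
proof (rule LIMSEQ_I)
  fix r :: real assume r: "r > 0"
  have "x \<in> closure (cspan cm (e ` {1..}))" unfolding onb_span by simp
  then obtain y where y: "y \<in> cspan cm (e ` {1..})" "dist y x < r"
    using r closure_approachable by blast
  then obtain F c where F: "finite F" "F \<subseteq> e ` {1..}" "y = (\<Sum>v\<in>F. cm (c v) v)"
    unfolding cspan_def by blast
  obtain N0 where N0: "\<And>N. N \<ge> N0 \<Longrightarrow> proj N y = y" using proj_fixed[OF F(1,2)] F(3) by blast
  have "norm (proj N x - x) < r" if "N \<ge> N0" for N
  proof -
    have "(x - y) - proj N (x - y) = x - proj N x" using N0[OF that] by (simp add: proj_diff)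
    then have "norm (x - proj N x) \<le> norm (x - y)" using norm_residual_le[of "x - y" N] by (simp only:)
    then show ?thesis using y(2) by (simp add: dist_norm norm_minus_commute)
  qed
  then show "\<exists>no. \<forall>n\<ge>no. norm (proj n x - x) < r" by blast
qed

lemma parseval: "(\<lambda>N. \<Sum>j\<in>{1..N}. (cmod (ci (e j) x))\<^sup>2) \<longlonglongrightarrow> (norm x)\<^sup>2"
proof -
  have "(\<lambda>N. (norm (proj N x))\<^sup>2) \<longlonglongrightarrow> (norm x)\<^sup>2" by (intro tendsto_intros proj_tendsto)
  then show ?thesis unfolding proj_def norm_sq_sum .
qed

text \<open>The adjoint at \<open>x\<close> is built from its coordinates. The partial sum
  \<open>a N\<close> represents the functional \<open>ci x (S (proj N z))\<close>, whence
  \<open>norm (a N) \<le> norm x * onorm S\<close>; the coordinates are thus square summable and the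
  partial sums converge.\<close>

lemma adjoint_exists:
  assumes S: "bounded_linear S" and Sc: "\<And>a x. S (cm a x) = cm a (S x)"
  shows "\<exists>a. \<forall>z. ci a z = ci x (S z)"
proof -
  interpret S: bounded_linear S by (rule S)
  define p where "p j = ci x (S (e j))" for j
  define a where "a N = (\<Sum>j\<in>{1..N}. cm (cnj (p j)) (e j))" for N
  have az: "ci (a N) z = ci x (S (proj N z))" for N z
  proof -
    have "S (proj N z) = (\<Sum>j\<in>{1..N}. cm (ci (e j) z) (S (e j)))"
      by (simp add: proj_def S.sum Sc)
    then show ?thesis by (simp add: a_def ci_sum_left ci_cm_left ci_sum_right ci_cm_right p_def mult.commute)
  qed
  define C where "C = norm x * onorm S"
  have C: "cmod (ci (a N) z) \<le> C * norm z" for N z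
  proof -
    have "cmod (ci (a N) z) \<le> norm x * norm (S (proj N z))" unfolding az by (rule cmod_ci_le)
    also have "norm (S (proj N z)) \<le> onorm S * norm (proj N z)" by (rule onorm[OF S])
    also have "\<dots> \<le> onorm S * norm z" by (intro mult_left_mono norm_proj_le onorm_pos_le S)
    finally show ?thesis unfolding C_def by (simp add: mult_left_mono mult.assoc)
  qed
  have n: "(norm (a N))\<^sup>2 = (\<Sum>j\<in>{1..N}. (cmod (p j))\<^sup>2)" for N
    unfolding a_def norm_sq_sum by simp
  have "norm (a N) \<le> C" for N
  proof (cases "a N = 0")
    case True
    have "0 \<le> onorm S" by (rule onorm_pos_le[OF S])
    then show ?thesis using True by (simp add: C_def)
  next
    case False
    \<comment> \<open>The functional is tested at \<open>a N\<close> itself.\<close>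
    have "(norm (a N))\<^sup>2 \<le> C * norm (a N)" using C[of N "a N"] unfolding ci_self by (simp add: norm_power)
    then show ?thesis using False by (simp add: power2_eq_square)
  qed
  then have "(\<Sum>j\<in>{1..N}. (cmod (p j))\<^sup>2) \<le> C\<^sup>2" for N
    unfolding n[symmetric] by (intro power_mono) auto
  then have "(\<Sum>j<N. (cmod (p (Suc j)))\<^sup>2) \<le> C\<^sup>2" for N
    by (simp add: sum.atLeast1_atMost_eq)
  then have sm: "summable (\<lambda>j. (cmod (p (Suc j)))\<^sup>2)"
    by (intro summableI_nonneg_bounded) auto
  have "Cauchy a"
  proof (rule CauchyI')
    fix r :: real assume r: "r > 0"
    obtain N0 where N0: "\<And>m n. m \<ge> N0 \<Longrightarrow> norm (sum (\<lambda>j. (cmod (p (Suc j)))\<^sup>2) {m..<n}) < r\<^sup>2"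
      using summable_Cauchy[of "\<lambda>j. (cmod (p (Suc j)))\<^sup>2"] sm r by (meson zero_less_power)
    have "dist (a m) (a n) < r" if "m \<ge> N0" "n > m" for m n
    proof -
      have "a n - a m = (\<Sum>j\<in>{1..n}. cm (if j \<le> m then 0 else cnj (p j)) (e j))"
      proof -
        have z: "cm 0 x = 0" for x using cm_of_real[of 0 x] by simp
        have "(\<Sum>j\<in>{1..n}. if j \<le> m then cm (cnj (p j)) (e j) else 0) = a m"
          unfolding a_def using that by (intro sum.mono_neutral_cong_right) auto
        moreover have "a n = (\<Sum>j\<in>{1..n}. (if j \<le> m then cm (cnj (p j)) (e j) else 0) + cm (if j \<le> m then 0 else cnj (p j)) (e j))"
          unfolding a_def by (intro sum.cong refl) (auto simp: z)
        ultimately show ?thesis by (simp add: sum.distrib)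
      qed
      then have "(norm (a n - a m))\<^sup>2 = (\<Sum>j\<in>{1..n}. (cmod (if j \<le> m then 0 else cnj (p j)))\<^sup>2)"
        by (simp only: norm_sq_sum)
      also have "\<dots> = (\<Sum>j\<in>{Suc m..n}. (cmod (p j))\<^sup>2)"
        by (intro sum.mono_neutral_cong_right) auto
      also have "\<dots> = (\<Sum>j\<in>{m..<n}. (cmod (p (Suc j)))\<^sup>2)"
        by (simp only: atLeastLessThanSuc_atLeastAtMost[symmetric] sum.shift_bounds_Suc_ivl)
      also have "\<dots> < r\<^sup>2" using N0[OF that(1), of n] by simp
      finally have "norm (a n - a m) < r" by (rule power2_less_imp_less) (use r in simp)
      then show ?thesis by (simp add: dist_norm norm_minus_commute)
    qed
    then show "\<exists>M. \<forall>m\<ge>M. \<forall>n>m. dist (a m) (a n) < r" by blast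
  qed
  then obtain l where l: "a \<longlonglongrightarrow> l" using Cauchy_convergent convergent_def by blast
  have "ci l z = ci x (S z)" for z
  proof (rule LIMSEQ_unique)
    have "(\<lambda>N. ci z (a N)) \<longlonglongrightarrow> ci z l"
      by (rule bounded_linear.tendsto[OF bounded_linear_ci l])
    then have "(\<lambda>N. cnj (ci z (a N))) \<longlonglongrightarrow> cnj (ci z l)" by (rule tendsto_cnj)
    then show "(\<lambda>N. ci (a N) z) \<longlonglongrightarrow> ci l z" by (simp only: ci_commute[symmetric])
    show "(\<lambda>N. ci (a N) z) \<longlonglongrightarrow> ci x (S z)"
      unfolding az by (intro bounded_linear.tendsto[OF bounded_linear_ci] S.tendsto proj_tendsto)
  qed
  then show ?thesis by blast
qed

end

section \<open>Circle means\<close>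

text \<open>Left endpoints of \<open>Suc n\<close> equal intervals, so that no denominator is zero;
  uniform continuity bounds the error on each interval.\<close>

lemma riemann_sum_tendsto:
  fixes h :: "real \<Rightarrow> complex"
  assumes h: "continuous_on {0..1} h"
  shows "(\<lambda>n. (\<Sum>q<Suc n. h (real q / real (Suc n))) / of_nat (Suc n)) \<longlonglongrightarrow> integral {0..1} h"
proof (rule LIMSEQ_I)
  fix r :: real assume r: "r > 0"
  have uc: "uniformly_continuous_on {0..1} h" by (rule compact_uniformly_continuous[OF h compact_Icc])
  obtain d where d: "d > 0" "\<And>x y. x \<in> {0..1} \<Longrightarrow> y \<in> {0..1} \<Longrightarrow> dist y x < d \<Longrightarrow> dist (h y) (h x) < r / 2"
    using uc r unfolding uniformly_continuous_on_def by (meson half_gt_zero)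
  obtain n0 where n0: "inverse (real (Suc n0)) < d" using reals_Archimedean[OF d(1)] by blast
  have "norm ((\<Sum>q<Suc n. h (real q / real (Suc n))) / of_nat (Suc n) - integral {0..1} h) < r" if n: "n \<ge> n0" for n
  proof -
    define m where "m = real (Suc n)"
    have m: "m > 0" by (simp add: m_def)
    have md: "1 / m < d"
    proof -
      have "1 / m \<le> inverse (real (Suc n0))" using n by (simp add: m_def field_simps)
      then show ?thesis using n0 by simp
    qed
    have int: "h integrable_on {a..b}" if "0 \<le> a" "b \<le> 1" for a b
      using that by (intro integrable_continuous_real continuous_on_subset[OF h]) auto
    have split: "integral {0..real k / m} h = (\<Sum>q<k. integral {real q / m..real (Suc q) / m} h)" if "k \<le> Suc n" for k
      using that
    proof (induction k)
      case (Suc k)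
      have "real (Suc k) / m \<le> 1" using Suc.prems m by (simp add: m_def)
      then have "integral {0..real k / m} h + integral {real k / m..real (Suc k) / m} h = integral {0..real (Suc k) / m} h"
        using m by (intro Henstock_Kurzweil_Integration.integral_combine int) (auto simp: field_simps)
      then show ?case using Suc by simp
    qed simp
    have "integral {0..1} h = (\<Sum>q<Suc n. integral {real q / m..real (Suc q) / m} h)"
      using split[of "Suc n"] m by (simp add: m_def)
    then have "(\<Sum>q<Suc n. h (real q / m)) / of_nat (Suc n) - integral {0..1} h
       = (\<Sum>q<Suc n. h (real q / m) / of_nat (Suc n) - integral {real q / m..real (Suc q) / m} h)"
      by (simp add: sum_subtractf sum_divide_distrib del: sum.lessThan_Suc of_nat_Suc)
    also have "norm \<dots> \<le> (\<Sum>q<Suc n. r / 2 / m)"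
    proof (rule order_trans[OF norm_sum sum_mono])
      fix q assume "q \<in> {..<Suc n}"
      then have q: "0 \<le> real q / m" "real (Suc q) / m \<le> 1" using m by (auto simp: m_def field_simps)
      have len: "real (Suc q) / m - real q / m = 1 / m" by (simp add: diff_divide_distrib[symmetric])
      have "h (real q / m) / of_nat (Suc n) = integral {real q / m..real (Suc q) / m} (\<lambda>_. h (real q / m))"
        using len m by (simp add: m_def scaleR_conv_of_real field_simps)
      then have "h (real q / m) / of_nat (Suc n) - integral {real q / m..real (Suc q) / m} h =
         integral {real q / m..real (Suc q) / m} (\<lambda>x. h (real q / m) - h x)"
        by (simp only: Henstock_Kurzweil_Integration.integral_diff[OF integrable_const_ivl int[OF q]])
      also have "norm \<dots> \<le> r / 2 * (real (Suc q) / m - real q / m)"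
      proof (rule integral_bound)
        show "real q / m \<le> real (Suc q) / m" using m by (simp add: divide_right_mono)
        show "continuous_on {real q / m..real (Suc q) / m} (\<lambda>x. h (real q / m) - h x)"
          using q by (intro continuous_intros continuous_on_subset[OF h]) auto
        fix t assume t: "t \<in> {real q / m..real (Suc q) / m}"
        have a: "real q / m \<in> {0..1}" "t \<in> {0..1}" using q t by auto
        have "dist t (real q / m) \<le> 1 / m" using t len by (auto simp: dist_real_def)
        then have "dist (h t) (h (real q / m)) < r / 2" using md by (intro d(2) a) auto
        then show "norm (h (real q / m) - h t) \<le> r / 2" by (simp add: dist_norm norm_minus_commute)
      qed
      finally show "norm (h (real q / m) / of_nat (Suc n) - integral {real q / m..real (Suc q) / m} h) \<le> r / 2 / m"
        unfolding len by simp
    qed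
    also have "\<dots> = r / 2" using m by (simp add: m_def field_simps)
    also have "\<dots> < r" using r by simp
    finally show ?thesis by (simp only: m_def)
  qed
  then show "\<exists>no. \<forall>n\<ge>no. norm ((\<Sum>q<Suc n. h (real q / real (Suc n))) / of_nat (Suc n) - integral {0..1} h) < r" by blast
qed

lemma circle_mean_contour:
  assumes r: "r > 0" and c: "continuous_on (sphere 0 r) \<psi>"
  shows "contour_integral (circlepath 0 r) (\<lambda>z. \<psi> z / z) = 2 * pi * \<i> * integral {0..1} (\<lambda>t. \<psi> (r * cis (2 * pi * t)))"
proof -
  have "contour_integral (circlepath 0 r) (\<lambda>z. \<psi> z / z) =
     integral {0..1} (\<lambda>t. \<psi> (circlepath 0 r t) / circlepath 0 r t * vector_derivative (circlepath 0 r) (at t))"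
    by (rule contour_integral_integral)
  also have "\<dots> = integral {0..1} (\<lambda>t. (2 * pi * \<i>) * \<psi> (r * cis (2 * pi * t)))"
  proof (intro Henstock_Kurzweil_Integration.integral_cong)
    fix t :: real
    define w where "w = exp (2 * complex_of_real pi * \<i> * t)"
    have w: "cis (2 * pi * t) = w" "w \<noteq> 0" by (simp_all add: w_def cis_conv_exp mult_ac)
    have c: "circlepath 0 r t = r * w" by (simp add: circlepath w_def)
    have v: "vector_derivative (circlepath 0 r) (at t) = 2 * pi * \<i> * r * w"
      by (simp add: vector_derivative_circlepath w_def)
    show "\<psi> (circlepath 0 r t) / circlepath 0 r t * vector_derivative (circlepath 0 r) (at t) = (2 * pi * \<i>) * \<psi> (r * cis (2 * pi * t))"
      unfolding c v w(1) using r w(2) by (simp add: field_simps)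
  qed
  finally show ?thesis by simp
qed

text \<open>The mean is, up to a constant, the contour integral of \<open>\<psi> z / z\<close>, and
  the two circles are homotopic along radii inside \<open>V\<close> without the origin.\<close>

lemma circle_mean_radius_indep:
  assumes V: "open V" and hol: "\<psi> holomorphic_on V" and s: "0 < s" "s \<le> 1"
    and sub: "\<And>z. s \<le> cmod z \<Longrightarrow> cmod z \<le> 1 \<Longrightarrow> z \<in> V"
  shows "integral {0..1} (\<lambda>t. \<psi> (cis (2 * pi * t))) = integral {0..1} (\<lambda>t. \<psi> (s * cis (2 * pi * t)))"
proof -
  have cont: "continuous_on V \<psi>" by (rule holomorphic_on_imp_continuous_on[OF hol])
  have hl: "homotopic_loops (V - {0}) (circlepath 0 1) (circlepath 0 s)"
  proof (rule homotopic_loops_linear)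
    fix t x :: real assume "t \<in> {0..1}"
    show "closed_segment (circlepath 0 1 t) (circlepath 0 s t) \<subseteq> V - {0}"
    proof
      fix w assume "w \<in> closed_segment (circlepath 0 1 t) (circlepath 0 s t)"
      then obtain u where u: "0 \<le> u" "u \<le> 1" "w = (1 - u) *\<^sub>R circlepath 0 1 t + u *\<^sub>R circlepath 0 s t"
        by (auto simp: closed_segment_def)
      have w: "w = complex_of_real ((1 - u) + u * s) * exp (2 * pi * \<i> * t)"
        unfolding u(3) by (simp add: circlepath scaleR_conv_of_real algebra_simps)
      have ge: "s \<le> (1 - u) + u * s"
      proof -
        have "(1 - u) * s \<le> (1 - u) * 1" using u s by (intro mult_left_mono) auto
        then show ?thesis by (simp add: algebra_simps)
      qed
      have le: "(1 - u) + u * s \<le> 1"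
        using mult_left_mono[OF s(2) u(1)] by simp
      have nw: "cmod w = (1 - u) + u * s"
        unfolding w norm_mult using ge s by (simp add: norm_exp_eq_Re abs_of_nonneg del: of_real_add of_real_mult of_real_diff)
      then show "w \<in> V - {0}" using sub[of w] ge le s by auto
    qed
  qed auto
  have holz: "(\<lambda>z. \<psi> z / z) holomorphic_on (V - {0})"
    by (intro holomorphic_on_divide holomorphic_on_subset[OF hol] holomorphic_on_ident) auto
  have eq: "contour_integral (circlepath 0 1) (\<lambda>z. \<psi> z / z) = contour_integral (circlepath 0 s) (\<lambda>z. \<psi> z / z)"
    using V by (intro Cauchy_theorem_homotopic_loops[OF hl _ holz]) auto
  have c1: "continuous_on (sphere 0 1) \<psi>" and c2: "continuous_on (sphere 0 s) \<psi>"
    using sub s by (auto intro!: continuous_on_subset[OF cont])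
  have "2 * pi * \<i> * integral {0..1} (\<lambda>t. \<psi> (1 * cis (2 * pi * t))) = 2 * pi * \<i> * integral {0..1} (\<lambda>t. \<psi> (s * cis (2 * pi * t)))"
    using circle_mean_contour[OF zero_less_one c1] circle_mean_contour[OF s(1) c2] eq by (simp only: of_real_1)
  then show ?thesis by simp
qed

text \<open>\<open>circ\<close> is an image measure on the whole plane, hence the measurability of
  \<open>F\<close> on all of it, whereas continuity is assumed on the circle alone.\<close>

lemma circ_integral:
  fixes F :: "complex \<Rightarrow> complex"
  assumes F: "F \<in> borel_measurable borel" and c: "continuous_on (sphere 0 1) F"
  shows "(LINT w|circ. F w) = integral {0..1} (\<lambda>t. F (cis (2 * pi * t)))"
proof -
  note [measurable] = F
  have cism[measurable]: "cis \<in> borel_measurable borel"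
    by (intro borel_measurable_continuous_onI continuous_intros)
  have cont: "continuous_on A (\<lambda>\<theta>. F (cis \<theta>))" for A :: "real set"
    by (intro continuous_on_compose2[OF c] continuous_intros) auto
  have u: "uniform_measure lborel {0..2*pi} = density lborel (\<lambda>x. ennreal (indicator {0..2*pi} x / (2 * pi)))"
    unfolding uniform_measure_def
    by (intro density_cong) (auto simp: indicator_def divide_ennreal[symmetric] divide_ennreal_def)
  have "(LINT w|circ. F w) = (LINT \<theta>|uniform_measure lborel {0..2*pi}. F (cis \<theta>))"
    unfolding circ_def by (rule integral_distr) (auto simp: uniform_measure_def)
  also have "\<dots> = (LINT \<theta>|lborel. (indicator {0..2*pi} \<theta> / (2 * pi)) *\<^sub>R F (cis \<theta>))"
    unfolding u by (intro integral_density) (auto intro!: divide_nonneg_nonneg)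
  also have "\<dots> = (LINT \<theta>|lborel. (1 / (2 * pi)) *\<^sub>R (indicator {0..2*pi} \<theta> *\<^sub>R F (cis \<theta>)))"
    by (intro Bochner_Integration.integral_cong refl) simp
  also have "\<dots> = (1 / (2 * pi)) *\<^sub>R (LINT \<theta>:{0..2*pi}|lborel. F (cis \<theta>))"
    unfolding set_lebesgue_integral_def by (rule integral_scaleR_right)
  also have "(LINT \<theta>:{0..2*pi}|lborel. F (cis \<theta>)) = integral {0..2*pi} (\<lambda>\<theta>. F (cis \<theta>))"
    by (intro set_borel_integral_eq_integral borel_integrable_atLeastAtMost' cont)
  also have "(1 / (2 * pi)) *\<^sub>R \<dots> = integral {0..1} (\<lambda>t. F (cis (2 * pi * t)))"
  proof -
    have "((\<lambda>\<theta>. F (cis \<theta>)) has_integral integral {0..2*pi} (\<lambda>\<theta>. F (cis \<theta>))) (cbox 0 (2*pi))"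
      by (simp add: integrable_integral integrable_continuous_real cont)
    from has_integral_affinity[OF this, of "2 * pi" 0]
    have "((\<lambda>t. F (cis (2 * pi * t))) has_integral (1 / (2 * pi)) *\<^sub>R integral {0..2*pi} (\<lambda>\<theta>. F (cis \<theta>))) ((\<lambda>x. x / (2 * pi)) ` {0..2*pi})"
      by simp
    moreover have "(\<lambda>x. x / (2 * pi)) ` {0..2*pi} = {0..1}"
    proof -
      have "(\<lambda>x. x / (2 * pi)) ` {0..2*pi} = (\<lambda>x. (1 / (2 * pi)) * x + 0) ` {0..2*pi}" by simp
      also have "\<dots> = {0..1}" by (subst image_affinity_atLeastAtMost) auto
      finally show ?thesis .
    qed
    ultimately show ?thesis by (simp add: integral_unique)
  qed
  finally show ?thesis .
qed

text \<open>The annulus is chosen symmetric under inversion because both \<open>s * w\<close> and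
  \<open>w / s\<close> will occur as arguments of \<open>E\<close>.\<close>

lemma annulus_subset:
  fixes U :: "complex set"
  assumes "open U" "sphere 0 1 \<subseteq> U"
  obtains s where "0 < s" "s < 1" "\<And>z. s \<le> cmod z \<Longrightarrow> cmod z \<le> 1 / s \<Longrightarrow> z \<in> U"
proof -
  obtain d where d: "d > 0" "(\<Union>x\<in>sphere 0 1. ball x d) \<subseteq> U"
    using compact_subset_open_imp_ball_epsilon_subset[OF compact_sphere assms] by blast
  \<comment> \<open>Then \<open>1 / s\<close> exceeds \<open>1\<close> by \<open>d / 2\<close> only,
    and \<open>(1 - d) * (1 + d / 2) < 1\<close> gives \<open>1 - d < s\<close>.\<close>
  define s where "s = 1 / (1 + d / 2)"
  have s: "0 < s" "s < 1" using d by (auto simp: s_def field_simps)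
  have "z \<in> U" if z: "s \<le> cmod z" "cmod z \<le> 1 / s" for z
  proof -
    have z0: "cmod z > 0" using s z by linarith
    have "1 - d < s"
    proof -
      have "(1 - d) * (1 + d / 2) < 1"
        using add_pos_pos[OF d(1) mult_pos_pos[OF d(1) d(1)]] by (simp add: algebra_simps)
      then show ?thesis using d(1) by (simp add: s_def field_simps)
    qed
    moreover have "1 / s = 1 + d / 2" using d(1) by (simp add: s_def)
    ultimately have b: "\<bar>cmod z - 1\<bar> < d" using z d(1) by auto
    have "cmod z *\<^sub>R sgn z = z" using z0 by (simp add: sgn_div_norm)
    then have "z - sgn z = (cmod z - 1) *\<^sub>R sgn z" by (simp add: scaleR_diff_left)
    then have "dist (sgn z) z = \<bar>cmod z - 1\<bar>"
      using z0 by (simp add: dist_norm norm_minus_commute[of "sgn z"] norm_sgn)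
    moreover have "sgn z \<in> sphere 0 1" using z0 by (simp add: norm_sgn)
    ultimately show ?thesis using d(2) b by (force simp: mem_ball)
  qed
  with s that show thesis by blast
qed

section \<open>Analytic vector fields near the circle\<close>

context complex_hilbert
begin

lemma analytic_vec_holomorphic:
  assumes E: "analytic_vec_on cm E U"
  shows "(\<lambda>w. ci x (E w)) holomorphic_on U"
proof (rule analytic_imp_holomorphic)
  show "(\<lambda>w. ci x (E w)) analytic_on U"
    unfolding analytic_on_def
  proof
    fix z assume "z \<in> U"
    then obtain r c where r: "r > 0" and s: "\<And>w. cmod (w - z) < r \<Longrightarrow> (\<lambda>n. cm ((w - z) ^ n) (c n)) sums E w"
      using E unfolding analytic_vec_on_def by blast
    have "(\<lambda>w. ci x (E w)) holomorphic_on ball z r"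
    proof (rule power_series_holomorphic)
      fix w assume "w \<in> ball z r"
      then have "(\<lambda>n. cm ((w - z) ^ n) (c n)) sums E w"
        by (intro s) (simp add: dist_norm norm_minus_commute)
      then have "(\<lambda>n. ci x (cm ((w - z) ^ n) (c n))) sums ci x (E w)"
        by (rule bounded_linear.sums[OF bounded_linear_ci])
      then show "(\<lambda>n. ci x (c n) * (w - z) ^ n) sums ci x (E w)"
        by (simp add: ci_cm_right mult.commute)
    qed
    then show "\<exists>\<epsilon>>0. (\<lambda>w. ci x (E w)) holomorphic_on ball z \<epsilon>" using r by blast
  qed
qed

text \<open>Convergence at distance \<open>r / 2\<close> bounds all terms there by some
  \<open>K\<close>. Within distance \<open>r / 4\<close> the terms are at most
  \<open>K * (1 / 2) ^ n\<close>, with sum \<open>2 * K\<close>.\<close>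

lemma analytic_vec_locally_bounded:
  assumes E: "analytic_vec_on cm E U" and z: "z \<in> U"
  shows "\<exists>r>0. \<exists>B. \<forall>w\<in>ball z r. norm (E w) \<le> B"
proof -
  obtain r c where r: "r > 0" and s: "\<And>w. cmod (w - z) < r \<Longrightarrow> (\<lambda>n. cm ((w - z) ^ n) (c n)) sums E w"
    using E z unfolding analytic_vec_on_def by blast
  have "summable (\<lambda>n. cm (complex_of_real (r / 2) ^ n) (c n))"
    using s[of "z + complex_of_real (r / 2)"] r by (auto simp: sums_iff norm_divide)
  then have "Bseq (\<lambda>n. cm (complex_of_real (r / 2) ^ n) (c n))"
    by (rule summable_imp_Bseq)
  then obtain K where K: "\<And>n. norm (cm (complex_of_real (r / 2) ^ n) (c n)) \<le> K"
    unfolding Bseq_def by blast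
  have K': "(r / 2) ^ n * norm (c n) \<le> K" for n
    using K[of n] r by (simp add: norm_cm norm_power norm_divide)
  have "norm (E w) \<le> K * 2" if w: "w \<in> ball z (r / 4)" for w
  proof -
    have wz: "cmod (w - z) \<le> r / 4" using w by (simp add: dist_norm norm_minus_commute)
    have tm: "norm (cm ((w - z) ^ n) (c n)) \<le> K * (1 / 2) ^ n" for n
    proof -
      have "norm (cm ((w - z) ^ n) (c n)) = cmod (w - z) ^ n * norm (c n)" by (simp add: norm_cm norm_power)
      also have "\<dots> \<le> (r / 4) ^ n * norm (c n)" by (intro mult_right_mono power_mono wz) auto
      also have "(r / 4) ^ n = (r / 2) ^ n * (1 / 2) ^ n" by (simp add: power_mult_distrib[symmetric])
      also have "(r / 2) ^ n * (1 / 2) ^ n * norm (c n) = ((r / 2) ^ n * norm (c n)) * (1 / 2) ^ n" by simp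
      also have "\<dots> \<le> K * (1 / 2) ^ n" by (intro mult_right_mono K') simp
      finally show ?thesis .
    qed
    have g: "(\<lambda>n. K * (1 / 2) ^ n) sums (K * 2)"
      using geometric_sums[of "1/2::real"] by (intro sums_mult) simp
    have "(\<lambda>n. cm ((w - z) ^ n) (c n)) sums E w" using wz r by (intro s) simp
    then have "norm (E w) = norm (\<Sum>n. cm ((w - z) ^ n) (c n))" by (simp add: sums_iff)
    also have "\<dots> \<le> (\<Sum>n. K * (1 / 2) ^ n)"
      using g tm by (intro norm_suminf_le) (auto simp: sums_iff)
    finally show ?thesis using g by (simp add: sums_iff)
  qed
  then show ?thesis using r by (intro exI[of _ "r / 4"] conjI exI[of _ "K * 2"] ballI) simp_all
qed

text \<open>A bound for the norm of \<open>E w\<close>, and not just for each function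
  \<open>ci x (E w)\<close>, is what Bessel's inequality turns into an estimate over all coordinates
  at once.\<close>

lemma analytic_vec_bounded:
  assumes E: "analytic_vec_on cm E U" and K: "compact K" "K \<subseteq> U"
  shows "\<exists>B. \<forall>w\<in>K. norm (E w) \<le> B"
proof -
  have "\<forall>z\<in>K. \<exists>r B. r > 0 \<and> (\<forall>w\<in>ball z r. norm (E w) \<le> B)"
    using analytic_vec_locally_bounded[OF E] K by blast
  then obtain r B where rB: "\<And>z. z \<in> K \<Longrightarrow> r z > 0 \<and> (\<forall>w\<in>ball z (r z). norm (E w) \<le> B z)" by metis
  obtain C where C: "C \<subseteq> K" "finite C" "K \<subseteq> (\<Union>z\<in>C. ball z (r z))"
  proof (rule compactE_image[OF K(1), of K "\<lambda>z. ball z (r z)"])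
    show "K \<subseteq> (\<Union>z\<in>K. ball z (r z))" using rB by force
  qed auto
  have "norm (E w) \<le> (\<Sum>z\<in>C. \<bar>B z\<bar>)" if "w \<in> K" for w
  proof -
    from subsetD[OF C(3) that] obtain z where z: "z \<in> C" "w \<in> ball z (r z)" by (rule UN_E)
    then have "norm (E w) \<le> \<bar>B z\<bar>" using rB[of z] C by fastforce
    also have "\<dots> \<le> (\<Sum>z\<in>C. \<bar>B z\<bar>)" using z C by (intro member_le_sum) auto
    finally show ?thesis .
  qed
  then show ?thesis by blast
qed

lemma circle_form_shift:
  assumes U: "open U" and E: "analytic_vec_on cm E U" and s: "0 < s" "s < 1"
    and sub: "\<And>z. s \<le> cmod z \<Longrightarrow> cmod z \<le> 1 / s \<Longrightarrow> z \<in> U"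
  shows "integral {0..1} (\<lambda>t. cis (2 * pi * t) ^ n * ci x (E (cis (2 * pi * t))) * cnj (ci y (E (cis (2 * pi * t))))) =
    integral {0..1} (\<lambda>t. (s * cis (2 * pi * t)) ^ n * ci x (E (s * cis (2 * pi * t))) * cnj (ci y (E (cis (2 * pi * t) / s))))"
proof -
  \<comment> \<open>Conjugating before and after a holomorphic function keeps \<open>\<psi>\<close>
    holomorphic. At \<open>z = s * w\<close> with \<open>|w| = 1\<close> the reflected point
    \<open>inverse (cnj z)\<close> is \<open>w / s\<close>, and for \<open>s = 1\<close> it is
    \<open>w\<close> again.\<close>
  define \<psi> where "\<psi> z = z ^ n * ci x (E z) * (cnj \<circ> (\<lambda>w. ci y (E (inverse w))) \<circ> cnj) z" for z
  define V where "V = {z \<in> U. z \<noteq> 0 \<and> inverse (cnj z) \<in> U}"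
  have V: "open V"
  proof -
    have "open ({z. z \<noteq> 0} \<inter> (\<lambda>z. inverse (cnj z)) -` U)"
      by (intro continuous_open_preimage U continuous_intros open_Collect_neq) auto
    then have "open (U \<inter> ({z. z \<noteq> 0} \<inter> (\<lambda>z. inverse (cnj z)) -` U))" using U by blast
    moreover have "U \<inter> ({z. z \<noteq> 0} \<inter> (\<lambda>z. inverse (cnj z)) -` U) = V" by (auto simp: V_def)
    ultimately show ?thesis by simp
  qed
  have h1: "(\<lambda>z. ci x (E z)) holomorphic_on V"
    by (rule holomorphic_on_subset[OF analytic_vec_holomorphic[OF E]]) (auto simp: V_def)
  have h2: "(cnj \<circ> (\<lambda>w. ci y (E (inverse w))) \<circ> cnj) holomorphic_on V"
  proof (rule holomorphic_on_compose_cnj_cnj[OF _ V])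
    have "((\<lambda>z. ci y (E z)) \<circ> inverse) holomorphic_on (cnj ` V)"
    proof (rule holomorphic_on_compose)
      show "inverse holomorphic_on cnj ` V"
        by (intro holomorphic_intros) (auto simp: V_def)
      show "(\<lambda>z. ci y (E z)) holomorphic_on inverse ` cnj ` V"
        by (rule holomorphic_on_subset[OF analytic_vec_holomorphic[OF E]]) (auto simp: V_def)
    qed
    then show "(\<lambda>w. ci y (E (inverse w))) holomorphic_on cnj ` V" by (simp add: o_def)
  qed
  have "\<psi> holomorphic_on V"
    unfolding \<psi>_def[abs_def] by (intro holomorphic_intros h1 h2)
  then have "integral {0..1} (\<lambda>t. \<psi> (cis (2 * pi * t))) = integral {0..1} (\<lambda>t. \<psi> (s * cis (2 * pi * t)))"
  proof (rule circle_mean_radius_indep[OF V _ s(1) less_imp_le[OF s(2)]])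
    fix z assume z: "s \<le> cmod z" "cmod z \<le> 1"
    have "1 \<le> 1 / s" using s by simp
    then have "z \<in> U" using z by (intro sub) auto
    moreover have "z \<noteq> 0" using z s by auto
    moreover have "inverse (cnj z) \<in> U"
    proof (rule sub)
      have "0 < cmod z" using z(1) s(1) by linarith
      then have "1 \<le> 1 / cmod z" using z(2) by (simp add: le_divide_eq)
      then show "s \<le> cmod (inverse (cnj z))" using s by (simp add: norm_inverse divide_inverse)
      show "cmod (inverse (cnj z)) \<le> 1 / s"
        using z s by (simp add: norm_inverse divide_inverse le_imp_inverse_le)
    qed
    ultimately show "z \<in> V" by (simp add: V_def)
  qed
  moreover have "\<psi> (cis (2 * pi * t)) = cis (2 * pi * t) ^ n * ci x (E (cis (2 * pi * t))) * cnj (ci y (E (cis (2 * pi * t))))" for t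
    by (simp add: \<psi>_def cis_cnj cis_inverse)
  moreover have "\<psi> (s * cis (2 * pi * t)) = (s * cis (2 * pi * t)) ^ n * ci x (E (s * cis (2 * pi * t))) * cnj (ci y (E (cis (2 * pi * t) / s)))" for t
    by (simp add: \<psi>_def cis_cnj cis_inverse divide_inverse mult.commute)
  ultimately show ?thesis by simp
qed

text \<open>The Riemann sums on the shifted circle are the required decompositions. Hypothesis
  \<open>v\<close> makes the bound independent of \<open>A\<close>; its factor \<open>2\<close>
  stems from the real coordinates, in which every basis vector appears twice.\<close>

lemma rank_one_approx_circle_form:
  assumes U: "open U" and E: "analytic_vec_on cm E U" and s: "0 < s" "s < 1"
    and sub: "\<And>z. s \<le> cmod z \<Longrightarrow> cmod z \<le> 1 / s \<Longrightarrow> z \<in> U"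
    and B: "\<And>z. s \<le> cmod z \<Longrightarrow> cmod z \<le> 1 / s \<Longrightarrow> norm (E z) \<le> B"
    and v: "\<And>y. (\<Sum>i\<in>A. (cmod (ci (v i) y))\<^sup>2) \<le> 2 * (norm y)\<^sup>2"
  shows "rank_one_approx A (2 * B\<^sup>2 * s ^ n)
    (\<lambda>i j. Re (integral {0..1} (\<lambda>t. cis (2 * pi * t) ^ n * ci (v i) (E (cis (2 * pi * t))) * cnj (ci (v j) (E (cis (2 * pi * t)))))) / 2)"
proof -
  define \<omega> where "\<omega> t = cis (2 * pi * t)" for t
  define f where "f i t = \<omega> t ^ n * ci (v i) (E (s * \<omega> t))" for i t
  define g where "g j t = ci (v j) (E (\<omega> t / s))" for j t
  have norm1: "cmod (\<omega> t) = 1" for t by (simp add: \<omega>_def)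
  have s1: "s \<le> 1 / s"
  proof -
    have "s * s \<le> 1" using s by (simp add: mult_le_one)
    then show ?thesis using s by (simp add: field_simps)
  qed
  have n1: "cmod (s * \<omega> t) = s" "cmod (\<omega> t / s) = 1 / s" for t
    using s by (simp_all add: norm_mult norm_divide norm1)
  have Eb: "norm (E (s * \<omega> t)) \<le> B" "norm (E (\<omega> t / s)) \<le> B" for t
    by (rule B; simp only: n1 s1 order_refl)+
  have B0: "0 \<le> B" using Eb(1)[of 0] norm_ge_zero order_trans by blast
  have in_U: "s * \<omega> t \<in> U" "\<omega> t / s \<in> U" for t
    by (rule sub; simp only: n1 s1 order_refl)+
  have cont_ci: "continuous_on U (\<lambda>w. ci x (E w))" for x
    by (rule holomorphic_on_imp_continuous_on[OF analytic_vec_holomorphic[OF E]])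
  have cont: "continuous_on {0..1} (\<lambda>t. s ^ n * (f i t * cnj (g j t)))" for i j
  proof -
    have "continuous_on {0..1} (\<lambda>t. ci (v i) (E (s * \<omega> t)))" "continuous_on {0..1} (\<lambda>t. ci (v j) (E (\<omega> t / s)))"
      using s in_U by (auto intro!: continuous_on_compose2[OF cont_ci] continuous_intros simp: \<omega>_def)
    then show ?thesis unfolding f_def g_def
      by (intro continuous_intros) (auto simp: \<omega>_def intro!: continuous_intros)
  qed
  define C where "C m i j = Re ((\<Sum>q<Suc m. s ^ n * (f i (real q / real (Suc m)) * cnj (g j (real q / real (Suc m))))) / of_nat (Suc m)) / 2" for m i j
  define c where "c i j = Re (integral {0..1} (\<lambda>t. \<omega> t ^ n * ci (v i) (E (\<omega> t)) * cnj (ci (v j) (E (\<omega> t))))) / 2" for i j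
  have ceq: "c i j = Re (integral {0..1} (\<lambda>t. s ^ n * (f i t * cnj (g j t)))) / 2" for i j
  proof -
    have "(\<lambda>t. (s * cis (2 * pi * t)) ^ n * ci (v i) (E (s * cis (2 * pi * t))) * cnj (ci (v j) (E (cis (2 * pi * t) / s)))) =
        (\<lambda>t. s ^ n * (f i t * cnj (g j t)))"
      by (auto simp: f_def g_def \<omega>_def power_mult_distrib)
    moreover have "integral {0..1} (\<lambda>t. \<omega> t ^ n * ci (v i) (E (\<omega> t)) * cnj (ci (v j) (E (\<omega> t)))) =
       integral {0..1} (\<lambda>t. (s * cis (2 * pi * t)) ^ n * ci (v i) (E (s * cis (2 * pi * t))) * cnj (ci (v j) (E (cis (2 * pi * t) / s))))"
      unfolding \<omega>_def by (rule circle_form_shift[OF U E s]) (rule sub)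
    ultimately show ?thesis unfolding c_def by (simp only:)
  qed
  have lim: "(\<lambda>m. C m i j) \<longlonglongrightarrow> c i j" for i j
    unfolding C_def ceq by (intro tendsto_divide tendsto_Re riemann_sum_tendsto cont tendsto_const) simp
  have "\<exists>(Q :: (nat \<times> bool) set) u w. finite Q \<and> (\<forall>i\<in>A. \<forall>j\<in>A. C m i j = (\<Sum>q\<in>Q. u q i * w q j)) \<and>
       (\<Sum>q\<in>Q. vnorm A (u q) * vnorm A (w q)) \<le> 2 * B\<^sup>2 * s ^ n" for m
  proof -
    define M where "M = real (Suc m)"
    have M: "M > 0" by (simp add: M_def)
    define \<tau> where "\<tau> q = real q / M" for q :: nat
    \<comment> \<open>The factor \<open>s ^ n\<close> comes from the shifted circle,
      \<open>1 / M\<close> from the mean over the nodes, and \<open>1 / 2\<close> from the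
      covariance of real parts.\<close>
    define k where "k = s ^ n / (2 * M)"
    have k0: "k \<ge> 0" using s M by (simp add: k_def)
    \<comment> \<open>\<open>Re (f * cnj g) = Re f * Re g + Im f * Im g\<close>, so each node
      contributes two kernels of rank one, told apart by the boolean.\<close>
    define u where "u = (\<lambda>(q, b) i. k * (if b then Re (f i (\<tau> q)) else Im (f i (\<tau> q))))"
    define w where "w = (\<lambda>(q, b) j. if b then Re (g j (\<tau> q)) else Im (g j (\<tau> q)))"
    define Q where "Q = {..<Suc m} \<times> (UNIV :: bool set)"
    have sq: "(\<Sum>i\<in>A. (if b then Re (h i) else Im (h i))\<^sup>2) \<le> 2 * B\<^sup>2"
      if h: "\<And>i. cmod (h i) = cmod (ci (v i) y)" and y: "norm y \<le> B" for h :: "_ \<Rightarrow> complex" and y b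
    proof -
      have "(\<Sum>i\<in>A. (if b then Re (h i) else Im (h i))\<^sup>2) \<le> (\<Sum>i\<in>A. (cmod (ci (v i) y))\<^sup>2)"
        unfolding h[symmetric] by (intro sum_mono) (simp add: cmod_power2)
      also have "\<dots> \<le> 2 * (norm y)\<^sup>2" by (rule v)
      also have "\<dots> \<le> 2 * B\<^sup>2" using y by (intro mult_left_mono power_mono) auto
      finally show ?thesis .
    qed
    have vu: "vnorm A (u (q, b)) \<le> k * (sqrt 2 * B)" for q b
    proof -
      have "vnorm A (u (q, b)) = k * sqrt (\<Sum>i\<in>A. (if b then Re (f i (\<tau> q)) else Im (f i (\<tau> q)))\<^sup>2)"
        using k0 by (simp add: vnorm_def u_def power_mult_distrib sum_distrib_left[symmetric] real_sqrt_mult)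
      also have "\<dots> \<le> k * sqrt (2 * B\<^sup>2)"
        using k0 Eb(1) by (intro mult_left_mono real_sqrt_le_mono sq[of _ "E (s * \<omega> (\<tau> q))"])
          (auto simp: f_def norm_mult norm_power norm1)
      finally show ?thesis using B0 by (simp add: real_sqrt_mult)
    qed
    have vw: "vnorm A (w (q, b)) \<le> sqrt 2 * B" for q b
    proof -
      have "vnorm A (w (q, b)) \<le> sqrt (2 * B\<^sup>2)"
        using Eb(2) unfolding vnorm_def w_def
        by (auto intro!: real_sqrt_le_mono sq[of _ "E (\<omega> (\<tau> q) / s)", simplified] simp: g_def split del: if_split)
      then show ?thesis using B0 by (simp add: real_sqrt_mult)
    qed
    have "C m i j = (\<Sum>q\<in>Q. u q i * w q j)" for i j
    proof -
      have "C m i j = (\<Sum>q<Suc m. k * Re (f i (\<tau> q) * cnj (g j (\<tau> q))))"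
      proof -
        have "Re ((\<Sum>q<Suc m. s ^ n * (f i (\<tau> q) * cnj (g j (\<tau> q)))) / complex_of_real M) =
            (\<Sum>q<Suc m. s ^ n * Re (f i (\<tau> q) * cnj (g j (\<tau> q)))) / M"
        proof -
          have "Re (complex_of_real (s ^ n) * x) = s ^ n * Re x" for x by (simp del: of_real_power)
          then show ?thesis unfolding Re_divide_of_real Re_sum of_real_power[symmetric] by (simp only:)
        qed
        then show ?thesis
          by (simp add: C_def \<tau>_def M_def k_def sum_divide_distrib sum_distrib_left mult.commute[of "real (Suc m)" 2] del: sum.lessThan_Suc of_nat_Suc times_complex.sel)
      qed
      also have "\<dots> = (\<Sum>q<Suc m. \<Sum>b\<in>UNIV. u (q, b) i * w (q, b) j)"
        by (intro sum.cong refl) (simp add: u_def w_def UNIV_bool algebra_simps)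
      also have "\<dots> = (\<Sum>q\<in>Q. u q i * w q j)"
        by (simp add: Q_def sum.cartesian_product case_prod_unfold del: sum.lessThan_Suc)
      finally show ?thesis .
    qed
    moreover have "(\<Sum>q\<in>Q. vnorm A (u q) * vnorm A (w q)) \<le> (\<Sum>q\<in>Q. (k * (sqrt 2 * B)) * (sqrt 2 * B))"
    proof (rule sum_mono)
      fix q :: "nat \<times> bool"
      obtain q' b where "q = (q', b)" by (cases q)
      then show "vnorm A (u q) * vnorm A (w q) \<le> (k * (sqrt 2 * B)) * (sqrt 2 * B)"
        using vu[of q' b] vw[of q' b] k0 B0 by (auto intro!: mult_mono vnorm_nonneg)
    qed
    \<comment> \<open>The number \<open>2 * M\<close> of terms cancels the denominator of
      \<open>k\<close>, so the bound is the same for all Riemann sums.\<close>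
    moreover have "(\<Sum>q\<in>Q. (k * (sqrt 2 * B)) * (sqrt 2 * B)) = 2 * B\<^sup>2 * s ^ n"
    proof -
      have "card Q = 2 * Suc m" by (simp add: Q_def card_cartesian_product)
      then have "(\<Sum>q\<in>Q. (k * (sqrt 2 * B)) * (sqrt 2 * B)) = 2 * M * (k * (2 * B\<^sup>2))"
        by (simp add: M_def power2_eq_square algebra_simps)
      then show ?thesis using M by (simp add: k_def)
    qed
    ultimately show ?thesis
      by (intro exI[of _ Q] exI[of _ u] exI[of _ w]) (simp add: Q_def)
  qed
  then show ?thesis
    unfolding rank_one_approx_def using lim unfolding c_def \<omega>_def by blast
qed

end

section \<open>Gaussian measures\<close>

text \<open>Convergence in L2 entails convergence of the characteristic functions, since
  \<open>cis\<close> is Lipschitz, and of the variances; both sides of the Gaussian identity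
  therefore pass to the limit.\<close>

lemma (in prob_space) l2cl_gaussian_family:
  assumes S: "S \<subseteq> L2R M" and add: "\<And>X Y. X \<in> S \<Longrightarrow> Y \<in> S \<Longrightarrow> (\<lambda>z. X z + Y z) \<in> S"
    and scale: "\<And>a Y. Y \<in> S \<Longrightarrow> (\<lambda>z. a * Y z) \<in> S"
    and char: "\<And>Y. Y \<in> S \<Longrightarrow> (LINT z|M. cis (Y z)) = complex_of_real (exp (- (l2norm M Y)\<^sup>2 / 2))"
  shows "gaussian_family M (l2cl M S)"
proof (unfold_locales)
  show "Y \<in> L2R M" if "Y \<in> l2cl M S" for Y using that by (simp add: l2cl_def)
next
  fix X Y assume "X \<in> l2cl M S" "Y \<in> l2cl M S"
  then obtain s t where X: "X \<in> L2R M" and s: "\<And>n. s n \<in> S" "(\<lambda>n. l2norm M (\<lambda>z. X z - s n z)) \<longlonglongrightarrow> 0"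
    and Y: "Y \<in> L2R M" and t: "\<And>n. t n \<in> S" "(\<lambda>n. l2norm M (\<lambda>z. Y z - t n z)) \<longlonglongrightarrow> 0"
    unfolding l2cl_def by blast
  have "(\<lambda>n. l2norm M (\<lambda>z. X z + Y z - (s n z + t n z))) \<longlonglongrightarrow> 0"
  proof (rule Lim_null_comparison[OF always_eventually])
    show "\<forall>n. norm (l2norm M (\<lambda>z. X z + Y z - (s n z + t n z))) \<le> l2norm M (\<lambda>z. X z - s n z) + l2norm M (\<lambda>z. Y z - t n z)"
    proof
      fix n
      have "(\<lambda>z. X z + Y z - (s n z + t n z)) = (\<lambda>z. (X z - s n z) + (Y z - t n z))" by auto
      then show "norm (l2norm M (\<lambda>z. X z + Y z - (s n z + t n z))) \<le> l2norm M (\<lambda>z. X z - s n z) + l2norm M (\<lambda>z. Y z - t n z)"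
        using l2norm_triangle[OF L2R_diff[OF X, of "s n"] L2R_diff[OF Y, of "t n"]] s(1)[of n] t(1)[of n] S
        by (auto simp: l2norm_nonneg)
    qed
    show "(\<lambda>n. l2norm M (\<lambda>z. X z - s n z) + l2norm M (\<lambda>z. Y z - t n z)) \<longlonglongrightarrow> 0"
      using tendsto_add[OF s(2) t(2)] by simp
  qed
  then show "(\<lambda>z. X z + Y z) \<in> l2cl M S"
    unfolding l2cl_def
    by (intro CollectI conjI L2R_add X Y exI[of _ "\<lambda>n z. s n z + t n z"] allI add s(1) t(1))
next
  fix a Y assume "Y \<in> l2cl M S"
  then obtain t where Y: "Y \<in> L2R M" and t: "\<And>n. t n \<in> S" "(\<lambda>n. l2norm M (\<lambda>z. Y z - t n z)) \<longlonglongrightarrow> 0"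
    unfolding l2cl_def by blast
  have "l2norm M (\<lambda>z. a * Y z - a * t n z) = \<bar>a\<bar> * l2norm M (\<lambda>z. Y z - t n z)" for n
    using l2norm_scale[of M a "\<lambda>z. Y z - t n z"] by (simp add: right_diff_distrib)
  then have "(\<lambda>n. l2norm M (\<lambda>z. a * Y z - a * t n z)) \<longlonglongrightarrow> 0"
    using tendsto_mult_right_zero[OF t(2), of "\<bar>a\<bar>"] by simp
  then show "(\<lambda>z. a * Y z) \<in> l2cl M S"
    unfolding l2cl_def
    by (intro CollectI conjI L2R_scale Y exI[of _ "\<lambda>n z. a * t n z"] allI scale t(1))
next
  fix Y assume "Y \<in> l2cl M S"
  then obtain t where Y: "Y \<in> L2R M" and t: "\<And>n. t n \<in> S" "(\<lambda>n. l2norm M (\<lambda>z. Y z - t n z)) \<longlonglongrightarrow> 0"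
    unfolding l2cl_def by blast
  have tL: "t n \<in> L2R M" for n using t S by blast
  note [measurable] = L2R_D(1)[OF Y] L2R_D(1)[OF tL]
  have ic: "integrable M (\<lambda>z. cis (X z))" if [measurable]: "X \<in> borel_measurable M" for X
    by (rule integrable_const_bound[of _ 1]) (auto simp: cis_conv_exp)
  have "(\<lambda>n. (LINT z|M. cis (t n z)) - (LINT z|M. cis (Y z))) \<longlonglongrightarrow> 0"
  proof (rule Lim_null_comparison[OF always_eventually t(2)], rule allI)
    fix n
    have "norm ((LINT z|M. cis (t n z)) - (LINT z|M. cis (Y z))) = norm (LINT z|M. cis (t n z) - cis (Y z))"
      using ic by simp
    also have "\<dots> \<le> (LINT z|M. \<bar>Y z - t n z\<bar>)"
    proof (rule integral_norm_le)
      show "integrable M (\<lambda>z. cis (t n z) - cis (Y z))" using ic by simp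
      show "integrable M (\<lambda>z. \<bar>Y z - t n z\<bar>)" using L2R_integrable[OF L2R_diff[OF Y tL]] by simp
      have "cmod (cis a - cis b) \<le> \<bar>b - a\<bar>" for a b
      proof -
        have "cis a - cis b = cis b * (cis (a - b) - 1)" by (simp add: right_diff_distrib cis_mult)
        moreover have "cmod (cis (a - b) - 1) \<le> \<bar>a - b\<bar>"
          using iexp_approx1[of "a - b" 0] by (simp add: cis_conv_exp)
        ultimately show ?thesis by (simp add: norm_mult abs_minus_commute)
      qed
      then show "norm (cis (t n z) - cis (Y z)) \<le> \<bar>Y z - t n z\<bar>" for z .
    qed
    also have "\<dots> \<le> l2norm M (\<lambda>z. Y z - t n z)"
      by (rule integral_abs_le_l2norm[OF L2R_diff[OF Y tL]])
    finally show "norm ((LINT z|M. cis (t n z)) - (LINT z|M. cis (Y z))) \<le> l2norm M (\<lambda>z. Y z - t n z)" .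
  qed
  then have lim1: "(\<lambda>n. LINT z|M. cis (t n z)) \<longlonglongrightarrow> (LINT z|M. cis (Y z))" by (rule LIM_zero_cancel)
  have "(\<lambda>n. (l2norm M (t n))\<^sup>2) \<longlonglongrightarrow> (l2norm M Y)\<^sup>2"
    unfolding l2norm_sq by (rule l2_tendsto_integral_mult[OF Y Y tL tL t(2) t(2)])
  then have "(\<lambda>n. complex_of_real (exp (- (l2norm M (t n))\<^sup>2 / 2))) \<longlonglongrightarrow> complex_of_real (exp (- (l2norm M Y)\<^sup>2 / 2))"
    by (intro tendsto_of_real tendsto_exp tendsto_divide tendsto_minus tendsto_const) auto
  then have lim2: "(\<lambda>n. LINT z|M. cis (t n z)) \<longlonglongrightarrow> complex_of_real (exp (- (l2norm M Y)\<^sup>2 / 2))"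
    by (simp only: char[OF t(1)])
  show "(LINT z|M. cis (Y z)) = complex_of_real (exp (- (l2norm M Y)\<^sup>2 / 2))"
    by (rule LIMSEQ_unique[OF lim1 lim2])
qed

text \<open>Second order expansion of the characteristic function at \<open>0\<close>, along \<open>t = 1 / n\<close>.\<close>

lemma (in prob_space) gaussian_char_variance:
  assumes Y: "Y \<in> L2R M" and char: "\<And>t. (LINT z|M. cis (t * Y z)) = complex_of_real (exp (- t\<^sup>2 * c))"
  shows "(LINT z|M. (Y z)\<^sup>2) = 2 * c"
proof -
  note [measurable] = L2R_D(1)[OF Y]
  define D where "D n z = (real (Suc n))\<^sup>2 * (1 - cos (Y z / real (Suc n)))" for n z
  have ic: "integrable M (\<lambda>z. cis (t * Y z))" for t
    by (rule integrable_const_bound[of _ 1]) (auto simp: cis_conv_exp)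
  have icos: "integrable M (\<lambda>z. cos (t * Y z))" for t
    by (rule integrable_const_bound[of _ 1]) auto
  have cosint: "(LINT z|M. cos (t * Y z)) = exp (- t\<^sup>2 * c)" for t
  proof -
    have "(LINT z|M. cos (t * Y z)) = (LINT z|M. Re (cis (t * Y z)))" by simp
    also have "\<dots> = Re (LINT z|M. cis (t * Y z))" by (rule integral_Re[OF ic])
    finally show ?thesis by (simp only: char Re_complex_of_real)
  qed
  have Dint: "(LINT z|M. D n z) = (real (Suc n))\<^sup>2 * (1 - exp (- (1 / real (Suc n))\<^sup>2 * c))" for n
    using cosint[of "1 / real (Suc n)"] icos[of "1 / real (Suc n)"] by (simp add: D_def prob_space)
  have "(\<lambda>n. LINT z|M. D n z) \<longlonglongrightarrow> (LINT z|M. (Y z)\<^sup>2 / 2)"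
  proof (rule integral_dominated_convergence)
    show "integrable M (\<lambda>z. (Y z)\<^sup>2 / 2)" using L2R_D(2)[OF Y] by simp
    show "AE z in M. (\<lambda>n. D n z) \<longlonglongrightarrow> (Y z)\<^sup>2 / 2"
    proof (rule AE_I2)
      fix z
      define y where "y = Y z"
      have "((\<lambda>n. (real (Suc n))\<^sup>2 * (1 - cos (y / real (Suc n)))) \<longlongrightarrow> y\<^sup>2 / 2) at_top"
        by (cases "y = 0") (simp, real_asymp simp: power2_eq_square)
      then show "(\<lambda>n. D n z) \<longlonglongrightarrow> (Y z)\<^sup>2 / 2" by (simp add: D_def y_def)
    qed
    show "AE z in M. norm (D n z) \<le> (Y z)\<^sup>2 / 2" for n
    proof (rule AE_I2)
      fix z
      have c1: "1 - cos x \<le> x\<^sup>2 / 2" for x :: real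
      proof -
        have "cos x = 1 - 2 * (sin (x / 2))\<^sup>2" using cos_double_sin[of "x / 2"] by simp
        moreover have "(sin (x / 2))\<^sup>2 \<le> (x / 2)\<^sup>2"
          using abs_sin_x_le_abs_x[of "x / 2"] unfolding abs_le_square_iff .
        ultimately show ?thesis by (simp add: power_divide)
      qed
      have "D n z \<le> (real (Suc n))\<^sup>2 * ((Y z / real (Suc n))\<^sup>2 / 2)"
        unfolding D_def by (intro mult_left_mono c1) simp
      also have "\<dots> = (Y z)\<^sup>2 / 2" by (simp add: power_divide)
      finally have "D n z \<le> (Y z)\<^sup>2 / 2" .
      moreover have "0 \<le> D n z" by (simp add: D_def)
      ultimately show "norm (D n z) \<le> (Y z)\<^sup>2 / 2" by simp
    qed
  qed (simp_all add: D_def)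
  moreover have "(\<lambda>n. (real (Suc n))\<^sup>2 * (1 - exp (- (1 / real (Suc n))\<^sup>2 * c))) \<longlonglongrightarrow> c"
    by (cases "c = 0") (simp, real_asymp)
  ultimately have "(LINT z|M. (Y z)\<^sup>2 / 2) = c"
    unfolding Dint by (rule LIMSEQ_unique)
  then show ?thesis by simp
qed

text \<open>On two copies of the space, weighted by \<open>1\<close> and \<open>-1\<close>, the equality of two measures becomes the
  vanishing of a signed one, so that the uniqueness of Fourier transforms applies.\<close>

lemma distr_eq_of_cylinders:
  fixes S :: "'h::banach \<Rightarrow> 'h" and X :: "nat \<Rightarrow> 'h \<Rightarrow> real"
  assumes m: "prob_space m" "sets m = sets borel" and S[measurable]: "S \<in> borel_measurable borel"
    and X[measurable]: "\<And>l. X l \<in> borel_measurable borel"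
    and gen: "sets (borel :: 'h measure) = sigma_sets UNIV (cylinders UNIV X)"
    and char: "\<And>t d. (LINT z|m. cis (\<Sum>l<d. t l * X l z)) = (LINT z|m. cis (\<Sum>l<d. t l * X l (S z)))"
  shows "distr m borel S = m"
proof -
  interpret prob_space m by (rule m)
  have sp: "space m = UNIV" using sets_eq_imp_space_eq[OF m(2)] by simp
  have mm: "measurable m N = measurable borel N" for N :: "'b measure"
    by (rule measurable_cong_sets[OF m(2) refl])
  have Sm[measurable]: "S \<in> measurable m borel" using S unfolding mm .
  have Xm[measurable]: "X l \<in> borel_measurable m" for l using X[of l] unfolding mm .
  have XSm[measurable]: "(\<lambda>z. X l (S z)) \<in> borel_measurable m" for l
    using measurable_comp[OF Sm X[of l]] by (simp add: o_def)
  let ?C = "count_space (UNIV :: bool set)"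
  let ?P = "?C \<Otimes>\<^sub>M m"
  interpret C: finite_measure ?C by (rule finite_measure_count_space) simp
  interpret P: pair_sigma_finite ?C m ..
  have fin: "finite_measure ?P"
  proof (rule finite_measureI)
    have "emeasure ?P (space ?P) = emeasure ?C UNIV * emeasure m (space m)"
      unfolding space_pair_measure space_count_space by (rule emeasure_pair_measure_Times) auto
    then show "emeasure ?P (space ?P) \<noteq> \<infinity>" by (simp add: emeasure_space_1)
  qed
  interpret F: finite_measure ?P by (rule fin)
  have split: "(LINT p|?P. F p) = (LINT z|m. F (True, z)) + (LINT z|m. F (False, z))"
    if F: "F \<in> borel_measurable ?P" and b: "\<And>p. norm (F p) \<le> 1" for F :: "bool \<times> 'h \<Rightarrow> 'b::{banach, second_countable_topology}"
  proof -
    have "integrable ?P F" using F b by (intro F.integrable_const_bound[of _ 1]) auto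
    then have "(LINT p|?P. F p) = (LINT b|?C. LINT z|m. F (b, z))"
      by (rule P.integral_fst'[symmetric])
    then show ?thesis by (simp add: lebesgue_integral_count_space_finite UNIV_bool)
  qed
  define h where "h = (\<lambda>p :: bool \<times> 'h. if fst p then 1 else -1 :: real)"
  define Y where "Y l p = (if fst p then X l (snd p) else X l (S (snd p)))" for l and p :: "bool \<times> 'h"
  have hm[measurable]: "h \<in> borel_measurable ?P" unfolding h_def by measurable
  have Ym[measurable]: "Y l \<in> borel_measurable ?P" for l unfolding Y_def by measurable
  have cyl: "(LINT z|m. (\<Prod>l<d. indicator (B l) (X l z) :: real)) = (LINT z|m. (\<Prod>l<d. indicator (B l) (X l (S z))))"
    if B[measurable]: "\<And>l. B l \<in> sets borel" for d B
  proof -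
    have bnd: "\<bar>\<Prod>l<d. indicator (B l) (w l) :: real\<bar> \<le> 1" for w
      unfolding abs_prod by (intro prod_le_1) (auto simp: indicator_def)
    have "(LINT p|?P. h p * (\<Prod>l<d. indicator (B l) (Y l p))) = 0"
    proof (rule fourier_uniqueness_cylinder[OF _ Ym _ B])
      show "integrable ?P h" by (intro F.integrable_const_bound[of _ 1]) (auto simp: h_def)
      fix t
      have "(LINT p|?P. h p *\<^sub>R cis (\<Sum>l<d. t l * Y l p)) =
         (LINT z|m. cis (\<Sum>l<d. t l * X l z)) + (LINT z|m. - cis (\<Sum>l<d. t l * X l (S z)))"
        by (subst split) (auto simp: h_def Y_def cis_conv_exp)
      then show "(LINT p|?P. h p *\<^sub>R cis (\<Sum>l<d. t l * Y l p)) = 0"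
        using char[where d=d and t=t] by simp
    qed
    moreover have "(LINT p|?P. h p * (\<Prod>l<d. indicator (B l) (Y l p))) =
         (LINT z|m. (\<Prod>l<d. indicator (B l) (X l z) :: real)) + (LINT z|m. - (\<Prod>l<d. indicator (B l) (X l (S z))))"
      using bnd by (subst split) (auto simp: h_def Y_def abs_mult)
    ultimately show ?thesis by simp
  qed
  let ?E = "cylinders UNIV X"
  show ?thesis
  proof (rule measure_eqI_generator_eq[of ?E UNIV _ _ "\<lambda>_. UNIV"])
    show "Int_stable ?E" by (rule Int_stable_cylinders)
    show "sets (distr m borel S) = sigma_sets UNIV ?E" "sets m = sigma_sets UNIV ?E"
      using gen m(2) by simp_all
    show "range (\<lambda>_::nat. UNIV) \<subseteq> ?E" using space_in_cylinders by auto
    interpret D: prob_space "distr m borel S" by (rule prob_space_distr) simp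
    show "emeasure (distr m borel S) UNIV \<noteq> \<infinity>"
      using D.emeasure_space_1 by simp
    fix A assume "A \<in> ?E"
    then obtain d B where A: "A = {z \<in> UNIV. \<forall>l<d. X l z \<in> B l}" and "\<forall>l. B l \<in> sets borel"
      by (rule cylindersE)
    then have B[measurable]: "\<And>l. B l \<in> sets borel" by simp
    have ind: "indicator A z = (\<Prod>l<d. indicator (B l) (X l z) :: real)" for z
      by (rule indicator_cylinder[OF UNIV_I A])
    have Am: "A \<in> sets borel" unfolding A by simp
    have "measure (distr m borel S) A = (LINT z|distr m borel S. indicator A z)" by simp
    also have "\<dots> = (LINT z|m. indicator A (S z))" using Am by (intro integral_distr) auto
    also have "\<dots> = (LINT z|m. indicator A z)" unfolding ind by (rule cyl[OF B, symmetric])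
    also have "\<dots> = measure m A" using sp by simp
    finally show "emeasure (distr m borel S) A = emeasure m A"
      by (simp add: D.emeasure_eq_measure emeasure_eq_measure)
  qed auto
qed

section \<open>The Gaussian measure of an eigenvector field\<close>

locale gaussian_eigenfield = hilbert_basis cm ci e
  for cm :: "complex \<Rightarrow> 'h::banach \<Rightarrow> 'h" and ci :: "'h \<Rightarrow> 'h \<Rightarrow> complex" and e :: "nat \<Rightarrow> 'h" +
  fixes T :: "'h \<Rightarrow> 'h" and E :: "complex \<Rightarrow> 'h" and R :: "'h \<Rightarrow> 'h" and m :: "'h measure" and \<sigma> :: "nat \<Rightarrow> real"
  assumes sep: "separable_space TYPE('h)"
    and Tlin: "cbounded_linear cm T"
    and Efield: "eigenfield cm T E"
    and Ean: "analytic_near_circle cm E"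
    and Rdef: "\<forall>x y. ci (R x) y = covf ci E x y"
    and gauss: "gaussian_cov ci R m"
    and eig: "\<forall>j\<ge>1. R (e j) = (2 * (\<sigma> j)\<^sup>2) *\<^sub>R e j"
begin

sublocale pm: prob_space m
  using gauss by (simp add: gaussian_cov_def)

lemma sets_m: "sets m = sets borel"
  using gauss by (simp add: gaussian_cov_def)

lemma space_m: "space m = UNIV"
  using sets_eq_imp_space_eq[OF sets_m] by simp

lemma measurable_m: "measurable m N = measurable borel N"
  by (rule measurable_cong_sets[OF sets_m refl])

lemma ci_measurable_m [measurable]: "ci x \<in> borel_measurable m"
  unfolding measurable_m by (rule ci_measurable)

definition Y :: "'h \<Rightarrow> 'h \<Rightarrow> real" where "Y x = (\<lambda>z. Re (ci x z))"

lemma Y_add: "Y (x + y) = (\<lambda>z. Y x z + Y y z)"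
  by (simp add: Y_def ci_add_left)

lemma Y_scale: "Y (a *\<^sub>R x) = (\<lambda>z. a * Y x z)"
  by (simp add: Y_def ci_scaleR_left)

lemma Y_measurable: "Y x \<in> borel_measurable borel"
  unfolding Y_def by measurable

lemma V_integrable: "integrable m (\<lambda>z. ci x z * cnj (ci y z))"
  and V_integral: "(LINT z|m. ci x z * cnj (ci y z)) = ci (R x) y"
  using gauss by (auto simp: gaussian_cov_def)

lemma abs_sq_integral:
  "integrable m (\<lambda>z. (cmod (ci x z))\<^sup>2)" "(LINT z|m. (cmod (ci x z))\<^sup>2) = Re (ci (R x) x)"
proof -
  have i: "integrable m (\<lambda>z. complex_of_real ((cmod (ci x z))\<^sup>2))"
    using V_integrable[of x x] unfolding complex_norm_square .
  then show 1: "integrable m (\<lambda>z. (cmod (ci x z))\<^sup>2)" by (simp only: complex_of_real_integrable_eq)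
  have "complex_of_real (LINT z|m. (cmod (ci x z))\<^sup>2) = (LINT z|m. complex_of_real ((cmod (ci x z))\<^sup>2))"
    by (simp only: integral_complex_of_real)
  also have "\<dots> = ci (R x) x" using V_integral[of x x] unfolding complex_norm_square .
  finally show "(LINT z|m. (cmod (ci x z))\<^sup>2) = Re (ci (R x) x)" by (metis Re_complex_of_real)
qed

lemma Y_L2R: "Y x \<in> L2R m"
proof (rule L2R_I)
  show "Y x \<in> borel_measurable m" unfolding measurable_m by (rule Y_measurable)
  then show "integrable m (\<lambda>z. (Y x z)\<^sup>2)"
    by (intro Bochner_Integration.integrable_bound[OF abs_sq_integral(1)[of x]]) (auto simp: Y_def cmod_power2)
qed

lemma Y_im: "Im (ci x z) = Y (cm \<i> x) z"
  by (simp add: Y_def ci_cm_left)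

text \<open>\<open>csym_gaussian\<close> does not say what its parameter \<open>v\<close> is. Real
  and imaginary multipliers \<open>w\<close> show that the real and the imaginary part of
  \<open>ci x\<close> both have variance \<open>v / 2\<close>, and the two variances add up to
  \<open>ci (R x) x\<close>.\<close>

lemma Y_gaussian:
  "(LINT z|m. cis (t * Y x z)) = complex_of_real (exp (- t\<^sup>2 * (Re (ci (R x) x) / 4)))"
  "(LINT z|m. (Y x z)\<^sup>2) = Re (ci (R x) x) / 2"
proof -
  obtain v where v: "\<And>w. (LINT z|m. cis (Re (cnj w * ci x z))) = complex_of_real (exp (- (cmod w)\<^sup>2 * v / 4))"
    using gauss unfolding gaussian_cov_def csym_gaussian_def by blast
  have 1: "(LINT z|m. cis (t * Y x z)) = complex_of_real (exp (- t\<^sup>2 * (v / 4)))" for t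
    using v[of "complex_of_real t"] by (simp add: Y_def)
  have 2: "(LINT z|m. cis (t * Y (cm \<i> x) z)) = complex_of_real (exp (- t\<^sup>2 * (v / 4)))" for t
    using v[of "\<i> * complex_of_real t"] by (simp add: Y_im[symmetric] norm_mult)
  have a: "(LINT z|m. (Y x z)\<^sup>2) = 2 * (v / 4)"
    by (rule pm.gaussian_char_variance[OF Y_L2R 1])
  have b: "(LINT z|m. (Y (cm \<i> x) z)\<^sup>2) = 2 * (v / 4)"
    by (rule pm.gaussian_char_variance[OF Y_L2R 2])
  have "Re (ci (R x) x) = (LINT z|m. (Y x z)\<^sup>2 + (Y (cm \<i> x) z)\<^sup>2)"
  proof -
    have "Re (ci x z) = Y x z" for z by (simp add: Y_def)
    then show ?thesis unfolding abs_sq_integral(2)[symmetric] cmod_power2 Y_im by (simp only:)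
  qed
  also have "\<dots> = v" using a b L2R_D(2)[OF Y_L2R] by simp
  finally have "Re (ci (R x) x) = v" .
  with 1 a show "(LINT z|m. cis (t * Y x z)) = complex_of_real (exp (- t\<^sup>2 * (Re (ci (R x) x) / 4)))"
    "(LINT z|m. (Y x z)\<^sup>2) = Re (ci (R x) x) / 2" by simp_all
qed

lemma l2norm_Y: "(l2norm m (Y x))\<^sup>2 = Re (ci (R x) x) / 2"
  unfolding l2norm_sq using Y_gaussian(2)[of x] by (simp add: power2_eq_square)

lemma Y_char: "(LINT z|m. cis (Y x z)) = complex_of_real (exp (- (l2norm m (Y x))\<^sup>2 / 2))"
  using Y_gaussian(1)[of 1 x] by (simp add: l2norm_Y)

text \<open>\<open>R\<close> is given as a bare function; additivity and homogeneity of its form in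
  the first argument are derived from this symmetry.\<close>

lemma R_hermitian: "ci (R y) x = cnj (ci (R x) y)"
  unfolding V_integral[symmetric] Bochner_Integration.integral_cnj[symmetric]
  by (simp add: mult.commute)

lemma R_form_add: "ci (R (x + y)) z = ci (R x) z + ci (R y) z"
  using R_hermitian[of "x + y" z] R_hermitian[of x z] R_hermitian[of y z] by (simp add: ci_add_right)

lemma R_form_cm: "ci (R (cm a x)) z = cnj a * ci (R x) z"
  using R_hermitian[of "cm a x" z] R_hermitian[of x z] by (simp add: ci_cm_right)

text \<open>Polarisation of the variance. The factor \<open>1 / 2\<close> is the share of the real
  part in a complex symmetric Gaussian variable.\<close>

lemma Y_cov: "cov m (Y x) (Y y) = Re (ci (R x) y) / 2"
proof -
  have "(l2norm m (Y (x + y)))\<^sup>2 = (l2norm m (Y x))\<^sup>2 + 2 * cov m (Y x) (Y y) + (l2norm m (Y y))\<^sup>2"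
    using integral_diff_square[OF Y_L2R Y_L2R, of 1 x "-1" y]
    by (simp add: Y_add cov_def flip: l2norm_sq)
  moreover have "Re (ci (R (x + y)) (x + y)) = Re (ci (R x) x) + 2 * Re (ci (R x) y) + Re (ci (R y) y)"
    using R_hermitian[of y x] by (simp add: R_form_add ci_add_right)
  ultimately show ?thesis by (simp add: l2norm_Y)
qed

definition Gfam :: "('h \<Rightarrow> real) set" where "Gfam = l2cl m (range Y)"

sublocale gf: gaussian_family m Gfam
  unfolding Gfam_def
proof (rule pm.l2cl_gaussian_family)
  show "range Y \<subseteq> L2R m" using Y_L2R by auto
  fix X X' assume "X \<in> range Y" "X' \<in> range Y"
  then show "(\<lambda>z. X z + X' z) \<in> range Y" by (auto simp flip: Y_add)
next
  fix a X assume "X \<in> range Y"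
  then show "(\<lambda>z. a * X z) \<in> range Y" by (auto simp flip: Y_scale)
next
  fix X assume "X \<in> range Y"
  then show "(LINT z|m. cis (X z)) = complex_of_real (exp (- (l2norm m X)\<^sup>2 / 2))" using Y_char by auto
qed

section \<open>Agreement of the projected and the recursive Wick products\<close>

lemma l2cl_base: "f \<in> S \<Longrightarrow> f \<in> L2R m \<Longrightarrow> f \<in> l2cl m S"
  unfolding l2cl_def by (intro CollectI conjI exI[of _ "\<lambda>_. f"]) (auto simp: l2norm_def)

lemma l2cl_mono: "S \<subseteq> S' \<Longrightarrow> l2cl m S \<subseteq> l2cl m S'"
  unfolding l2cl_def by blast

lemma Y_Gfam: "Y x \<in> Gfam"
  unfolding Gfam_def by (intro l2cl_base Y_L2R) simp

abbreviation "gf\<^sub>e \<equiv> gfun cm ci e"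

lemma gfun_Y: "gf\<^sub>e l = Y (frake cm e l)"
  by (simp add: gfun_def Y_def)

lemma gfun_Gfam: "gf\<^sub>e l \<in> Gfam"
  unfolding gfun_Y by (rule Y_Gfam)

lemma Gset_Gfam: "Gset cm ci e m \<subseteq> Gfam"
  unfolding Gset_def Gfam_def
proof (rule l2cl_mono, rule subsetI)
  fix f assume "f \<in> rspan {gf\<^sub>e l | l. l \<noteq> 0}"
  then show "f \<in> range Y"
  proof (induction rule: rspan_induct)
    case zero
    have "Y 0 = (\<lambda>z. 0)" by (simp add: Y_def)
    then show ?case by (metis rangeI)
  next
    case (step a g h)
    then obtain l x where "g = Y (frake cm e l)" "h = Y x" by (auto simp: gfun_Y)
    then have "(\<lambda>z. a * g z + h z) = Y (a *\<^sub>R frake cm e l + x)" by (simp add: Y_add Y_scale)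
    then show ?case by blast
  qed
qed

lemma gfun_Gset: "l \<noteq> 0 \<Longrightarrow> gf\<^sub>e l \<in> Gset cm ci e m"
  unfolding Gset_def by (intro l2cl_base rspan_base) (auto simp: gfun_Y Y_L2R)

lemma prodl_upt: "prodl (map g [0..<k]) z = (\<Prod>j<k. g j z)"
  unfolding prodl_def by (induction k) (auto simp: mult.commute)

text \<open>Together with \<open>prodspan_Gpow\<close> this places the span behind
  \<open>Glow\<close> between polynomials in \<open>Gset\<close> and polynomials in
  \<open>Gfam\<close>. The former contain the correction terms of a Wick product, the latter are
  orthogonal to it.\<close>

lemma Gpow_prodspan: assumes "j < k" shows "Gpow cm ci e m j \<subseteq> prodspan Gfam k"
  unfolding Gpow_def prodspan_def
proof (rule rspan_subset, rule subsetI)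
  fix f assume "f \<in> {(\<lambda>z. \<Prod>i<j. g i z) | g. \<forall>i<j. g i \<in> Gset cm ci e m}"
  then obtain g where g: "f = (\<lambda>z. \<Prod>i<j. g i z)" "\<And>i. i < j \<Longrightarrow> g i \<in> Gfam" using Gset_Gfam by blast
  have fp: "f = prodl (map g [0..<j])" unfolding g(1) by (rule ext) (simp add: prodl_upt)
  then show "f \<in> rspan {prodl L | L. set L \<subseteq> Gfam \<and> length L < k}"
    using assms g(2) fp by (intro rspan_base CollectI exI[of _ "map g [0..<j]"]) auto
qed

lemma prodspan_Gpow: "prodspan (Gset cm ci e m) k \<subseteq> rspan (\<Union>j<k. Gpow cm ci e m j)"
  unfolding prodspan_def
proof (rule rspan_subset, rule subsetI)
  fix f assume "f \<in> {prodl L | L. set L \<subseteq> Gset cm ci e m \<and> length L < k}"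
  then obtain L where L: "f = prodl L" "set L \<subseteq> Gset cm ci e m" "length L < k" by blast
  have "prodl L z = (\<Prod>i<length L. (L ! i) z)" for z
    using prodl_upt[of "\<lambda>i. L ! i" "length L" z] by (simp add: map_nth)
  then have "f \<in> Gpow cm ci e m (length L)"
    unfolding Gpow_def L(1) using L(2) by (intro rspan_base CollectI exI[of _ "\<lambda>i. L ! i"]) auto
  then show "f \<in> rspan (\<Union>j<k. Gpow cm ci e m j)" using L(3) by (intro rspan_base) auto
qed

lemma Glow_orth:
  assumes L: "set L \<subseteq> Gfam" and h: "h \<in> Glow cm ci e m (length L)"
  shows "(LINT z|m. wickp m L z * h z) = 0"
proof -
  obtain s where hL: "h \<in> L2R m" and s: "\<And>n. s n \<in> rspan (\<Union>j<length L. Gpow cm ci e m j)"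
    and lim: "(\<lambda>n. l2norm m (\<lambda>z. h z - s n z)) \<longlonglongrightarrow> 0"
    using h unfolding Glow_def l2cl_def by blast
  have "rspan (\<Union>j<length L. Gpow cm ci e m j) \<subseteq> prodspan Gfam (length L)"
    unfolding prodspan_def using Gpow_prodspan by (intro rspan_subset) (auto simp: prodspan_def)
  then have sp: "s n \<in> prodspan Gfam (length L)" for n using s by blast
  have W: "wickp m L \<in> L2R m" by (intro allmom_L2R gf.wickp_allmom L)
  have "(\<lambda>n. LINT z|m. wickp m L z * s n z) \<longlonglongrightarrow> (LINT z|m. wickp m L z * h z)"
    by (rule l2_tendsto_integral_mult[OF W hL W allmom_L2R[OF gf.prodspan_allmom[OF sp]] _ lim]) (simp add: l2norm_def)
  then show ?thesis unfolding gf.wickp_prodspan_orth[OF L sp] by (simp add: LIMSEQ_const_iff)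
qed

abbreviation "wick_coeff \<equiv> alpha cm ci e \<sigma> m"

text \<open>The recursive Wick product solves the projection problem behind \<open>wick\<close>, and
  the solution is unique almost everywhere, which is enough under the integral.\<close>

lemma alpha_eq:
  assumes I: "0 \<notin> set I" and f: "f \<in> L2R m"
  shows "wick_coeff f I = (LINT z|m. f z * wickp m (map gf\<^sub>e I) z) / (fact (length I) * prod_list (map (\<lambda>l. (\<sigma> (nat \<bar>l\<bar>))\<^sup>2) I))"
proof -
  let ?L = "map gf\<^sub>e I" and ?V = "Glow cm ci e m (length I)"
  have p: "(\<lambda>z. prod_list (map (\<lambda>l. gf\<^sub>e l z) I)) = prodl ?L" by (simp add: prodl_def[abs_def] o_def)
  have L: "set ?L \<subseteq> Gfam" using gfun_Gfam by auto
  have "i \<noteq> 0" if "i \<in> set I" for i using that I by metis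
  then have LG: "set ?L \<subseteq> Gset cm ci e m" using gfun_Gset by auto
  have V: "?V \<subseteq> L2R m" by (auto simp: Glow_def l2cl_def)
  have "(\<lambda>z. wickp m ?L z - prodl ?L z) \<in> prodspan (Gset cm ci e m) (length I)"
    using wickp_prodspan[OF LG, of m] by simp
  then have "(\<lambda>z. (-1) * (wickp m ?L z - prodl ?L z)) \<in> rspan (\<Union>j<length I. Gpow cm ci e m j)"
    using prodspan_Gpow by (intro rspan_scale) blast
  then have r: "(\<lambda>z. prodl ?L z - wickp m ?L z) \<in> rspan (\<Union>j<length I. Gpow cm ci e m j)" by simp
  have mem: "(\<lambda>z. prodl ?L z - wickp m ?L z) \<in> ?V"
    unfolding Glow_def by (intro l2cl_base r L2R_diff allmom_L2R gf.prodl_allmom gf.wickp_allmom L)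
  have orth: "(LINT z|m. wickp m ?L z * h z) = 0" if "h \<in> ?V" for h
    using Glow_orth[OF L, of h] that by simp
  have pr: "l2proj m ?V (prodl ?L) \<in> ?V" "AE z in m. prodl ?L z - l2proj m ?V (prodl ?L) z = wickp m ?L z"
    by (rule gf.l2proj_prodl[OF L V mem], erule orth)+
  have wm: "wick cm ci e m (length I) (prodl ?L) \<in> borel_measurable m"
    unfolding wick_def using V pr(1) L2R_D(1)[of "l2proj m ?V (prodl ?L)" m] allmom_measurable[OF gf.prodl_allmom[OF L]]
    by (intro borel_measurable_diff) auto
  have "(LINT z|m. f z * wick cm ci e m (length I) (prodl ?L) z) = (LINT z|m. f z * wickp m ?L z)"
  proof (rule integral_cong_AE)
    show "(\<lambda>z. f z * wick cm ci e m (length I) (prodl ?L) z) \<in> borel_measurable m"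
      by (intro borel_measurable_times L2R_D(1)[OF f] wm)
    show "(\<lambda>z. f z * wickp m ?L z) \<in> borel_measurable m"
      by (intro borel_measurable_times L2R_D(1)[OF f] allmom_measurable gf.wickp_allmom L)
    show "AE z in m. f z * wick cm ci e m (length I) (prodl ?L) z = f z * wickp m ?L z"
      using pr(2) unfolding wick_def by eventually_elim simp
  qed
  then show ?thesis unfolding alpha_def p by simp
qed

section \<open>The real coordinates as an orthogonal generating system\<close>

definition modes :: "nat \<Rightarrow> int set" where "modes N = {- int N..int N} - {0}"

lemma UN_modes: "(\<Union>N. modes N) = {i. i \<noteq> 0}"
proof (intro equalityI subsetI)
  fix i :: int assume "i \<in> {i. i \<noteq> 0}"
  then have "i \<in> modes (nat \<bar>i\<bar>)" by (simp add: modes_def) arith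
  then show "i \<in> (\<Union>N. modes N)" by (rule UN_I[OF UNIV_I])
qed (auto simp: modes_def)

lemma sum_modes: "(\<Sum>i\<in>modes N. h i) = (\<Sum>j\<in>{1..N}. h (int j) + h (- int j))"
proof (induction N)
  case 0
  then show ?case by (simp add: modes_def)
next
  case (Suc N)
  have "modes (Suc N) = insert (int (Suc N)) (insert (- int (Suc N)) (modes N))" by (auto simp: modes_def)
  then have "(\<Sum>i\<in>modes (Suc N). h i) = h (int (Suc N)) + (h (- int (Suc N)) + (\<Sum>i\<in>modes N. h i))"
    by (simp add: modes_def)
  then show ?case using Suc by (simp add: add_ac)
qed

lemma frake_bessel: "(\<Sum>i\<in>modes N. (cmod (ci (frake cm e i) y))\<^sup>2) \<le> 2 * (norm y)\<^sup>2"
proof -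
  have "(\<Sum>i\<in>modes N. (cmod (ci (frake cm e i) y))\<^sup>2) = (\<Sum>j\<in>{1..N}. 2 * (cmod (ci (e j) y))\<^sup>2)"
    unfolding sum_modes by (intro sum.cong refl) (auto simp: frake_def ci_cm_left norm_mult)
  then show ?thesis using bessel[of y N] by (simp add: sum_distrib_left[symmetric])
qed

text \<open>The real and imaginary parts of one coordinate are uncorrelated because
  \<open>ci (R (e j)) (cm \<i> (e j))\<close> is purely imaginary. The variance is half the
  eigenvalue \<open>2 * (\<sigma> j)^2\<close>.\<close>

lemma gfun_orth:
  assumes "i \<noteq> 0" "j \<noteq> 0"
  shows "cov m (gf\<^sub>e i) (gf\<^sub>e j) = (if i = j then (\<sigma> (nat \<bar>i\<bar>))\<^sup>2 else 0)"
proof -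
  have b: "ci (R (e k)) (e l) = (if k = l then complex_of_real (2 * (\<sigma> k)\<^sup>2) else 0)" if "k \<ge> 1" "l \<ge> 1" for k l
    using eig that onb by (simp add: ci_scaleR_left)
  have "nat i \<ge> 1" if "i > 0" for i using that by simp
  consider "i > 0" "j > 0" | "i > 0" "j < 0" | "i < 0" "j > 0" | "i < 0" "j < 0" using assms by linarith
  then show ?thesis
    by cases (auto simp: gfun_Y Y_cov frake_def R_form_cm ci_cm_right b nat_eq_iff)
qed

text \<open>Enumerates the nonzero integers as \<open>1, -1, 2, -2, ...\<close>, since cylinder sets
  are formed from a sequence of variables.\<close>

definition mode :: "nat \<Rightarrow> int" where "mode l = (if even l then int (l div 2) + 1 else - (int (l div 2) + 1))"

lemma range_mode: "range mode = {i. i \<noteq> 0}"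
proof
  show "{i. i \<noteq> 0} \<subseteq> range mode"
  proof
    fix i :: int assume i: "i \<in> {i. i \<noteq> 0}"
    show "i \<in> range mode"
    proof (cases "i > 0")
      case True
      then have "mode (2 * nat (i - 1)) = i" by (simp add: mode_def)
      then show ?thesis by (metis rangeI)
    next
      case False
      then have "mode (2 * nat (- i - 1) + 1) = i" using i by (simp add: mode_def)
      then show ?thesis by (metis rangeI)
    qed
  qed
qed (auto simp: mode_def)

text \<open>By Parseval's identity distances are limits of functions of the coordinates, so balls
  lie in the generated sigma-algebra; by separability every open set is a countable union of
  balls.\<close>

lemma cylinders_generate:
  "sets (borel :: 'h measure) = sigma_sets UNIV (cylinders UNIV (\<lambda>l. gf\<^sub>e (mode l)))"
    (is "_ = sigma_sets UNIV ?E")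
proof -
  define N where "N = sigma (UNIV :: 'h set) ?E"
  have spN: "space N = UNIV" by (simp add: N_def space_measure_of_conv)
  have setsN: "sets N = sigma_sets UNIV ?E" unfolding N_def by (rule sets_measure_of) auto
  have X[measurable]: "gf\<^sub>e (mode l) \<in> borel_measurable N" for l
  proof (rule measurableI)
    fix A :: "real set" assume A: "A \<in> sets borel"
    have "gf\<^sub>e (mode l) -` A \<inter> space N = {z \<in> UNIV. \<forall>k<Suc l. gf\<^sub>e (mode k) z \<in> (if k = l then A else UNIV)}"
      by (auto simp: spN)
    also have "\<dots> \<in> ?E" using A by (intro cylindersI[of "\<lambda>k. if k = l then A else UNIV"]) auto
    finally show "gf\<^sub>e (mode l) -` A \<inter> space N \<in> sets N" unfolding setsN by (rule sigma_sets.Basic)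
  qed simp
  have g[measurable]: "gf\<^sub>e i \<in> borel_measurable N" if "i \<noteq> 0" for i
  proof -
    have "i \<in> range mode" using that unfolding range_mode by simp
    then obtain l where "i = mode l" by (rule rangeE)
    then show ?thesis using X by simp
  qed
  have cie: "(\<lambda>z. ci (e j) z) \<in> borel_measurable N" if j: "j \<ge> 1" for j
  proof -
    have eq: "ci (e j) z = complex_of_real (gf\<^sub>e (int j) z) + \<i> * complex_of_real (gf\<^sub>e (- int j) z)" for z
      using j by (simp add: complex_eq_iff gfun_def frake_def ci_cm_left)
    have [measurable]: "gf\<^sub>e (int j) \<in> borel_measurable N" "gf\<^sub>e (- int j) \<in> borel_measurable N" using j g by auto
    show ?thesis unfolding eq by measurable
  qed
  have dist: "(\<lambda>z. dist a z) \<in> borel_measurable N" for a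
  proof -
    have "(\<lambda>z. (norm (z - a))\<^sup>2) \<in> borel_measurable N"
    proof (rule borel_measurable_LIMSEQ_real)
      show "(\<lambda>N. \<Sum>j\<in>{1..N}. (cmod (ci (e j) (z - a)))\<^sup>2) \<longlonglongrightarrow> (norm (z - a))\<^sup>2" for z by (rule parseval)
      show "(\<lambda>z. \<Sum>j\<in>{1..n}. (cmod (ci (e j) (z - a)))\<^sup>2) \<in> borel_measurable N" for n
      proof (intro borel_measurable_sum borel_measurable_power)
        fix j assume "j \<in> {1..n}"
        then have [measurable]: "ci (e j) \<in> borel_measurable N" using cie by simp
        show "(\<lambda>z. cmod (ci (e j) (z - a))) \<in> borel_measurable N"
          unfolding ci_diff_right by measurable
      qed
    qed
    then have "(\<lambda>z. sqrt ((norm (z - a))\<^sup>2)) \<in> borel_measurable N" by measurable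
    then show ?thesis by (simp add: dist_norm norm_minus_commute)
  qed
  have ball: "ball a r \<in> sets N" for a r
  proof -
    have "{z \<in> space N. dist a z < r} \<in> sets N" using dist[of a] by measurable
    then show ?thesis by (simp add: spN ball_def)
  qed
  obtain D :: "'h set" where D: "countable D" "closure D = UNIV" using sep unfolding separable_space_def by blast
  have op: "U \<in> sets N" if U: "open U" for U
  proof -
    have "U = (\<Union>p\<in>{p\<in>D \<times> \<rat>. ball (fst p) (snd p) \<subseteq> U}. ball (fst p) (snd p))"
    proof
      show "U \<subseteq> (\<Union>p\<in>{p\<in>D \<times> \<rat>. ball (fst p) (snd p) \<subseteq> U}. ball (fst p) (snd p))"
      proof
        fix x assume x: "x \<in> U"
        obtain r where r: "r > 0" "ball x r \<subseteq> U" using U x open_contains_ball by blast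
        \<comment> \<open>\<open>q < r / 2\<close> keeps the ball about the nearby centre
          \<open>a\<close> inside \<open>ball x r\<close>; the lower bound makes \<open>q\<close>
          positive.\<close>
        obtain q where q: "q \<in> \<rat>" "r / 4 < q" "q < r / 2" using Rats_dense_in_real[of "r/4" "r/2"] r by auto
        have "x \<in> closure D" by (simp add: D)
        moreover have "q > 0" using q(2) r(1) by linarith
        ultimately obtain a where a: "a \<in> D" "dist a x < q" unfolding closure_approachable by blast
        have "ball a q \<subseteq> ball x r"
        proof
          fix y assume "y \<in> ball a q"
          then have "dist a y < q" by simp
          then have "dist x y < q + q" using dist_triangle[of x y a] a(2) by (simp add: dist_commute)
          then show "y \<in> ball x r" using q(3) by simp
        qed
        then have "(a, q) \<in> {p\<in>D \<times> \<rat>. ball (fst p) (snd p) \<subseteq> U}" using a q r by auto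
        moreover have "x \<in> ball (fst (a, q)) (snd (a, q))" using a by simp
        ultimately show "x \<in> (\<Union>p\<in>{p\<in>D \<times> \<rat>. ball (fst p) (snd p) \<subseteq> U}. ball (fst p) (snd p))" by blast
      qed
    qed auto
    moreover have "(\<Union>p\<in>{p\<in>D \<times> \<rat>. ball (fst p) (snd p) \<subseteq> U}. ball (fst p) (snd p)) \<in> sets N"
    proof (rule sets.countable_UN')
      have "countable (D \<times> (\<rat> :: real set))" using D(1) by (intro countable_SIGMA countable_rat)
      then show "countable {p\<in>D \<times> \<rat>. ball (fst p) (snd p) \<subseteq> U}" by (rule countable_subset[rotated]) auto
    qed (use ball in auto)
    ultimately show ?thesis by simp
  qed
  show ?thesis
  proof
    show "sets borel \<subseteq> sigma_sets UNIV ?E"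
    proof -
      have "sigma_sets (space N) {S :: 'h set. open S} \<subseteq> sets N" using op by (intro sets.sigma_sets_subset) auto
      then show ?thesis unfolding setsN spN borel_def by (simp add: sets_measure_of_conv)
    qed
    show "sigma_sets UNIV ?E \<subseteq> sets borel"
    proof -
      have [measurable]: "gf\<^sub>e l \<in> borel_measurable borel" for l unfolding gfun_Y by (rule Y_measurable)
      have "?E \<subseteq> sets borel"
      proof
        fix A assume "A \<in> ?E"
        then obtain d B where A: "A = {z \<in> UNIV. \<forall>l<d. gf\<^sub>e (mode l) z \<in> B l}"
          and "\<forall>l. B l \<in> sets borel" by (rule cylindersE)
        then have [measurable]: "\<And>l. B l \<in> sets borel" by simp
        show "A \<in> sets borel" unfolding A by simp
      qed
      then show ?thesis using sets.sigma_sets_subset[of ?E "borel :: 'h measure"] by simp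
    qed
  qed
qed

sublocale we: wick_expansion m Gfam "gf\<^sub>e" "\<lambda>i. (\<sigma> (nat \<bar>i\<bar>))\<^sup>2" modes
proof unfold_locales
  show "gf\<^sub>e i \<in> Gfam" for i by (rule gfun_Gfam)
  show "finite (modes N)" for N by (simp add: modes_def)
  show "modes N \<subseteq> modes N'" if "N \<le> N'" for N N' using that by (auto simp: modes_def)
  show "cov m (gf\<^sub>e i) (gf\<^sub>e j) = (if i = j then (\<sigma> (nat \<bar>i\<bar>))\<^sup>2 else 0)"
    if "i \<in> (\<Union>N. modes N)" "j \<in> (\<Union>N. modes N)" for i j
    using that unfolding UN_modes by (intro gfun_orth) auto
  fix f assume f: "f \<in> L2R m"
    and orth: "\<And>I. set I \<subseteq> (\<Union>N. modes N) \<Longrightarrow> (LINT z|m. f z * wickp m (map gf\<^sub>e I) z) = 0"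
  show "AE z in m. f z = 0"
  proof (rule gf.wickp_complete[OF f, of "\<lambda>l. gf\<^sub>e (mode l)"])
    show "sets m = sigma_sets (space m) (cylinders (space m) (\<lambda>l. gf\<^sub>e (mode l)))"
      unfolding space_m sets_m by (rule cylinders_generate)
    fix L assume "set L \<subseteq> range (\<lambda>l. gf\<^sub>e (mode l))"
    then have "L \<in> lists (gf\<^sub>e ` {i. i \<noteq> 0})" unfolding range_mode[symmetric] by (auto simp: image_image)
    then obtain I where "L = map gf\<^sub>e I" "set I \<subseteq> {i. i \<noteq> 0}" unfolding lists_image by (auto simp: in_lists_conv_set)
    then show "(LINT z|m. f z * wickp m L z) = 0" using orth[of I] by (simp add: UN_modes)
  qed (rule gfun_Gfam)
qed

lemma alpha_is_coeff: assumes f: "f \<in> L2R m" shows "we.is_coeff f (wick_coeff f)"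
  unfolding we.is_coeff_def
proof (intro conjI allI impI)
  fix I J :: "int list" assume IJ: "mset I = mset J"
  have "prod_list (map h I) = prod_list (map h J)" for h :: "int \<Rightarrow> real"
    using IJ by (metis mset_map prod_mset_prod_list)
  then show "wick_coeff f I = wick_coeff f J"
    using mset_eq_length[OF IJ] by (simp add: alpha_def)
next
  fix I :: "int list" assume I: "set I \<subseteq> (\<Union>N. modes N)"
  then have I0: "0 \<notin> set I" unfolding UN_modes by auto
  show "fact (length I) * prod_list (map (\<lambda>i. (\<sigma> (nat \<bar>i\<bar>))\<^sup>2) I) * wick_coeff f I = (LINT z|m. f z * wickp m (map gf\<^sub>e I) z)"
  proof (cases "prod_list (map (\<lambda>i. (\<sigma> (nat \<bar>i\<bar>))\<^sup>2) I) = 0")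
    case False
    then show ?thesis using alpha_eq[OF I0 f] by simp
  next
    \<comment> \<open>Some variance is zero: the left side vanishes whatever the coefficient is, and
      the right side vanishes because a null factor annihilates the Wick product.\<close>
    case True
    then obtain i where i: "i \<in> set I" "\<sigma> (nat \<bar>i\<bar>) = 0" by (auto simp: prod_list_zero_iff)
    then have "i \<noteq> 0" using I0 by auto
    then have "l2norm m (gf\<^sub>e i) = 0"
      using gfun_orth[of i i] i(2) l2norm_sq[of m "gf\<^sub>e i"] by (simp add: cov_def)
    then have "AE z in m. wickp m (map gf\<^sub>e I) z = 0"
      using i(1) gfun_Gfam by (intro gf.wickp_degenerate[of _ "gf\<^sub>e i"]) auto
    then have "AE z in m. f z * wickp m (map gf\<^sub>e I) z = 0" by eventually_elim simp
    then show ?thesis using True by (simp add: integral_eq_zero_AE)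
  qed
qed

end

section \<open>Decay of correlations\<close>

text \<open>The recursion uses only values and covariances of the variables, and the covariances are
  unchanged under \<open>S\<close>.\<close>

lemma wickp_compose:
  assumes "\<And>X X'. X \<in> G \<Longrightarrow> X' \<in> G \<Longrightarrow> cov M (\<lambda>z. X (S z)) (\<lambda>z. X' (S z)) = cov M X X'"
  shows "set L \<subseteq> G \<Longrightarrow> wickp M (map (\<lambda>X z. X (S z)) L) z = wickp M L (S z)"
proof (induction L rule: length_induct)
  case (1 L)
  show ?case
  proof (cases L)
    case (Cons y ys)
    have IH: "wickp M (map (\<lambda>X z. X (S z)) K) z = wickp M K (S z)" if "length K < length L" "set K \<subseteq> G" for K
      using 1 that by blast
    have "contr (cov M) (\<lambda>z. y (S z)) (\<lambda>K. wickp M K z) (map (\<lambda>X z. X (S z)) ys) =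
       contr (\<lambda>u X. cov M u (\<lambda>z. X (S z))) (\<lambda>z. y (S z)) (\<lambda>K. wickp M (map (\<lambda>X z. X (S z)) K) z) ys"
      by (rule contr_map)
    also have "\<dots> = contr (\<lambda>u X. cov M u (\<lambda>z. X (S z))) (\<lambda>z. y (S z)) (\<lambda>K. wickp M K (S z)) ys"
      using Cons 1(2) by (intro contr_cong_subset IH) auto
    also have "\<dots> = contr (cov M) y (\<lambda>K. wickp M K (S z)) ys"
    proof -
      have "contr (\<lambda>u X. cov M u (\<lambda>z. X (S z))) (\<lambda>z. y (S z)) F K = contr (cov M) y F K" if "set K \<subseteq> G" for F :: "_ \<Rightarrow> real" and K
        using that assms Cons 1(2) by (induction K arbitrary: F) auto
      then show ?thesis using Cons 1(2) by auto
    qed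
    finally show ?thesis using IH[of ys] Cons 1(2) by simp
  qed simp
qed

context gaussian_eigenfield
begin

text \<open>\<open>E\<close> is arbitrary off a neighbourhood of the circle, and an integrand that is not Borel measurable
  on the whole plane has integral \<open>0\<close>. In that case the functional \<open>ci (R x)\<close> vanishes off a proper subspace and hence everywhere.\<close>

lemma form_integrand_dichotomy:
  "(\<forall>x y. ci (R x) y = 0) \<or> (\<forall>x y. (\<lambda>w. ci x (E w) * cnj (ci y (E w))) \<in> borel_measurable borel)"
proof -
  define F where "F x y w = ci x (E w) * cnj (ci y (E w))" for x y w
  have Fadd1: "F (x + k) y w = F x y w + F k y w" for x k y w by (simp add: F_def ci_add_left algebra_simps)
  have Fadd2: "F x (y + k) w = F x y w + F x k w" for x k y w by (simp add: F_def ci_add_left algebra_simps)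
  have zero: "ci (R x) y = 0" if "F x y \<notin> borel_measurable borel" for x y
  proof -
    have "sets circ = sets borel" by (simp add: circ_def)
    then have "\<not> integrable circ (F x y)"
      using that measurable_cong_sets[of circ borel borel borel] by (auto dest: borel_measurable_integrable)
    then have "(LINT w|circ. F x y w) = 0" by (rule not_integrable_integral_eq)
    then show ?thesis using Rdef by (simp add: covf_def F_def[abs_def])
  qed
  have zero_all: "ci (R x) y = 0" if x: "F x y0 \<notin> borel_measurable borel" for x y y0
  proof (cases "F x y \<in> borel_measurable borel")
    case True
    have "F x (y + y0) \<notin> borel_measurable borel"
    proof
      assume "F x (y + y0) \<in> borel_measurable borel"
      then have "(\<lambda>w. F x (y + y0) w - F x y w) \<in> borel_measurable borel" using True by (intro borel_measurable_diff)
      then show False using x by (simp add: Fadd2)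
    qed
    then show ?thesis using zero[of x "y + y0"] zero[OF x] by (simp add: ci_add_right)
  qed (rule zero)
  show ?thesis
  proof (cases "\<forall>x y. F x y \<in> borel_measurable borel")
    case True
    then show ?thesis by (simp add: F_def[abs_def])
  next
    case False
    then obtain k y0 where k: "F k y0 \<notin> borel_measurable borel" by blast
    have "ci (R x) y = 0" for x y
    proof (cases "F x y0 \<in> borel_measurable borel")
      case True
      have "F (x + k) y0 \<notin> borel_measurable borel"
      proof
        assume "F (x + k) y0 \<in> borel_measurable borel"
        then have "(\<lambda>w. F (x + k) y0 w - F x y0 w) \<in> borel_measurable borel" using True by (intro borel_measurable_diff)
        then show False using k by (simp add: Fadd1)
      qed
      then show ?thesis using zero_all[of "x + k" y0 y] zero_all[OF k, of y] by (simp add: R_form_add)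
    qed (rule zero_all)
    then show ?thesis by blast
  qed
qed

section \<open>Invariance of the measure and composition with the dynamics\<close>

definition analytic_nbhd :: "complex set \<Rightarrow> bool" where
  "analytic_nbhd U \<longleftrightarrow> open U \<and> sphere 0 1 \<subseteq> U \<and> analytic_vec_on cm E U"

lemma R_form_circle:
  assumes U: "analytic_nbhd U" and F: "\<And>x y. (\<lambda>w. ci x (E w) * cnj (ci y (E w))) \<in> borel_measurable borel"
  shows "ci (R x) y = integral {0..1} (\<lambda>t. ci x (E (cis (2 * pi * t))) * cnj (ci y (E (cis (2 * pi * t)))))"
proof -
  have c: "continuous_on (sphere 0 1) (\<lambda>w. ci x (E w))" for x
    using U holomorphic_on_imp_continuous_on[OF analytic_vec_holomorphic[of E U x]]
    by (auto simp: analytic_nbhd_def intro: continuous_on_subset)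
  have "ci (R x) y = (LINT w|circ. ci x (E w) * cnj (ci y (E w)))" using Rdef by (simp add: covf_def)
  also have "\<dots> = integral {0..1} (\<lambda>t. ci x (E (cis (2 * pi * t))) * cnj (ci y (E (cis (2 * pi * t)))))"
    by (rule circ_integral[OF F]) (intro continuous_intros c)
  finally show ?thesis .
qed

lemma T_bounded_linear: "bounded_linear T" and T_cm: "T (cm a x) = cm a (T x)"
  using Tlin by (auto simp: cbounded_linear_def)

lemma Tn_bounded_linear: "bounded_linear (T ^^ n)"
proof (induction n)
  case 0
  then show ?case by (simp add: bounded_linear_ident id_def)
next
  case (Suc n)
  then show ?case using bounded_linear_compose[OF T_bounded_linear Suc] by (simp add: o_def)
qed

lemma Tn_cm: "(T ^^ n) (cm a x) = cm a ((T ^^ n) x)"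
  by (induction n) (auto simp: T_cm)

lemma Tn_E: "cmod w = 1 \<Longrightarrow> (T ^^ n) (E w) = cm (w ^ n) (E w)"
proof (induction n)
  case 0
  show ?case using cm_of_real[of 1 "E w"] by simp
next
  case (Suc n)
  then show ?case using Efield by (simp add: T_cm eigenfield_def cm_cm mult.commute)
qed

definition adj :: "nat \<Rightarrow> 'h \<Rightarrow> 'h" where "adj n x = (SOME a. \<forall>z. ci a z = ci x ((T ^^ n) z))"

lemma adj: "ci (adj n x) z = ci x ((T ^^ n) z)"
proof -
  have "\<exists>a. \<forall>z. ci a z = ci x ((T ^^ n) z)" by (rule adjoint_exists[OF Tn_bounded_linear Tn_cm])
  from someI_ex[OF this] show ?thesis unfolding adj_def by blast
qed

lemma adj_E: "cmod w = 1 \<Longrightarrow> ci (adj n x) (E w) = w ^ n * ci x (E w)"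
  by (simp add: adj Tn_E ci_cm_right)

lemma Y_adj: "Y (adj n x) z = Y x ((T ^^ n) z)"
  by (simp add: Y_def adj)

text \<open>Since \<open>E w\<close> is an eigenvector, passing to the adjoint multiplies the
  integrand by \<open>w ^ n * cnj w ^ n\<close>, which is \<open>1\<close> on the circle.\<close>

lemma R_form_adj:
  assumes U: "analytic_nbhd U"
  shows "ci (R (adj n x)) (adj n x) = ci (R x) x"
proof (cases "\<forall>x y. ci (R x) y = 0")
  case False
  then have F: "\<And>x y. (\<lambda>w. ci x (E w) * cnj (ci y (E w))) \<in> borel_measurable borel"
    using form_integrand_dichotomy by blast
  have "w ^ n * cnj w ^ n = 1" if "cmod w = 1" for w
    using that by (simp add: power_mult_distrib[symmetric] complex_norm_square[symmetric])
  then have "ci (adj n x) (E w) * cnj (ci (adj n x) (E w)) = ci x (E w) * cnj (ci x (E w))" if "cmod w = 1" for w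
    using that by (simp add: adj_E mult_ac)
  then show ?thesis unfolding R_form_circle[OF U F] by simp
qed simp

lemma Tn_measurable: "(T ^^ n) \<in> borel_measurable borel"
  by (intro borel_measurable_continuous_onI linear_continuous_on Tn_bounded_linear)

text \<open>Every linear combination of coordinates is some \<open>Y x\<close>, and its composition
  with \<open>T ^^ n\<close> is \<open>Y (adj n x)\<close>, of the same variance; so the Gaussian
  characteristic functions agree.\<close>

lemma invariant:
  assumes U: "analytic_nbhd U"
  shows "distr m borel (T ^^ n) = m"
proof (rule distr_eq_of_cylinders[OF pm.prob_space_axioms sets_m Tn_measurable _ cylinders_generate])
  show "gf\<^sub>e (mode l) \<in> borel_measurable borel" for l unfolding gfun_Y by (rule Y_measurable)
  fix t :: "nat \<Rightarrow> real" and d :: nat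
  have "\<exists>x. \<forall>z. (\<Sum>l<d. t l * gf\<^sub>e (mode l) z) = Y x z"
  proof (induction d)
    case 0
    show ?case by (intro exI[of _ 0]) (simp add: Y_def)
  next
    case (Suc d)
    then obtain x where "\<And>z. (\<Sum>l<d. t l * gf\<^sub>e (mode l) z) = Y x z" by blast
    then have "(\<Sum>l<Suc d. t l * gf\<^sub>e (mode l) z) = Y (x + t d *\<^sub>R frake cm e (mode d)) z" for z
      by (simp add: Y_add Y_scale gfun_Y)
    then show ?case by blast
  qed
  then obtain x where x: "\<And>z. (\<Sum>l<d. t l * gf\<^sub>e (mode l) z) = Y x z" by blast
  show "(LINT z|m. cis (\<Sum>l<d. t l * gf\<^sub>e (mode l) z)) = (LINT z|m. cis (\<Sum>l<d. t l * gf\<^sub>e (mode l) ((T ^^ n) z)))"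
    unfolding x Y_adj[symmetric] Y_char l2norm_Y R_form_adj[OF U] ..
qed

lemma integral_Tn:
  fixes h :: "'h \<Rightarrow> real"
  assumes U: "analytic_nbhd U" and h: "h \<in> borel_measurable m"
  shows "(LINT z|m. h ((T ^^ n) z)) = (LINT z|m. h z)"
proof -
  have "(LINT z|m. h z) = (LINT z|distr m borel (T ^^ n). h z)" by (simp add: invariant[OF U])
  also have "\<dots> = (LINT z|m. h ((T ^^ n) z))"
    using Tn_measurable h by (intro integral_distr) (simp_all add: measurable_m)
  finally show ?thesis by simp
qed

lemma L2R_Tn:
  assumes U: "analytic_nbhd U" and f: "f \<in> L2R m"
  shows "(\<lambda>z. f ((T ^^ n) z)) \<in> L2R m"
proof (rule L2R_I)
  have Tm: "(T ^^ n) \<in> measurable m m"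
    using Tn_measurable measurable_cong_sets[OF sets_m sets_m] by blast
  show "(\<lambda>z. f ((T ^^ n) z)) \<in> borel_measurable m" by (rule measurable_compose[OF Tm L2R_D(1)[OF f]])
  have "integrable (distr m borel (T ^^ n)) (\<lambda>z. (f z)\<^sup>2)" using L2R_D(2)[OF f] by (simp add: invariant[OF U])
  then show "integrable m (\<lambda>z. (f ((T ^^ n) z))\<^sup>2)"
    using Tn_measurable L2R_D(1)[OF f]
    by (subst (asm) integrable_distr_eq) (simp_all add: measurable_m)
qed

lemma l2norm_Tn:
  assumes U: "analytic_nbhd U" and f: "f \<in> L2R m"
  shows "l2norm m (\<lambda>z. f ((T ^^ n) z)) = l2norm m f"
  using integral_Tn[OF U, of "\<lambda>z. (f z)\<^sup>2" n] L2R_D(1)[OF f] by (simp add: l2norm_def)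

definition gT :: "nat \<Rightarrow> int \<Rightarrow> 'h \<Rightarrow> real" where "gT n i = (\<lambda>z. gf\<^sub>e i ((T ^^ n) z))"

lemma gT_Y: "gT n i = Y (adj n (frake cm e i))"
  unfolding gT_def gfun_Y by (rule ext) (simp add: Y_adj)

lemma gT_Gfam: "gT n i \<in> Gfam"
  unfolding gT_Y by (rule Y_Gfam)

lemma partial_expansion_Tn:
  assumes U: "analytic_nbhd U"
  shows "we.partial_expansion a (gT n) N z = we.partial_expansion a gf\<^sub>e N ((T ^^ n) z)"
proof -
  have "cov m (\<lambda>z. X ((T ^^ n) z)) (\<lambda>z. X' ((T ^^ n) z)) = cov m X X'" if "X \<in> Gfam" "X' \<in> Gfam" for X X'
    unfolding cov_def using that by (intro integral_Tn[OF U] borel_measurable_times gf.G_measurable)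
  then have "wickp m (map (\<lambda>X z. X ((T ^^ n) z)) (map gf\<^sub>e I)) z = wickp m (map gf\<^sub>e I) ((T ^^ n) z)" for I
    by (rule wickp_compose) (auto intro: gfun_Gfam)
  then show ?thesis by (simp add: we.partial_expansion_def gT_def[abs_def] o_def)
qed

text \<open>Composition with \<open>T ^^ n\<close> preserves the L2 norm, so it carries the
  convergence of the expansion of \<open>f\<close> over to the expansion in the variables
  \<open>gT n\<close>.\<close>

lemma correlation_limit:
  assumes U: "analytic_nbhd U" and f: "f \<in> L2R m" and g: "g \<in> L2R m"
    and a: "we.is_coeff f a" and b: "we.is_coeff g b"
  shows "(\<lambda>N. LINT z|m. we.partial_expansion a (gT n) N z * we.partial_expansion b gf\<^sub>e N z)
     \<longlonglongrightarrow> (LINT z|m. f ((T ^^ n) z) * g z)"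
proof (rule l2_tendsto_integral_mult)
  show "(\<lambda>z. f ((T ^^ n) z)) \<in> L2R m" by (rule L2R_Tn[OF U f])
  show "we.partial_expansion a (gT n) N \<in> L2R m" for N by (intro we.partial_expansion_L2R gT_Gfam)
  show P: "we.partial_expansion b gf\<^sub>e N \<in> L2R m" for b N by (intro we.partial_expansion_L2R gfun_Gfam)
  show "(\<lambda>N. l2norm m (\<lambda>z. g z - we.partial_expansion b gf\<^sub>e N z)) \<longlonglongrightarrow> 0"
    by (rule we.partial_expansion_tendsto[OF b g])
  have "l2norm m (\<lambda>z. f ((T ^^ n) z) - we.partial_expansion a (gT n) N z) = l2norm m (\<lambda>z. f z - we.partial_expansion a gf\<^sub>e N z)" for N
    unfolding partial_expansion_Tn[OF U] by (rule l2norm_Tn[OF U L2R_diff[OF f P]])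
  then show "(\<lambda>N. l2norm m (\<lambda>z. f ((T ^^ n) z) - we.partial_expansion a (gT n) N z)) \<longlonglongrightarrow> 0"
    using we.partial_expansion_tendsto[OF a f] by simp
qed (rule g)

text \<open>This is where \<open>n\<close> enters the estimate: by \<open>adj_E\<close> the adjoint
  puts the factor \<open>w ^ n\<close> under the circle integral. A vanishing form is the zero
  kernel, decomposed over the empty index set.\<close>

lemma rank_one_approx_cov:
  assumes U: "analytic_nbhd U" and s: "0 < s" "s < 1"
    and sub: "\<And>z. s \<le> cmod z \<Longrightarrow> cmod z \<le> 1 / s \<Longrightarrow> z \<in> U"
    and B: "\<And>z. s \<le> cmod z \<Longrightarrow> cmod z \<le> 1 / s \<Longrightarrow> norm (E z) \<le> B"
  shows "rank_one_approx (modes N) (2 * B\<^sup>2 * s ^ n) (\<lambda>i j. cov m (gT n i) (gf\<^sub>e j))"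
proof (cases "\<forall>x y. ci (R x) y = 0")
  case True
  then have c0: "cov m (gT n i) (gf\<^sub>e j) = 0" for i j by (simp add: gT_Y gfun_Y Y_cov)
  have "0 \<le> 2 * B\<^sup>2 * s ^ n" using s by simp
  then show ?thesis unfolding rank_one_approx_def c0
    by (intro exI[of _ "\<lambda>_ _ _. 0"] conjI allI) (auto intro!: exI[of _ "{}"])
next
  case False
  then have F: "\<And>x y. (\<lambda>w. ci x (E w) * cnj (ci y (E w))) \<in> borel_measurable borel"
    using form_integrand_dichotomy by blast
  have "cov m (gT n i) (gf\<^sub>e j) = Re (integral {0..1} (\<lambda>t. cis (2 * pi * t) ^ n * ci (frake cm e i) (E (cis (2 * pi * t)))
      * cnj (ci (frake cm e j) (E (cis (2 * pi * t)))))) / 2" for i j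
    unfolding gT_Y gfun_Y Y_cov R_form_circle[OF U F] by (simp add: adj_E)
  moreover have "open U" "analytic_vec_on cm E U" using U by (auto simp: analytic_nbhd_def)
  then have "rank_one_approx (modes N) (2 * B\<^sup>2 * s ^ n)
    (\<lambda>i j. Re (integral {0..1} (\<lambda>t. cis (2 * pi * t) ^ n * ci (frake cm e i) (E (cis (2 * pi * t))) * cnj (ci (frake cm e j) (E (cis (2 * pi * t)))))) / 2)"
    by (rule rank_one_approx_circle_form[OF _ _ s]) (fact sub, fact B, rule frake_bessel)
  ultimately show ?thesis by (simp only:)
qed

section \<open>The two norms and the final estimate\<close>

abbreviation "\<X> \<equiv> Xsp cm ci e \<sigma> m"
abbreviation "\<Y> \<equiv> Ysp cm ci e \<sigma> m"
abbreviation "norm\<^sub>X \<equiv> Xnorm cm ci e \<sigma> m"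
abbreviation "norm\<^sub>Y \<equiv> Ynorm cm ci e \<sigma> m"

lemma Bnorm_le_Xnorm:
  assumes f: "f \<in> \<X>"
  shows "Bnorm (wick_coeff f) k \<le> norm\<^sub>X f" "l2norm m f \<le> norm\<^sub>X f"
proof -
  let ?b = "\<lambda>k. (Bnorm (wick_coeff f) k)\<^sup>2"
  have s: "summable ?b" using f by (simp add: Xsp_def)
  have "sum ?b {k} \<le> suminf ?b" using s by (intro sum_le_suminf) auto
  then have 1: "?b k \<le> (l2norm m f)\<^sup>2 + suminf ?b" by (simp add: add_increasing)
  have 2: "(l2norm m f)\<^sup>2 \<le> (l2norm m f)\<^sup>2 + suminf ?b" using suminf_nonneg[OF s] by simp
  show "Bnorm (wick_coeff f) k \<le> norm\<^sub>X f"
    unfolding Xnorm_def by (rule real_le_rsqrt[OF 1])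
  show "l2norm m f \<le> norm\<^sub>X f"
    unfolding Xnorm_def by (rule real_le_rsqrt[OF 2])
qed

lemma Bnorm_le_Ynorm:
  assumes g: "g \<in> \<Y>"
  shows "fact k * Bnorm (wick_coeff g) k \<le> norm\<^sub>Y g" "l2norm m g \<le> norm\<^sub>Y g"
proof -
  let ?b = "\<lambda>k. fact k * Bnorm (wick_coeff g) k"
  have bdd: "bdd_above (range ?b)" and B: "Bbdd (wick_coeff g) k" for k using g by (auto simp: Ysp_def)
  have up: "?b k \<le> (SUP k. ?b k)" for k by (intro cSUP_upper bdd) simp
  have "0 \<le> ?b 0" using Bnorm_nonneg[OF B[of 0]] by simp
  then have "0 \<le> (SUP k. ?b k)" using up[of 0] by linarith
  then show "fact k * Bnorm (wick_coeff g) k \<le> norm\<^sub>Y g" "l2norm m g \<le> norm\<^sub>Y g"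
    using up[of k] l2norm_nonneg[of m g] unfolding Ynorm_def by linarith+
qed

lemma Icorr_bound:
  assumes U: "analytic_nbhd U" and s: "0 < s" "s < 1"
    and sub: "\<And>z. s \<le> cmod z \<Longrightarrow> cmod z \<le> 1 / s \<Longrightarrow> z \<in> U"
    and B: "\<And>z. s \<le> cmod z \<Longrightarrow> cmod z \<le> 1 / s \<Longrightarrow> norm (E z) \<le> B"
    and f: "f \<in> \<X>" and g: "g \<in> \<Y>"
  shows "\<bar>Icorr T m n f g\<bar> \<le> 4 * (2 * B\<^sup>2 * s ^ n) * norm\<^sub>X f * norm\<^sub>Y g"
proof -
  let ?X = "norm\<^sub>X f" and ?Y = "norm\<^sub>Y g"
  define a b where "a = wick_coeff f" and "b = wick_coeff g"
  define K where "K = 2 * B\<^sup>2 * s ^ n"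
  have K0: "K \<ge> 0" using s by (simp add: K_def)
  have fL: "f \<in> L2R m" and gL: "g \<in> L2R m" using f g by (auto simp: Xsp_def Ysp_def)
  have ba: "Bbdd a k" and bb: "Bbdd b k" for k using f g by (auto simp: Xsp_def Ysp_def a_def b_def)
  have ca: "we.is_coeff f a" and cb: "we.is_coeff g b" unfolding a_def b_def by (intro alpha_is_coeff fL gL)+
  have X0: "0 \<le> ?X" and Y0: "0 \<le> ?Y"
    using Bnorm_le_Xnorm(2)[OF f] Bnorm_le_Ynorm(2)[OF g] l2norm_nonneg[of m f] l2norm_nonneg[of m g] by linarith+
  have a0: "a [] = (LINT z|m. f z)" and b0: "b [] = (LINT z|m. g z)"
    using ca[unfolded we.is_coeff_def, THEN conjunct2, rule_format, of "[]"]
      cb[unfolded we.is_coeff_def, THEN conjunct2, rule_format, of "[]"] by simp_all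
  have "\<bar>Icorr T m n f g\<bar> \<le> 4 * K * (?X * ?Y)"
  proof (cases "K \<le> 1 / 2")
    case True
    define t where "t N k = fact k * (\<Sum>I\<in>lsts (modes N) k. \<Sum>J\<in>lsts (modes N) k. a I * b J * prod_list (map2 (\<lambda>i j. cov m (gT n i) (gf\<^sub>e j)) I J))" for N k
    have tb: "\<bar>t N k\<bar> \<le> (?X * ?Y) * K ^ k" for N k
    proof -
      have A: "finite (modes N)" "0 \<notin> modes N" by (auto simp: modes_def)
      have "\<bar>\<Sum>I\<in>lsts (modes N) k. \<Sum>J\<in>lsts (modes N) k. a I * b J * prod_list (map2 (\<lambda>i j. cov m (gT n i) (gf\<^sub>e j)) I J)\<bar> \<le> Bnorm a k * Bnorm b k * K ^ k"
      proof (intro bilinear_approx_bound A mform_bounded_Bnorm ba bb Bnorm_nonneg)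
        show "rank_one_approx (modes N) K (\<lambda>i j. cov m (gT n i) (gf\<^sub>e j))"
          unfolding K_def by (rule rank_one_approx_cov[OF U s]) (fact sub, fact B)
      qed
      then have "\<bar>t N k\<bar> \<le> fact k * (Bnorm a k * Bnorm b k * K ^ k)"
        by (simp add: t_def abs_mult)
      \<comment> \<open>The factorial left by the permanent is absorbed by the weight in the norm of
        \<open>g\<close>.\<close>
      also have "\<dots> = (Bnorm a k * (fact k * Bnorm b k)) * K ^ k" by simp
      also have "\<dots> \<le> (?X * ?Y) * K ^ k"
        using Bnorm_le_Xnorm(1)[OF f, of k] Bnorm_le_Ynorm(1)[OF g, of k] Bnorm_nonneg[OF ba, of k] Bnorm_nonneg[OF bb, of k] X0 K0
        by (intro mult_right_mono mult_mono) (auto simp: a_def b_def)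
      finally show ?thesis .
    qed
    have "\<bar>(LINT z|m. we.partial_expansion a (gT n) N z * we.partial_expansion b gf\<^sub>e N z) - (LINT z|m. f z) * (LINT z|m. g z)\<bar> \<le> 2 * K * (?X * ?Y)" for N
    proof -
      have sym: "mset I = mset J \<Longrightarrow> b I = b J" for I J using cb unfolding we.is_coeff_def by blast
      have "(LINT z|m. we.partial_expansion a (gT n) N z * we.partial_expansion b gf\<^sub>e N z) = (\<Sum>k\<le>N. t N k)"
        unfolding t_def by (rule we.partial_expansion_pairing[OF gT_Gfam sym])
      also have "\<dots> = t N 0 + (\<Sum>k<N. t N (Suc k))" by (rule sum.atMost_shift)
      \<comment> \<open>The term of degree zero is the product of the means, which the correlation
        subtracts; the remaining sum starts with the first power of \<open>K\<close>.\<close>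
      also have "t N 0 = (LINT z|m. f z) * (LINT z|m. g z)" by (simp add: t_def lsts_0 a0 b0)
      finally have "\<bar>(LINT z|m. we.partial_expansion a (gT n) N z * we.partial_expansion b gf\<^sub>e N z) - (LINT z|m. f z) * (LINT z|m. g z)\<bar>
         = \<bar>\<Sum>k<N. t N (Suc k)\<bar>" by simp
      also have "\<dots> \<le> (\<Sum>k<N. (?X * ?Y) * K ^ Suc k)"
        by (rule order_trans[OF sum_abs sum_mono]) (rule tb)
      also have "\<dots> = (?X * ?Y) * (K * (\<Sum>k<N. K ^ k))" by (simp add: sum_distrib_left)
      also have "\<dots> \<le> (?X * ?Y) * (K * 2)"
      proof (intro mult_left_mono)
        have "(\<Sum>k<N. K ^ k) \<le> (\<Sum>k<N. (1 / 2) ^ k)" using True K0 by (intro sum_mono power_mono)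
        also have "\<dots> \<le> (\<Sum>k. (1 / 2 :: real) ^ k)" by (intro sum_le_suminf summable_geometric) auto
        also have "\<dots> = 2" by (subst suminf_geometric) auto
        finally show "(\<Sum>k<N. K ^ k) \<le> 2" .
      qed (use K0 X0 Y0 in auto)
      finally show ?thesis by (simp add: mult_ac)
    qed
    moreover have "(\<lambda>N. \<bar>(LINT z|m. we.partial_expansion a (gT n) N z * we.partial_expansion b gf\<^sub>e N z) - (LINT z|m. f z) * (LINT z|m. g z)\<bar>)
       \<longlonglongrightarrow> \<bar>(LINT z|m. f ((T ^^ n) z) * g z) - (LINT z|m. f z) * (LINT z|m. g z)\<bar>"
      by (intro tendsto_rabs tendsto_diff tendsto_const correlation_limit[OF U fL gL ca cb])
    ultimately have "\<bar>Icorr T m n f g\<bar> \<le> 2 * K * (?X * ?Y)"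
      unfolding Icorr_def by (intro LIMSEQ_le_const2) auto
    also have "\<dots> \<le> 4 * K * (?X * ?Y)" using K0 X0 Y0 by (intro mult_right_mono) auto
    finally show ?thesis .
  next
    case False
    \<comment> \<open>Now \<open>1 < 2 * K\<close>, so the trivial bound by twice the product of the
      norms already lies below the claim.\<close>
    have le: "l2norm m f * l2norm m g \<le> ?X * ?Y"
      using Bnorm_le_Xnorm(2)[OF f] Bnorm_le_Ynorm(2)[OF g] X0 by (intro mult_mono l2norm_nonneg)
    have 1: "\<bar>LINT z|m. f ((T ^^ n) z) * g z\<bar> \<le> ?X * ?Y"
      using l2_Cauchy_Schwarz[OF L2R_Tn[OF U fL, of n] gL] le by (simp add: l2norm_Tn[OF U fL])
    have abs1: "\<bar>LINT z|m. h z\<bar> \<le> l2norm m h" if "h \<in> L2R m" for h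
      using pm.integral_abs_le_l2norm[OF that] integral_abs_bound[of m h] by linarith
    have "\<bar>(LINT z|m. f z) * (LINT z|m. g z)\<bar> \<le> l2norm m f * l2norm m g"
      unfolding abs_mult by (intro mult_mono abs1 fL gL l2norm_nonneg) simp
    then have "\<bar>Icorr T m n f g\<bar> \<le> 2 * (?X * ?Y)" using 1 le unfolding Icorr_def by linarith
    also have "\<dots> \<le> 4 * K * (?X * ?Y)" using False X0 Y0 by (intro mult_right_mono) auto
    finally show ?thesis .
  qed
  then show ?thesis by (simp add: K_def mult.assoc)
qed

lemma correlation_decay:
  "\<exists>t. 0 < t \<and> t < 1 \<and> (\<exists>D>0. \<forall>f\<in>\<X>. \<forall>g\<in>\<Y>. \<forall>n\<ge>1.
     \<bar>Icorr T m n f g\<bar> \<le> D * t ^ n * norm\<^sub>X f * norm\<^sub>Y g)"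
proof -
  obtain U where U: "open U" "sphere 0 1 \<subseteq> U" "analytic_vec_on cm E U"
    using Ean unfolding analytic_near_circle_def by blast
  then have nU: "analytic_nbhd U" by (simp add: analytic_nbhd_def)
  obtain s where s: "0 < s" "s < 1" and sub: "\<And>z. s \<le> cmod z \<Longrightarrow> cmod z \<le> 1 / s \<Longrightarrow> z \<in> U"
    using annulus_subset[OF U(1,2)] by blast
  define A where "A = cball (0::complex) (1 / s) - ball 0 s"
  have "compact A" unfolding A_def by (intro compact_diff) auto
  moreover have "A \<subseteq> U" unfolding A_def using sub by (auto simp: not_less)
  ultimately obtain B where B: "\<forall>z\<in>A. norm (E z) \<le> B" using analytic_vec_bounded[OF U(3)] by blast
  have B': "norm (E z) \<le> B" if "s \<le> cmod z" "cmod z \<le> 1 / s" for z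
    using B that by (simp add: A_def)
  \<comment> \<open>The summand \<open>1\<close> keeps \<open>D\<close> positive even if
    \<open>B\<close> is zero.\<close>
  define D where "D = 4 * (2 * B\<^sup>2) + 1"
  have "D > 0" by (simp add: D_def add_nonneg_pos)
  moreover have "\<bar>Icorr T m n f g\<bar> \<le> D * s ^ n * norm\<^sub>X f * norm\<^sub>Y g"
    if f: "f \<in> \<X>" and g: "g \<in> \<Y>" for f g n
  proof -
    have "0 \<le> norm\<^sub>X f" "0 \<le> norm\<^sub>Y g"
      using Bnorm_le_Xnorm(2)[OF f] Bnorm_le_Ynorm(2)[OF g] l2norm_nonneg[of m f] l2norm_nonneg[of m g] by linarith+
    then have "4 * (2 * B\<^sup>2 * s ^ n) * norm\<^sub>X f * norm\<^sub>Y g \<le> D * s ^ n * norm\<^sub>X f * norm\<^sub>Y g"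
      using s by (intro mult_right_mono) (auto simp: D_def algebra_simps)
    moreover have "\<bar>Icorr T m n f g\<bar> \<le> 4 * (2 * B\<^sup>2 * s ^ n) * norm\<^sub>X f * norm\<^sub>Y g"
      by (rule Icorr_bound[OF nU s _ _ f g]) (fact sub, fact B')
    ultimately show ?thesis by linarith
  qed
  ultimately show ?thesis using s by blast
qed

end

theorem theorem5p22:
  fixes cm :: "complex \<Rightarrow> 'h::banach \<Rightarrow> 'h"
    and ci :: "'h \<Rightarrow> 'h \<Rightarrow> complex"
    and T :: "'h \<Rightarrow> 'h"
    and E :: "complex \<Rightarrow> 'h"
    and R :: "'h \<Rightarrow> 'h"
    and m :: "'h measure"
    and e :: "nat \<Rightarrow> 'h"
    and \<sigma> :: "nat \<Rightarrow> real"
  assumes H: "chilbert cm ci"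
    and sep: "separable_space TYPE('h)"
    and infdim: "infinite_dim cm"
    and Tlin: "cbounded_linear cm T"
    and Efield: "eigenfield cm T E"
    and Espan: "mu_spanning cm E"
    and Ean: "analytic_near_circle cm E"
    and Rdef: "\<forall>x y. ci (R x) y = covf ci E x y"
    and gauss: "gaussian_cov ci R m"
    and onb: "\<forall>i\<ge>1. \<forall>j\<ge>1. ci (e i) (e j) = (if i = j then 1 else 0)"
    and onb_span: "closure (cspan cm (e ` {1..})) = UNIV"
    and eig: "\<forall>j\<ge>1. R (e j) = (2 * (\<sigma> j)\<^sup>2) *\<^sub>R e j"
  shows "\<exists>t. 0 < t \<and> t < 1 \<and> (\<exists>D>0. \<forall>f\<in>Xsp cm ci e \<sigma> m. \<forall>g\<in>Ysp cm ci e \<sigma> m. \<forall>n\<ge>1.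
           \<bar>Icorr T m n f g\<bar> \<le> D * t ^ n * Xnorm cm ci e \<sigma> m f * Ynorm cm ci e \<sigma> m g)"
proof -
  interpret gaussian_eigenfield cm ci e T E R m \<sigma>
    using H sep Tlin Efield Ean Rdef gauss onb onb_span eig by unfold_locales auto
  show ?thesis by (rule correlation_decay)
qed

end
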